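(* Let $\beta\in(-1,1)$. There exists $\omega_0>0$ (depending on $\beta$) such that for every $\omega\in(0,\omega_0)$, the only solutions $(\lambda,C_1,S_1,C_2,S_2,C_N,S_N,C_V,S_V)\in\mathbb{R}\times H^1(\mathbb{R})^4\times L^2(\mathbb{R})^4$ (all functions real-valued, and with the convention that $S_1=S_2=S_N=S_V=0$ when $\lambda=0$) of the system $$ \left\{\begin{aligned} L_-C_2&=\lambda S_1\\ L_+S_1&=\lambda C_2+QS_N\\ L_-S_2&=-\lambda C_1\\ L_+C_1&=-\lambda S_2+QC_N \end{aligned}\right. \qquad \left\{\begin{aligned} C_V'-\beta C_N'&=-\lambda\sqrt{\omega}\,(S_N+2QS_1)\\ S_V'-\beta S_N'&=\lambda\sqrt{\omega}\,(C_N+2QC_1)\\ C_N'-\beta C_V'&=-\lambda\sqrt{\omega}\,(S_V+2\beta QS_1)\\ S_N'-\beta S_V'&=\lambda\sqrt{\omega}\,(C_V+2\beta QC_1) \end{aligned}\right. $$ are $$\lambda=0,\quad C_1\in\operatorname{span}(Q'),\quad C_2\in\operatorname{span}(Q),\quad C_N=C_V=0,$$ and $$\lambda\in\mathbb{R},\quad C_1=S_1=C_2=S_2=C_N=S_N=C_V=S_V=0.$$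
   Context: $Q(y)=\frac{\sqrt2}{\cosh y}$, which satisfies $Q''+Q^3=Q$ on $\mathbb{R}$. $L_+=-\partial_y^2+1-3Q^2$ and $L_-=-\partial_y^2+1-Q^2$. Primes denote $\frac{d}{dy}$. The equations are understood in the sense of distributions on $\mathbb{R}$. *)

theory Defs
  imports "HOL-Analysis.Analysis"
begin

text \<open>
  Elements of \<open>L\<^sup>2\<close> and \<open>H\<^sup>1\<close> are represented by functions, and equality of elements by equality
  almost everywhere. The measure is the complete one (lebesgue rather than lborel), so that
  membership does not depend on the representative.
\<close>

abbreviation eq_ae :: "(real \<Rightarrow> real) \<Rightarrow> (real \<Rightarrow> real) \<Rightarrow> bool"
  where "eq_ae f g \<equiv> (AE y in lebesgue. f y = g y)"

definition L2 :: "(real \<Rightarrow> real) set"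
  where "L2 = {f. f \<in> borel_measurable lebesgue \<and> integrable lebesgue (\<lambda>y. (f y)\<^sup>2)}"

definition test_function :: "(real \<Rightarrow> real) \<Rightarrow> bool"
  where "test_function \<phi> \<longleftrightarrow>
    (\<forall>n y. ((deriv ^^ n) \<phi>) field_differentiable (at y)) \<and> compact (closure {y. \<phi> y \<noteq> 0})"

text \<open>
  A distribution is represented by its action on functions; only the values on test functions
  matter, and distributions are compared by \<open>dist_eq\<close>.
\<close>

type_synonym distribution = "(real \<Rightarrow> real) \<Rightarrow> real"

definition dist_eq :: "distribution \<Rightarrow> distribution \<Rightarrow> bool"
  where "dist_eq T U \<longleftrightarrow> (\<forall>\<phi>. test_function \<phi> \<longrightarrow> T \<phi> = U \<phi>)"

definition dist_of :: "(real \<Rightarrow> real) \<Rightarrow> distribution"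
  where "dist_of f = (\<lambda>\<phi>. \<integral>y. f y * \<phi> y \<partial>lebesgue)"

definition dist_deriv :: "distribution \<Rightarrow> distribution"
  where "dist_deriv T = (\<lambda>\<phi>. - T (deriv \<phi>))"

definition H1 :: "(real \<Rightarrow> real) set"
  where "H1 = {f \<in> L2. \<exists>g\<in>L2. dist_eq (dist_deriv (dist_of f)) (dist_of g)}"

definition Q :: "real \<Rightarrow> real"
  where "Q y = sqrt 2 / cosh y"

definition L_plus :: "(real \<Rightarrow> real) \<Rightarrow> distribution"
  where "L_plus f = (\<lambda>\<phi>. - dist_deriv (dist_deriv (dist_of f)) \<phi>
    + dist_of f \<phi> - dist_of (\<lambda>y. 3 * (Q y)\<^sup>2 * f y) \<phi>)"

definition L_minus :: "(real \<Rightarrow> real) \<Rightarrow> distribution"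
  where "L_minus f = (\<lambda>\<phi>. - dist_deriv (dist_deriv (dist_of f)) \<phi>
    + dist_of f \<phi> - dist_of (\<lambda>y. (Q y)\<^sup>2 * f y) \<phi>)"

text \<open>The distribution \<open>f' - \<beta> g'\<close>.\<close>

definition transport :: "real \<Rightarrow> (real \<Rightarrow> real) \<Rightarrow> (real \<Rightarrow> real) \<Rightarrow> distribution"
  where "transport \<beta> f g =
    (\<lambda>\<phi>. dist_deriv (dist_of f) \<phi> - \<beta> * dist_deriv (dist_of g) \<phi>)"

definition schroedinger_part ::
  "real \<Rightarrow> (real \<Rightarrow> real) \<Rightarrow> (real \<Rightarrow> real) \<Rightarrow> (real \<Rightarrow> real) \<Rightarrow> (real \<Rightarrow> real) \<Rightarrow>
    (real \<Rightarrow> real) \<Rightarrow> (real \<Rightarrow> real) \<Rightarrow> bool"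
  where "schroedinger_part l C1 S1 C2 S2 CN SN \<longleftrightarrow>
    dist_eq (L_minus C2) (dist_of (\<lambda>y. l * S1 y)) \<and>
    dist_eq (L_plus S1) (dist_of (\<lambda>y. l * C2 y + Q y * SN y)) \<and>
    dist_eq (L_minus S2) (dist_of (\<lambda>y. - l * C1 y)) \<and>
    dist_eq (L_plus C1) (dist_of (\<lambda>y. - l * S2 y + Q y * CN y))"

definition wave_part ::
  "real \<Rightarrow> real \<Rightarrow> real \<Rightarrow> (real \<Rightarrow> real) \<Rightarrow> (real \<Rightarrow> real) \<Rightarrow>
    (real \<Rightarrow> real) \<Rightarrow> (real \<Rightarrow> real) \<Rightarrow> (real \<Rightarrow> real) \<Rightarrow> (real \<Rightarrow> real) \<Rightarrow> bool"
  where "wave_part \<beta> \<omega> l C1 S1 CN SN CV SV \<longleftrightarrow>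
    dist_eq (transport \<beta> CV CN) (dist_of (\<lambda>y. - l * sqrt \<omega> * (SN y + 2 * Q y * S1 y))) \<and>
    dist_eq (transport \<beta> SV SN) (dist_of (\<lambda>y. l * sqrt \<omega> * (CN y + 2 * Q y * C1 y))) \<and>
    dist_eq (transport \<beta> CN CV) (dist_of (\<lambda>y. - l * sqrt \<omega> * (SV y + 2 * \<beta> * Q y * S1 y))) \<and>
    dist_eq (transport \<beta> SN SV) (dist_of (\<lambda>y. l * sqrt \<omega> * (CV y + 2 * \<beta> * Q y * C1 y)))"

end

theory Submission
  imports Defs "HOL-Real_Asymp.Real_Asymp" "HOL-Computational_Algebra.Polynomial"
begin

text \<open>
Put \<open>F = C1 + i S1\<close>, \<open>K = - S2 + i C2\<close>, \<open>Z = (CN + CV) + i (SN + SV)\<close> and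
\<open>W = (CN - CV) + i (SN - SV)\<close>. The eight real equations become
\<open>L_- K = l F\<close>, \<open>L_+ F = l K + Q N\<close> with \<open>N = (Z + W) / 2\<close>, and the two transport equations
\<open>Z' = i \<mu> (Z + 2 (1 + \<beta>) Q F)\<close>, \<open>W' = - i \<nu> (W + 2 (1 - \<beta>) Q F)\<close>, where
\<open>\<mu> = l sqrt \<omega> / (1 - \<beta>)\<close> and \<open>\<nu> = l sqrt \<omega> / (1 + \<beta>)\<close>. Complex conjugation changes the sign of
\<open>l\<close>, so for a nonzero frequency one may take \<open>l > 0\<close>; two ranges of \<open>l\<close> are then treated by
different arguments. In both of them a suitable bound for the solution is improved by a factor
\<open>1/2\<close>, and iterating shows that the solution is zero.

\<^emph>\<open>Bounded frequencies.\<close> With \<open>D = \<partial> + tanh\<close> one has \<open>D Q = 0\<close>, \<open>L_- = D* D\<close> and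
\<open>D\<^sup>2 L_+ L_- = (1 - \<partial>\<^sup>2)\<^sup>2 D\<^sup>2\<close>. Therefore \<open>g = D\<^sup>2 K\<close> satisfies the equation
\<open>(1 - \<partial>\<^sup>2)\<^sup>2 g - l\<^sup>2 g = l Q N''\<close>, in which the potentials have disappeared and only the source is left.
Integrating it and undoing \<open>D\<close> twice gives \<open>K = A + c1 y Q + c2 Q + Kr\<close> with \<open>Kr\<close>
controlled by the source, uniformly in \<open>l\<close> (\<open>expansion\<close>). The constant \<open>A\<close> is the threshold
resonance at \<open>l = 1\<close>; \<open>c1\<close> and \<open>c2\<close> are the Galilean and phase directions that appear as \<open>l\<close>
tends to \<open>0\<close>. The estimates on \<open>F\<close>, \<open>Z\<close>, \<open>W\<close> do not see \<open>c2\<close>. The other two constants are excluded by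
the transport equations: such an equation with \<open>\<mu> \<noteq> 0\<close> has a decaying solution only if its source
is orthogonal to \<open>exp (- i \<mu> y)\<close>. To leading order in \<open>\<mu>\<close>, \<open>\<nu>\<close>, the two orthogonality relations
and their difference say that \<open>K\<close> is orthogonal to \<open>Q'\<close> and to \<open>Q + 2 y Q'\<close>; on the span of
\<open>y Q\<close> and \<open>1\<close> these conditions are independent (\<open>coefficients_small\<close>). So everything is bounded
by the source \<open>Q N''\<close>, while \<open>N''\<close> is bounded by \<open>sqrt \<omega>\<close> times everything
(\<open>source_contraction\<close>).

\<^emph>\<open>Large frequencies.\<close> Now \<open>u = K + F\<close> oscillates with wave number \<open>sqrt (l - 1)\<close>, \<open>v = K - F\<close>
is elliptic and hence small, but \<open>Z\<close> can resonate with \<open>u\<close> when \<open>l \<omega>\<close> is of order one, so \<open>Z\<close> is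
not a perturbation. It is the Hamiltonian structure that helps: in the derivative of
\<open>|u'|\<^sup>2 + (l - 1) |u|\<^sup>2 + |Z|\<^sup>2 / (2 (1 + \<beta>)) + |W|\<^sup>2 / (2 (1 - \<beta>)) + Re (Q (cnj u) (Z + W))\<close>
the resonant terms cancel exactly (\<open>energy_deriv\<close>). What remains is small in comparison with the
energy itself and exponentially localised, and the energy vanishes at infinity
(\<open>high_frequency\<close>).

\<^emph>\<open>Regularity.\<close> The distributional system is reduced to a classical one by the lemma of
du Bois-Reymond: a function in \<open>L\<^sup>2\<close> with a weak derivative in \<open>L\<^sup>2\<close> is almost everywhere
equal to a primitive of that derivative (\<open>weak_derivative_representative\<close>). Iterating this along the system shows that
all components have continuously differentiable representatives that vanish at infinity.

At \<open>l = 0\<close> the system decouples: the transport equations give constants in \<open>L\<^sup>2\<close>, and Wronskians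
identify the kernels of \<open>L_-\<close> and \<open>L_+\<close> among decaying functions.
\<close>

section \<open>Comparison estimates on the line\<close>

text \<open>
Multiplying by \<open>exp (- c t)\<close>, which does not increase norms to the right because \<open>Re c \<ge> 0\<close>,
removes the linear term. The comparison function \<open>m\<close> stands for the integral of the source
over \<open>[t, \<infinity>)\<close>, so that no integral has to be formed.
\<close>

lemma norm_le_by_integrating_factor:
  fixes w r :: "real \<Rightarrow> complex" and m m' :: "real \<Rightarrow> real" and c :: complex
  assumes w: "\<And>t. (w has_vector_derivative (c * w t + r t)) (at t)"
    and m: "\<And>t. (m has_real_derivative m' t) (at t)"
    and r: "\<And>t. x \<le> t \<Longrightarrow> t \<le> s \<Longrightarrow> exp (- Re c * (t - x)) * cmod (r t) \<le> - m' t"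
    and c: "0 \<le> Re c" and "x \<le> s"
  shows "cmod (w x) \<le> cmod (w s) + m x - m s"
proof (cases "x = s")
  case False
  define \<phi> where "\<phi> t = exp (- c * of_real (t - x)) * w t" for t
  have d: "(\<phi> has_vector_derivative exp (- c * of_real (t - x)) * r t) (at t)" for t
    unfolding \<phi>_def
    by (rule derivative_eq_intros w has_vector_derivative_real_field | simp add: algebra_simps)+
  have n: "cmod (exp (- c * of_real (t - x))) = exp (- Re c * (t - x))" for t
    by (simp add: norm_exp_eq_Re)
  have "continuous_on {x..s} \<phi>"
    using has_vector_derivative_continuous[OF d] by (auto intro!: continuous_at_imp_continuous_on)
  moreover have "continuous_on {x..s} (\<lambda>t. - m t)"
    using DERIV_isCont[OF m] by (auto intro!: continuous_at_imp_continuous_on continuous_minus)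
  ultimately
  have "cmod (\<phi> s - \<phi> x) \<le> - m s - - m x"
    by (intro differentiable_bound_general[where \<phi>' = "\<lambda>t. - m' t"
          and f' = "\<lambda>t. exp (- c * of_real (t - x)) * r t"])
       (use False \<open>x \<le> s\<close> d r n m in \<open>auto simp: norm_mult has_real_derivative_iff_has_vector_derivative[symmetric] intro!: DERIV_minus\<close>)
  moreover have "\<phi> x = w x" by (simp add: \<phi>_def)
  moreover have "cmod (\<phi> s) \<le> cmod (w s)"
    using c \<open>x \<le> s\<close> n[of s] by (simp add: \<phi>_def norm_mult mult_left_le_one_le)
  ultimately show ?thesis
    using norm_triangle_ineq2[of "\<phi> x" "\<phi> s"] by (simp add: norm_minus_commute)
qed simp

lemma norm_le_of_vanishing_at_top:
  fixes w r :: "real \<Rightarrow> complex" and m m' :: "real \<Rightarrow> real" and c :: complex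
  assumes w: "\<And>t. (w has_vector_derivative (c * w t + r t)) (at t)"
    and m: "\<And>t. (m has_real_derivative m' t) (at t)" "\<And>t. 0 \<le> m t"
    and r: "\<And>t. x \<le> t \<Longrightarrow> exp (- Re c * (t - x)) * cmod (r t) \<le> - m' t"
    and c: "0 \<le> Re c" and lim: "(w \<longlongrightarrow> 0) at_top"
  shows "cmod (w x) \<le> m x"
proof (rule tendsto_lowerbound)
  show "((\<lambda>s. cmod (w s) + m x) \<longlongrightarrow> m x) at_top"
    using tendsto_add[OF tendsto_norm[OF lim] tendsto_const] by simp
  show "\<forall>\<^sub>F s in at_top. cmod (w x) \<le> cmod (w s) + m x"
    using eventually_ge_at_top[of x]
  proof eventually_elim
    case (elim s)
    then show ?case
      using norm_le_by_integrating_factor[OF w m(1) r c elim] m(2)[of s] by force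
  qed
qed simp

text \<open>
With \<open>Re c \<ge> 0\<close> the homogeneous solutions do not decay to the right, so a solution vanishing there
is determined by the source.
\<close>

lemma exp_decay_right:
  fixes w r :: "real \<Rightarrow> complex" and c :: complex
  assumes w: "\<And>t. (w has_vector_derivative (c * w t + r t)) (at t)"
    and r: "\<And>t. cmod (r t) \<le> B * exp (- a * \<bar>t\<bar>)" and a: "0 < a"
    and c: "0 \<le> Re c" and lim: "(w \<longlongrightarrow> 0) at_top" and x: "0 \<le> x"
  shows "cmod (w x) \<le> B / a * exp (- a * \<bar>x\<bar>)"
proof -
  have B: "0 \<le> B" using order_trans[OF norm_ge_zero r[of 0]] by simp
  have "cmod (w x) \<le> B / a * exp (- a * x)"
  proof (rule norm_le_of_vanishing_at_top[OF w _ _ _ c lim, where m' = "\<lambda>t. - B * exp (- a * t)"])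
    show "((\<lambda>t. B / a * exp (- a * t)) has_real_derivative - B * exp (- a * t)) (at t)" for t
      using a by (auto intro!: derivative_eq_intros)
    show "exp (- Re c * (t - x)) * cmod (r t) \<le> - (- B * exp (- a * t))" if "x \<le> t" for t
    proof -
      have "exp (- Re c * (t - x)) \<le> 1" using c that by simp
      then have "exp (- Re c * (t - x)) * cmod (r t) \<le> 1 * cmod (r t)"
        by (intro mult_right_mono) auto
      then show ?thesis using r[of t] that x by simp
    qed
  qed (use a B in auto)
  then show ?thesis using x by simp
qed

lemma bounded_of_exp_source:
  fixes w r :: "real \<Rightarrow> complex" and c :: complex
  assumes w: "\<And>t. (w has_vector_derivative (c * w t + r t)) (at t)"
    and r: "\<And>t. cmod (r t) \<le> B * exp (- a * \<bar>t\<bar>)" and a: "0 < a"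
    and c: "0 \<le> Re c" and lim: "(w \<longlongrightarrow> 0) at_top"
  shows "cmod (w x) \<le> 2 * B / a"
proof -
  have B: "0 \<le> B" using order_trans[OF norm_ge_zero r[of 0]] by simp
  have pos: "cmod (w x) \<le> B / a" if "0 \<le> x" for x
  proof -
    have "B / a * exp (- a * \<bar>x\<bar>) \<le> B / a * 1"
      using a B by (intro mult_left_mono) auto
    then show ?thesis using exp_decay_right[OF w r a c lim that] by simp
  qed
  show ?thesis
  proof (cases "0 \<le> x")
    case False
    have "cmod (w x) \<le> cmod (w 0) + (- B / a * exp (a * x)) - (- B / a * exp (a * 0))"
    proof (rule norm_le_by_integrating_factor[OF w _ _ c, where m' = "\<lambda>t. - B * exp (a * t)"])
      show "((\<lambda>t. - B / a * exp (a * t)) has_real_derivative - B * exp (a * t)) (at t)" for t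
        using a by (auto intro!: derivative_eq_intros)
      show "exp (- Re c * (t - x)) * cmod (r t) \<le> - (- B * exp (a * t))" if "x \<le> t" "t \<le> 0" for t
      proof -
        have "exp (- Re c * (t - x)) \<le> 1" using c that by simp
        then have "exp (- Re c * (t - x)) * cmod (r t) \<le> 1 * cmod (r t)"
          by (intro mult_right_mono) auto
        then show ?thesis using r[of t] that by simp
      qed
    qed (use False in auto)
    moreover have "0 \<le> B / a * exp (a * x)" using B a by simp
    ultimately show ?thesis using pos[of 0] by simp
  qed (use pos[of x] B a in \<open>auto simp: field_simps\<close>)
qed

lemma has_vector_derivative_reflect:
  fixes w :: "real \<Rightarrow> 'a::real_normed_vector"
  assumes "\<And>t. (w has_vector_derivative w' t) (at t)"
  shows "((\<lambda>t. w (- t)) has_vector_derivative - w' (- t)) (at t)"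
  using vector_diff_chain_at[of uminus "-1" t w "w' (- t)"] assms
  by (simp add: o_def has_vector_derivative_minus has_vector_derivative_id)

lemma tendsto_reflect: "(w \<longlongrightarrow> l) at_bot \<Longrightarrow> ((\<lambda>t::real. w (- t)) \<longlongrightarrow> l) at_top"
  by (rule filterlim_compose[OF _ filterlim_uminus_at_bot_at_top])

lemma bounded_of_exp_source':
  fixes w r :: "real \<Rightarrow> complex" and c :: complex
  assumes w: "\<And>t. (w has_vector_derivative (- c * w t + r t)) (at t)"
    and r: "\<And>t. cmod (r t) \<le> B * exp (- a * \<bar>t\<bar>)" and a: "0 < a"
    and c: "0 \<le> Re c" and lim: "(w \<longlongrightarrow> 0) at_bot"
  shows "cmod (w x) \<le> 2 * B / a"
proof -
  have "cmod (w (- (- x))) \<le> 2 * B / a"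
    by (rule bounded_of_exp_source[where w = "\<lambda>t. w (- t)" and r = "\<lambda>t. - r (- t)" and x = "- x",
          OF _ _ a c tendsto_reflect[OF lim]])
       (use has_vector_derivative_reflect[OF w] r[of "- t" for t] in auto)
  then show ?thesis by simp
qed

lemma exp_decay:
  fixes w r :: "real \<Rightarrow> complex" and c :: complex
  assumes w: "\<And>t. (w has_vector_derivative (c * w t + r t)) (at t)"
    and r: "\<And>t. cmod (r t) \<le> B * exp (- a * \<bar>t\<bar>)" and a: "0 < a"
    and c: "Re c = 0" and lim: "(w \<longlongrightarrow> 0) at_top" "(w \<longlongrightarrow> 0) at_bot"
  shows "cmod (w x) \<le> B / a * exp (- a * \<bar>x\<bar>)"
proof (cases "0 \<le> x")
  case True
  then show ?thesis using exp_decay_right[OF w r a _ lim(1)] c by simp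
next
  case False
  have "cmod (w (- (- x))) \<le> B / a * exp (- a * \<bar>- x\<bar>)"
    by (rule exp_decay_right[where w = "\<lambda>t. w (- t)" and r = "\<lambda>t. - r (- t)" and x = "- x" and c = "- c",
          OF _ _ a _ tendsto_reflect[OF lim(2)]])
       (use has_vector_derivative_reflect[OF w] r[of "- t" for t] c False in auto)
  then show ?thesis by simp
qed

text \<open>
The gain \<open>1 / \<kappa>\<close> over the supremum of the source comes from the exponential growth of the
homogeneous solution.
\<close>

lemma bounded_of_bounded_source:
  fixes w r :: "real \<Rightarrow> complex" and \<kappa> :: real
  assumes w: "\<And>t. (w has_vector_derivative (of_real \<kappa> * w t + r t)) (at t)"
    and r: "\<And>t. cmod (r t) \<le> B" and \<kappa>: "0 < \<kappa>" and lim: "(w \<longlongrightarrow> 0) at_top"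
  shows "\<kappa> * cmod (w x) \<le> B"
proof -
  have B: "0 \<le> B" using order_trans[OF norm_ge_zero r[of 0]] by simp
  have "cmod (w x) \<le> B / \<kappa> * exp (- \<kappa> * (x - x))"
    by (rule norm_le_of_vanishing_at_top[OF w _ _ _ _ lim, where m' = "\<lambda>t. - B * exp (- \<kappa> * (t - x))"])
       (use \<kappa> B r in \<open>auto intro!: derivative_eq_intros mult_left_mono simp: mult.commute\<close>)
  then show ?thesis using \<kappa> by (simp add: field_simps)
qed

text \<open>
The resolvent bound of \<open>- \<partial>\<^sup>2 + \<kappa>\<^sup>2\<close> in the supremum norm, obtained from the factors
\<open>v' + \<kappa> v\<close> and \<open>v' - \<kappa> v\<close>, which satisfy first-order equations to be integrated from the two
opposite ends of the line.
\<close>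

lemma resolvent_bound:
  fixes v v' r :: "real \<Rightarrow> complex" and \<kappa> :: real
  assumes v: "\<And>t. (v has_vector_derivative v' t) (at t)"
    and v': "\<And>t. (v' has_vector_derivative (of_real (\<kappa>\<^sup>2) * v t + r t)) (at t)"
    and r: "\<And>t. cmod (r t) \<le> B" and \<kappa>: "0 < \<kappa>"
    and top: "(v \<longlongrightarrow> 0) at_top" "(v' \<longlongrightarrow> 0) at_top"
    and bot: "(v \<longlongrightarrow> 0) at_bot" "(v' \<longlongrightarrow> 0) at_bot"
  shows "\<kappa>\<^sup>2 * cmod (v x) \<le> B"
proof -
  have w: "\<kappa> * cmod (v' x + of_real \<kappa> * v x) \<le> B"
  proof (rule bounded_of_bounded_source[where r = r, OF _ r \<kappa>])
    show "((\<lambda>t. v' t + of_real \<kappa> * v t) has_vector_derivative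
        of_real \<kappa> * (v' t + of_real \<kappa> * v t) + r t) (at t)" for t
      by (rule derivative_eq_intros v v' | simp add: algebra_simps power2_eq_square)+
    show "((\<lambda>t. v' t + of_real \<kappa> * v t) \<longlongrightarrow> 0) at_top"
      using tendsto_add[OF top(2) tendsto_mult_left[OF top(1), of "of_real \<kappa>"]] by simp
  qed
  have z: "\<kappa> * cmod (v' x - of_real \<kappa> * v x) \<le> B"
  proof -
    have d: "((\<lambda>t. v' t - of_real \<kappa> * v t) has_vector_derivative
        - of_real \<kappa> * (v' t - of_real \<kappa> * v t) + r t) (at t)" for t
      by (rule derivative_eq_intros v v' | simp add: algebra_simps power2_eq_square)+
    have l: "((\<lambda>t. v' t - of_real \<kappa> * v t) \<longlongrightarrow> 0) at_bot"
      using tendsto_diff[OF bot(2) tendsto_mult_left[OF bot(1), of "of_real \<kappa>"]] by simp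
    have "\<kappa> * cmod (v' (- (- x)) - of_real \<kappa> * v (- (- x))) \<le> B"
      by (rule bounded_of_bounded_source[where w = "\<lambda>t. v' (- t) - of_real \<kappa> * v (- t)"
            and r = "\<lambda>t. - r (- t)", OF _ _ \<kappa> tendsto_reflect[OF l]])
         (use has_vector_derivative_reflect[OF d] r in auto)
    then show ?thesis by simp
  qed
  have "2 * of_real \<kappa> * v x = (v' x + of_real \<kappa> * v x) - (v' x - of_real \<kappa> * v x)"
    by simp
  then have "cmod (2 * of_real \<kappa> * v x) \<le> cmod (v' x + of_real \<kappa> * v x) + cmod (v' x - of_real \<kappa> * v x)"
    using norm_triangle_ineq4 by metis
  then have "2 * \<kappa> * cmod (v x) \<le> cmod (v' x + of_real \<kappa> * v x) + cmod (v' x - of_real \<kappa> * v x)"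
    using \<kappa> by (simp add: norm_mult)
  then have "\<kappa> * (2 * \<kappa> * cmod (v x)) \<le> B + B"
    using w z \<kappa> mult_left_mono[of _ _ \<kappa>] by (smt (verit) distrib_left)
  then show ?thesis by (simp add: power2_eq_square)
qed

text \<open>
The constant \<open>c\<close> is real for an elliptic equation, imaginary for an oscillating one, and zero at
the threshold between them. In contrast to \<open>a\<close> itself, the derivative \<open>a'\<close> is bounded
uniformly across this transition.
\<close>

lemma derivative_bound_of_exp_source:
  fixes a a' \<rho> :: "real \<Rightarrow> complex" and c :: complex
  assumes a: "\<And>t. (a has_vector_derivative a' t) (at t)"
    and a': "\<And>t. (a' has_vector_derivative (c\<^sup>2 * a t - \<rho> t)) (at t)"
    and \<rho>: "\<And>t. cmod (\<rho> t) \<le> M * exp (- \<bar>t\<bar>)" and c: "0 \<le> Re c"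
    and top: "(a \<longlongrightarrow> 0) at_top" "(a' \<longlongrightarrow> 0) at_top"
    and bot: "(a \<longlongrightarrow> 0) at_bot" "(a' \<longlongrightarrow> 0) at_bot"
  shows "cmod (a' x) \<le> 2 * M" and "cmod (c * a x) \<le> 2 * M"
proof -
  have w: "cmod (a' x + c * a x) \<le> 2 * M / 1"
  proof (rule bounded_of_exp_source[where r = "\<lambda>t. - \<rho> t" and c = c])
    show "((\<lambda>t. a' t + c * a t) has_vector_derivative c * (a' t + c * a t) + - \<rho> t) (at t)" for t
      by (rule derivative_eq_intros a a' | simp add: algebra_simps power2_eq_square)+
    show "((\<lambda>t. a' t + c * a t) \<longlongrightarrow> 0) at_top"
      using tendsto_add[OF top(2) tendsto_mult_left[OF top(1), of c]] by simp
  qed (use \<rho> c in auto)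
  have z: "cmod (a' x - c * a x) \<le> 2 * M / 1"
  proof (rule bounded_of_exp_source'[where r = "\<lambda>t. - \<rho> t" and c = c])
    show "((\<lambda>t. a' t - c * a t) has_vector_derivative - c * (a' t - c * a t) + - \<rho> t) (at t)" for t
      by (rule derivative_eq_intros a a' | simp add: algebra_simps power2_eq_square)+
    show "((\<lambda>t. a' t - c * a t) \<longlongrightarrow> 0) at_bot"
      using tendsto_diff[OF bot(2) tendsto_mult_left[OF bot(1), of c]] by simp
  qed (use \<rho> c in auto)
  have "2 * a' x = (a' x + c * a x) + (a' x - c * a x)" by simp
  then have "cmod (2 * a' x) \<le> cmod (a' x + c * a x) + cmod (a' x - c * a x)"
    using norm_triangle_ineq by metis
  then show "cmod (a' x) \<le> 2 * M" using w z by (simp add: norm_mult)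
  have "2 * (c * a x) = (a' x + c * a x) - (a' x - c * a x)" by simp
  then have "cmod (2 * (c * a x)) \<le> cmod (a' x + c * a x) + cmod (a' x - c * a x)"
    using norm_triangle_ineq4 by metis
  then show "cmod (c * a x) \<le> 2 * M" using w z by (simp add: norm_mult)
qed

section \<open>The soliton profile and exponential weights\<close>

lemma Q_has_derivative: "(Q has_real_derivative - tanh y * Q y) (at y)"
  unfolding Q_def [abs_def] tanh_def
  by (rule derivative_eq_intros refl | simp add: power2_eq_square)+

lemma tanh_has_derivative: "(tanh has_real_derivative 1 - (tanh y)\<^sup>2) (at (y::real))"
  by (rule derivative_eq_intros refl | simp)+

lemma Q_squared: "(Q y)\<^sup>2 = 2 * (1 - (tanh y)\<^sup>2)"
proof -
  have "(tanh y)\<^sup>2 = ((cosh y)\<^sup>2 - 1) / (cosh y)\<^sup>2"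
    by (simp add: tanh_def power_divide cosh_square_eq)
  then show ?thesis by (simp add: Q_def power_divide diff_divide_distrib)
qed

lemma Q_pos: "0 < Q y" by (simp add: Q_def)

lemma Q_le_exp: "Q y \<le> 3 * exp (- \<bar>y\<bar>)"
proof -
  have "exp \<bar>y\<bar> \<le> 2 * cosh y"
  proof -
    have "2 * cosh \<bar>y\<bar> = exp \<bar>y\<bar> + exp (- \<bar>y\<bar>)" by (simp add: cosh_def)
    then show ?thesis by (simp add: cosh_real_abs)
  qed
  then have "1 \<le> 2 * cosh y * exp (- \<bar>y\<bar>)"
    by (simp add: exp_minus field_simps)
  moreover have "sqrt 2 \<le> 3 / 2"
    by (rule real_le_lsqrt) (auto simp: power2_eq_square)
  ultimately have "sqrt 2 \<le> 3 / 2 * (2 * cosh y * exp (- \<bar>y\<bar>))"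
    by linarith
  then show ?thesis by (simp add: Q_def field_simps)
qed

text \<open>
The profile functions enter as complex factors everywhere below; \<open>Tc\<close> and \<open>Qc\<close> turn the
verification of derivatives into polynomial algebra modulo \<open>Qc_squared\<close>.
\<close>

definition Tc :: "real \<Rightarrow> complex" where "Tc y = of_real (tanh y)"
definition Qc :: "real \<Rightarrow> complex" where "Qc y = of_real (Q y)"

lemma Tc_deriv: "(Tc has_vector_derivative 1 - Tc y * Tc y) (at y)"
  using has_vector_derivative_of_real[OF tanh_has_derivative[of y]]
  by (simp add: Tc_def [abs_def] power2_eq_square)

lemma Qc_deriv: "(Qc has_vector_derivative - Tc y * Qc y) (at y)"
  using has_vector_derivative_of_real[OF Q_has_derivative[of y]]
  by (simp add: Tc_def Qc_def [abs_def])

lemma Qc_squared: "Qc y * Qc y = 2 * (1 - Tc y * Tc y)"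
proof -
  have "of_real ((Q y)\<^sup>2) = (of_real (2 * (1 - (tanh y)\<^sup>2)) :: complex)"
    by (simp only: Q_squared)
  then show ?thesis by (simp add: Tc_def Qc_def power2_eq_square)
qed

lemma norm_Tc: "cmod (Tc y) \<le> 1"
  using tanh_real_bounds[of y] by (auto simp: Tc_def)

lemma norm_Qc: "cmod (Qc y) = Q y" using Q_pos[of y] by (simp add: Qc_def)

lemma Q_le_3_2: "Q y \<le> 3/2"
proof -
  have "sqrt 2 \<le> 3 / 2"
    by (rule real_le_lsqrt) (auto simp: power2_eq_square)
  moreover have "Q y \<le> sqrt 2 / 1"
    unfolding Q_def by (rule divide_left_mono) (use cosh_real_ge_1[of y] in auto)
  ultimately show ?thesis by simp
qed

lemma Qc_vanishes: "(Qc \<longlongrightarrow> 0) at_infinity"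
proof (rule Lim_null_comparison)
  show "\<forall>\<^sub>F y in at_infinity. cmod (Qc y) \<le> 3 * exp (- \<bar>y\<bar>)"
    using Q_le_exp norm_Qc by simp
  have "((\<lambda>y. exp (- norm y)) \<longlongrightarrow> 0) (at_infinity :: real filter)"
    by (rule filterlim_compose[OF exp_at_bot])
       (simp only: filterlim_uminus_at_bot minus_minus filterlim_norm_at_top)
  then show "((\<lambda>y. 3 * exp (- \<bar>y\<bar>)) \<longlongrightarrow> 0) (at_infinity :: real filter)"
    using tendsto_mult_right_zero by force
qed

lemma tendsto_zero_bounded_mult:
  fixes f g :: "real \<Rightarrow> complex"
  assumes "\<And>y. cmod (f y) \<le> C" and "(g \<longlongrightarrow> 0) A"
  shows "((\<lambda>y. f y * g y) \<longlongrightarrow> 0) A"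
proof (rule Lim_null_comparison)
  show "\<forall>\<^sub>F y in A. cmod (f y * g y) \<le> C * cmod (g y)"
    using assms(1) by (simp add: norm_mult mult_right_mono)
  show "((\<lambda>y. C * cmod (g y)) \<longlongrightarrow> 0) A"
    using tendsto_mult_right_zero[OF tendsto_norm_zero[OF assms(2)]] .
qed

lemma tendsto_at_infinityD:
  fixes f :: "real \<Rightarrow> 'a::topological_space"
  assumes "(f \<longlongrightarrow> l) at_infinity"
  shows "(f \<longlongrightarrow> l) at_top" "(f \<longlongrightarrow> l) at_bot"
  by (rule tendsto_mono[OF _ assms], simp add: at_infinity_eq_at_top_bot)+

lemma poly_exp_half: "(1 + \<bar>y\<bar>) * exp (- \<bar>y\<bar>) \<le> 2 * exp (- (1/2) * \<bar>y\<bar>)"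
  and poly_exp_quarter: "(1 + \<bar>y\<bar>) * exp (- (1/2) * \<bar>y\<bar>) \<le> 4 * exp (- (1/4) * \<bar>y\<bar>)"
  and poly2_exp: "(1 + \<bar>y\<bar>)\<^sup>2 * exp (- \<bar>y\<bar>) \<le> 16 * exp (- (1/4) * \<bar>y\<bar>)" for y :: real
proof -
  have half: "1 + \<bar>y\<bar> \<le> 2 * exp (\<bar>y\<bar> / 2)" using exp_ge_add_one_self[of "\<bar>y\<bar> / 2"] by linarith
  have quarter: "1 + \<bar>y\<bar> \<le> 4 * exp (\<bar>y\<bar> / 4)" using exp_ge_add_one_self[of "\<bar>y\<bar> / 4"] by linarith
  show "(1 + \<bar>y\<bar>) * exp (- \<bar>y\<bar>) \<le> 2 * exp (- (1/2) * \<bar>y\<bar>)"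
    using mult_right_mono[OF half, of "exp (- \<bar>y\<bar>)"] by (simp add: mult.assoc exp_add[symmetric])
  show "(1 + \<bar>y\<bar>) * exp (- (1/2) * \<bar>y\<bar>) \<le> 4 * exp (- (1/4) * \<bar>y\<bar>)"
    using mult_right_mono[OF quarter, of "exp (- (1/2) * \<bar>y\<bar>)"] by (simp add: mult.assoc exp_add[symmetric])
  have "(1 + \<bar>y\<bar>)\<^sup>2 \<le> (4 * exp (\<bar>y\<bar> / 4))\<^sup>2" by (intro power_mono quarter) auto
  also have "\<dots> = 16 * exp (\<bar>y\<bar> / 2)" by (simp add: power2_eq_square exp_add[symmetric])
  finally have "(1 + \<bar>y\<bar>)\<^sup>2 * exp (- \<bar>y\<bar>) \<le> 16 * exp (\<bar>y\<bar> / 2) * exp (- \<bar>y\<bar>)"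
    by (intro mult_right_mono) auto
  also have "\<dots> \<le> 16 * exp (- (1/4) * \<bar>y\<bar>)"
    by (simp add: exp_add[symmetric])
  finally show "(1 + \<bar>y\<bar>)\<^sup>2 * exp (- \<bar>y\<bar>) \<le> 16 * exp (- (1/4) * \<bar>y\<bar>)" .
qed

text \<open>
This inverts the operator \<open>D = \<partial> + tanh\<close> with the solution normalised at \<open>0\<close>: since
\<open>cosh\<close> is an integrating factor, dividing by it costs nothing in the growth rate.
\<close>

lemma linear_growth:
  fixes f r :: "real \<Rightarrow> complex"
  assumes f: "\<And>y. (f has_vector_derivative (r y - Tc y * f y)) (at y)" and f0: "f 0 = 0"
    and r: "\<And>y. cmod (r y) \<le> M * (1 + \<bar>y\<bar>)"
  shows "cmod (f y) \<le> M * (1 + \<bar>y\<bar>)"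
proof -
  have M: "0 \<le> M" using order_trans[OF norm_ge_zero r[of 0]] by simp
  have pos: "cmod (f y) \<le> M * (1 + \<bar>y\<bar>)"
    if f: "\<And>y. (f has_vector_derivative (r y - Tc y * f y)) (at y)" and f0: "f 0 = 0"
      and r: "\<And>y. cmod (r y) \<le> M * (1 + \<bar>y\<bar>)" and "0 \<le> y" for f r y
  proof (cases "y = 0")
    case False
    define C :: "real \<Rightarrow> complex" where "C y = of_real (cosh y)" for y
    have C: "(C has_vector_derivative C y * Tc y) (at y)" for y
    proof -
      have "(cosh has_real_derivative cosh y * tanh y) (at y)"
        by (rule derivative_eq_intros refl | simp add: tanh_def)+
      from has_vector_derivative_of_real[OF this] show ?thesis
        by (simp add: C_def [abs_def] Tc_def)
    qed
    have d: "((\<lambda>y. C y * f y) has_vector_derivative C y * r y) (at y)" for y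
      by (rule has_vector_derivative_eq_rhs, (rule has_vector_derivative_mult C f)+)
         (simp add: algebra_simps)
    have m: "((\<lambda>y. M * (1 + y) * sinh y) has_vector_derivative M * sinh y + M * (1 + y) * cosh y) (at y)" for y
      unfolding has_real_derivative_iff_has_vector_derivative[symmetric]
      by (rule derivative_eq_intros refl | simp add: algebra_simps)+
    have "cmod (C y * f y - C 0 * f 0) \<le> M * (1 + y) * sinh y - M * (1 + 0) * sinh 0"
    proof (rule differentiable_bound_general)
      show "continuous_on {0..y} (\<lambda>y. C y * f y)"
        using has_vector_derivative_continuous[OF d] by (auto intro!: continuous_at_imp_continuous_on)
      show "continuous_on {0..y} (\<lambda>y. M * (1 + y) * sinh y)"
        by (intro continuous_intros)
      show "cmod (C x * r x) \<le> M * sinh x + M * (1 + x) * cosh x" if "0 < x" "x < y" for x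
      proof -
        have "cosh x * cmod (r x) \<le> cosh x * (M * (1 + x))"
          using r[of x] that by (intro mult_left_mono) auto
        moreover have "0 \<le> M * sinh x" using M that by simp
        ultimately show ?thesis by (simp add: C_def norm_mult algebra_simps)
      qed
    qed (use d m False \<open>0 \<le> y\<close> in auto)
    then have "cosh y * cmod (f y) \<le> M * (1 + y) * sinh y"
      by (simp add: f0 C_def norm_mult)
    also have "\<dots> \<le> M * (1 + y) * cosh y"
      using M \<open>0 \<le> y\<close> sinh_le_cosh_real[of y] by (intro mult_left_mono) auto
    finally have "cosh y * cmod (f y) \<le> cosh y * (M * (1 + y))" by (simp add: algebra_simps)
    then show ?thesis using \<open>0 \<le> y\<close> by simp
  qed (use M f0 in simp)
  show ?thesis
  proof (cases "0 \<le> y")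
    case False
    have "cmod (- f (- (- y))) \<le> M * (1 + \<bar>- y\<bar>)"
    proof (rule pos[where r = "\<lambda>y. r (- y)" and f = "\<lambda>y. - f (- y)"])
      show "((\<lambda>y. - f (- y)) has_vector_derivative r (- x) - Tc x * - f (- x)) (at x)" for x
        using has_vector_derivative_minus[OF has_vector_derivative_reflect[OF f], of x]
        by (simp add: Tc_def add.commute)
    qed (use f0 r[of "- x" for x] False in auto)
    then show ?thesis by simp
  qed (use pos[OF f f0 r] in simp)
qed

text \<open>
This replaces the evaluation of an integral over the line: \<open>\<integral> f' = 0\<close> for a function vanishing at both
ends, so \<open>A \<integral> q'\<close> equals \<open>- \<integral> e\<close>. The difference \<open>q y - q (- y)\<close> stands for \<open>\<integral> q'\<close>.
\<close>

lemma coefficient_bound: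
  fixes f e :: "real \<Rightarrow> complex" and A :: complex and q q' :: "real \<Rightarrow> real"
  assumes f: "\<And>y. (f has_vector_derivative (A * of_real (q' y) + e y)) (at y)"
    and q: "\<And>y. (q has_real_derivative q' y) (at y)"
    and e: "\<And>y. cmod (e y) \<le> B * exp (- a * \<bar>y\<bar>)" and a: "0 < a"
    and lim: "(f \<longlongrightarrow> 0) at_infinity"
    and gap: "\<forall>\<^sub>F y in at_top. d \<le> \<bar>q y - q (- y)\<bar>"
  shows "cmod A * d \<le> 2 * B / a"
proof -
  have B: "0 \<le> B" using order_trans[OF norm_ge_zero e[of 0]] by simp
  define g where "g y = f y - A * of_real (q y)" for y
  have g: "(g has_vector_derivative e y) (at y)" for y
    unfolding g_def
    by (rule has_vector_derivative_eq_rhs,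
       (rule has_vector_derivative_diff has_vector_derivative_mult f has_vector_derivative_const
          has_vector_derivative_of_real q)+) simp
  have half: "cmod (g y - g 0) \<le> B / a"
    if g: "\<And>y. (g has_vector_derivative e y) (at y)"
      and e: "\<And>y. cmod (e y) \<le> B * exp (- a * \<bar>y\<bar>)" and "0 < y" for g e y
  proof -
    have m: "((\<lambda>y. - B / a * exp (- a * y)) has_vector_derivative B * exp (- a * y)) (at y)" for y
      unfolding has_real_derivative_iff_has_vector_derivative[symmetric]
      by (rule derivative_eq_intros refl | use a in simp)+
    have "cmod (g y - g 0) \<le> - B / a * exp (- a * y) - - B / a * exp (- a * 0)"
    proof (rule differentiable_bound_general)
      show "continuous_on {0..y} g"
        using has_vector_derivative_continuous[OF g] by (auto intro!: continuous_at_imp_continuous_on)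
      show "continuous_on {0..y} (\<lambda>y. - B / a * exp (- a * y))"
        by (intro continuous_intros)
      show "cmod (e x) \<le> B * exp (- a * x)" if "0 < x" "x < y" for x
        using e[of x] that by simp
    qed (use g m \<open>0 < y\<close> in auto)
    moreover have "0 \<le> B / a * exp (- a * y)" using B a by simp
    ultimately show ?thesis by simp
  qed
  have "cmod (g y - g (- y)) \<le> 2 * B / a" if "0 < y" for y
  proof -
    have "cmod (g (- y) - g (- 0)) \<le> B / a"
      by (rule half[where g = "\<lambda>y. g (- y)" and e = "\<lambda>y. - e (- y)", OF _ _ that])
         (use has_vector_derivative_reflect[OF g] e[of "- x" for x] in auto)
    moreover have "cmod (g y - g 0) \<le> B / a" by (rule half[OF g e that])
    ultimately show ?thesis
      using norm_triangle_ineq4[of "g y - g 0" "g (- y) - g 0"] by simp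
  qed
  note gdiff = this
  have "((\<lambda>y. 2 * B / a + cmod (f y) + cmod (f (- y))) \<longlongrightarrow> 2 * B / a + 0 + 0) at_top"
    by (intro tendsto_intros tendsto_norm_zero tendsto_at_infinityD[OF lim]
        tendsto_reflect)
  moreover have "\<forall>\<^sub>F y in at_top. cmod A * d \<le> 2 * B / a + cmod (f y) + cmod (f (- y))"
    using gap eventually_gt_at_top[of 0]
  proof eventually_elim
    case (elim y)
    have "A * of_real (q y - q (- y)) = f y - f (- y) - (g y - g (- y))"
      by (simp add: g_def algebra_simps)
    then have "cmod A * \<bar>q y - q (- y)\<bar> = cmod (f y - f (- y) - (g y - g (- y)))"
      by (metis norm_mult norm_of_real)
    also have "\<dots> \<le> cmod (f y) + cmod (f (- y)) + cmod (g y - g (- y))"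
      by (metis add_right_mono norm_triangle_ineq4 order_trans)
    finally have "cmod A * \<bar>q y - q (- y)\<bar> \<le> cmod (f y) + cmod (f (- y)) + 2 * B / a"
      using gdiff[OF elim(2)] by simp
    moreover have "cmod A * d \<le> cmod A * \<bar>q y - q (- y)\<bar>"
      using elim by (intro mult_left_mono) auto
    ultimately show ?case by simp
  qed
  ultimately have "cmod A * d \<le> 2 * B / a + 0 + 0"
    by (rule tendsto_lowerbound) simp
  then show ?thesis by simp
qed

section \<open>Removing the potentials from the complexified system\<close>

lemmas vderiv_intros = has_vector_derivative_mult has_vector_derivative_add
  has_vector_derivative_diff has_vector_derivative_minus has_vector_derivative_const
  Tc_deriv Qc_deriv

text \<open>
The parameters \<open>a\<close> and \<open>b\<close> are \<open>1 + \<beta>\<close> and \<open>1 - \<beta>\<close>. The relation of \<open>\<mu>\<close> and \<open>\<nu>\<close> to \<open>l\<close> and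
\<open>\<omega>\<close> enters later, only through the bounds \<open>\<mu> \<le> s l\<close> and \<open>\<nu> \<le> s l\<close>.
\<close>

locale zakharov_mode =
  fixes l \<mu> \<nu> a b :: real and K K' F F' Z W :: "real \<Rightarrow> complex"
  assumes l: "0 < l" and \<mu>: "0 < \<mu>" and \<nu>: "0 < \<nu>" and a: "0 < a" "a < 2" and b: "0 < b" "b < 2"
    and K: "(K has_vector_derivative K' y) (at y)"
    and K': "(K' has_vector_derivative (K y - Qc y * Qc y * K y - of_real l * F y)) (at y)"
    and F: "(F has_vector_derivative F' y) (at y)"
    and F': "(F' has_vector_derivative
      (F y - 3 * Qc y * Qc y * F y - of_real l * K y - Qc y * ((Z y + W y) / 2))) (at y)"
    and Z: "(Z has_vector_derivative \<i> * of_real \<mu> * (Z y + 2 * of_real a * Qc y * F y)) (at y)"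
    and W: "(W has_vector_derivative - \<i> * of_real \<nu> * (W y + 2 * of_real b * Qc y * F y)) (at y)"
    and lim: "(K \<longlongrightarrow> 0) at_infinity" "(K' \<longlongrightarrow> 0) at_infinity"
      "(F \<longlongrightarrow> 0) at_infinity" "(F' \<longlongrightarrow> 0) at_infinity"
      "(Z \<longlongrightarrow> 0) at_infinity" "(W \<longlongrightarrow> 0) at_infinity"
begin

text \<open>
\<open>N'\<close> and \<open>N''\<close> are the first two derivatives of \<open>N\<close>, with the derivatives of \<open>Z\<close> and \<open>W\<close>
substituted from the equations.
\<close>

definition N where "N y = (Z y + W y) / 2"
definition Z' where "Z' y = \<i> * of_real \<mu> * (Z y + 2 * of_real a * Qc y * F y)"
definition W' where "W' y = - \<i> * of_real \<nu> * (W y + 2 * of_real b * Qc y * F y)"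
definition Z'' where "Z'' y = \<i> * of_real \<mu> * (Z' y + 2 * of_real a * Qc y * (F' y - Tc y * F y))"
definition W'' where "W'' y = - \<i> * of_real \<nu> * (W' y + 2 * of_real b * Qc y * (F' y - Tc y * F y))"
definition N' where "N' y = (Z' y + W' y) / 2"
definition N'' where "N'' y = (Z'' y + W'' y) / 2"

text \<open>
\<open>gK\<close> is \<open>D\<^sup>2 K\<close> with \<open>D = \<partial> + tanh\<close>, and \<open>gF\<close> is \<open>(1 - \<partial>\<^sup>2) gK / l\<close>; in both, second
derivatives of \<open>K\<close> and \<open>F\<close> are eliminated by means of the equations, which also disposes of the division by
\<open>l\<close>. The primed functions are their derivatives.
\<close>

definition gK where "gK y = 2 * Tc y * K' y + 2 * Tc y * Tc y * K y - of_real l * F y"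
definition gK' where "gK' y = 2 * K' y + 2 * Tc y * K y - 2 * of_real l * Tc y * F y - of_real l * F' y"
definition gF where "gF y = 2 * Tc y * F' y + (4 * Tc y * Tc y - 2) * F y - of_real l * K y - Qc y * N y"
definition gF' where "gF' y = 2 * Tc y * Tc y * F' y + (4 * Tc y * Tc y * Tc y - 2 * Tc y) * F y
   - 2 * of_real l * Tc y * K y - of_real l * K' y - Tc y * Qc y * N y - Qc y * N' y"

lemma vanish:
  assumes "(f \<longlongrightarrow> 0) at_infinity"
  shows "((\<lambda>y. Tc y * f y) \<longlongrightarrow> 0) at_infinity" "((\<lambda>y. Qc y * f y) \<longlongrightarrow> 0) at_infinity"
    "((\<lambda>y. c * f y) \<longlongrightarrow> (0::complex)) at_infinity"
  using tendsto_zero_bounded_mult[OF norm_Tc assms]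
    tendsto_zero_bounded_mult[of Qc "3/2", OF _ assms] norm_Qc Q_le_3_2
    tendsto_mult_right_zero[OF assms] by auto

lemma vanish_add_diff:
  fixes f g :: "real \<Rightarrow> complex"
  assumes "(f \<longlongrightarrow> 0) at_infinity" "(g \<longlongrightarrow> 0) at_infinity"
  shows "((\<lambda>y. f y + g y) \<longlongrightarrow> 0) at_infinity" "((\<lambda>y. f y - g y) \<longlongrightarrow> 0) at_infinity"
  using tendsto_add[OF assms] tendsto_diff[OF assms] by auto

lemma N_lim: "(N \<longlongrightarrow> 0) at_infinity" "(N' \<longlongrightarrow> 0) at_infinity"
proof -
  show "(N \<longlongrightarrow> 0) at_infinity"
    using vanish(3)[OF vanish_add_diff(1)[OF lim(5,6)], of "1/2"]
    by (simp add: N_def [abs_def])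
  have "((\<lambda>y. \<i> * of_real \<mu> / 2 * (Z y + 2 * of_real a * (Qc y * F y)) +
      - \<i> * of_real \<nu> / 2 * (W y + 2 * of_real b * (Qc y * F y))) \<longlongrightarrow> 0) at_infinity"
    by (intro vanish vanish_add_diff lim)
  then show "(N' \<longlongrightarrow> 0) at_infinity"
    by (simp add: N'_def [abs_def] Z'_def W'_def add_divide_distrib diff_divide_distrib mult.assoc)
qed

lemma gK_gF_lim:
  "(gK \<longlongrightarrow> 0) at_infinity" "(gK' \<longlongrightarrow> 0) at_infinity"
  "(gF \<longlongrightarrow> 0) at_infinity" "(gF' \<longlongrightarrow> 0) at_infinity"
proof -
  have "((\<lambda>y. 2 * (Tc y * K' y) + 2 * (Tc y * (Tc y * K y)) - of_real l * F y) \<longlongrightarrow> 0) at_infinity"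
    by (intro vanish vanish_add_diff lim)
  then show "(gK \<longlongrightarrow> 0) at_infinity" by (simp add: gK_def [abs_def] algebra_simps)
  have "((\<lambda>y. 2 * K' y + 2 * (Tc y * K y) - 2 * of_real l * (Tc y * F y) - of_real l * F' y) \<longlongrightarrow> 0) at_infinity"
    by (intro vanish vanish_add_diff lim)
  then show "(gK' \<longlongrightarrow> 0) at_infinity" by (simp add: gK'_def [abs_def] algebra_simps)
  have "((\<lambda>y. 2 * (Tc y * F' y) + (4 * (Tc y * (Tc y * F y)) - 2 * F y) - of_real l * K y - Qc y * N y) \<longlongrightarrow> 0) at_infinity"
    by (intro vanish vanish_add_diff lim N_lim)
  then show "(gF \<longlongrightarrow> 0) at_infinity" by (simp add: gF_def [abs_def] algebra_simps)
  have "((\<lambda>y. 2 * (Tc y * (Tc y * F' y)) + (4 * (Tc y * (Tc y * (Tc y * F y))) - 2 * (Tc y * F y))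
      - 2 * of_real l * (Tc y * K y) - of_real l * K' y - Tc y * (Qc y * N y) - Qc y * N' y) \<longlongrightarrow> 0) at_infinity"
    by (intro vanish vanish_add_diff lim N_lim)
  then show "(gF' \<longlongrightarrow> 0) at_infinity" by (simp add: gF'_def [abs_def] algebra_simps)
qed

lemma N_deriv: "(N has_vector_derivative N' y) (at y)"
proof -
  have "((\<lambda>y. (1/2) * (Z y + W y)) has_vector_derivative N' y) (at y)"
    by (rule has_vector_derivative_eq_rhs, (rule vderiv_intros Z W)+)
       (simp add: N'_def Z'_def W'_def field_simps)
  then show ?thesis by (simp add: N_def [abs_def])
qed

lemma N'_deriv: "(N' has_vector_derivative N'' y) (at y)"
proof -
  have "((\<lambda>y. (1/2) * (\<i> * of_real \<mu> * (Z y + 2 * of_real a * Qc y * F y) +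
     - \<i> * of_real \<nu> * (W y + 2 * of_real b * Qc y * F y))) has_vector_derivative N'' y) (at y)"
    by (rule has_vector_derivative_eq_rhs, (rule vderiv_intros Z W F)+)
       (simp add: N''_def Z''_def W''_def Z'_def W'_def field_simps)
  then show ?thesis by (simp add: N'_def [abs_def] Z'_def W'_def)
qed

lemma gK_deriv: "(gK has_vector_derivative gK' y) (at y)"
  unfolding gK_def [abs_def]
  apply (rule has_vector_derivative_eq_rhs, (rule vderiv_intros K K' F)+)
  unfolding gK'_def using Qc_squared[of y] by algebra

lemma gK'_deriv: "(gK' has_vector_derivative gK y - of_real l * gF y) (at y)"
  unfolding gK'_def [abs_def]
  apply (rule has_vector_derivative_eq_rhs, (rule vderiv_intros K K' F F')+)
  unfolding gK_def gF_def N_def [symmetric] using Qc_squared[of y] by algebra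

lemma gF_deriv: "(gF has_vector_derivative gF' y) (at y)"
  unfolding gF_def [abs_def]
  apply (rule has_vector_derivative_eq_rhs, (rule vderiv_intros K K' F F' N_deriv)+)
  unfolding gF'_def N_def [symmetric] using Qc_squared[of y] by algebra

text \<open>
Together with \<open>gK'_deriv\<close> this is the identity \<open>D\<^sup>2 L_+ L_- = (1 - \<partial>\<^sup>2)\<^sup>2 D\<^sup>2\<close>. The source
\<open>Q N\<close> has become \<open>Q N''\<close> because \<open>D (Q h) = Q h'\<close>.
\<close>

lemma gF'_deriv: "(gF' has_vector_derivative gF y - of_real l * gK y - Qc y * N'' y) (at y)"
  unfolding gF'_def [abs_def]
  apply (rule has_vector_derivative_eq_rhs, (rule vderiv_intros K K' F F' N_deriv N'_deriv)+)
  unfolding gK_def gF_def N_def [symmetric] using Qc_squared[of y] by algebra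


text \<open>
The sum and the difference of \<open>gF\<close> and \<open>gK\<close> satisfy decoupled equations with spectral parameters
\<open>1 - l\<close> and \<open>1 + l\<close>. The second one is elliptic. The first one passes the threshold at
\<open>l = 1\<close>, where its solution may become large, but nearly constant: hence only the deviation from
its value at \<open>0\<close> is estimated.
\<close>

lemma transform_bounds:
  assumes \<rho>: "\<And>y. cmod (Qc y * N'' y) \<le> M * exp (- \<bar>y\<bar>)"
  shows "cmod (gK' y) \<le> 2 * M" and "cmod (gK y - (gF 0 + gK 0) / 2) \<le> M * (1 + \<bar>y\<bar>)"
proof -
  have d1: "((\<lambda>y. gF y + gK y) has_vector_derivative (gF' t + gK' t)) (at t)" for t
    by (rule vderiv_intros gK_deriv gF_deriv)+
  have \<alpha>: "cmod (gF' t + gK' t) \<le> 2 * M" for t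
  proof (rule derivative_bound_of_exp_source(1)[where a = "\<lambda>y. gF y + gK y" and a' = "\<lambda>y. gF' y + gK' y"
        and c = "csqrt (1 - of_real l)" and \<rho> = "\<lambda>y. Qc y * N'' y", OF d1 _ \<rho>])
    show "((\<lambda>y. gF' y + gK' y) has_vector_derivative
        (csqrt (1 - of_real l))\<^sup>2 * (gF t + gK t) - Qc t * N'' t) (at t)" for t
      by (rule has_vector_derivative_eq_rhs, (rule vderiv_intros gK'_deriv gF'_deriv)+)
         (simp add: algebra_simps)
    show "0 \<le> Re (csqrt (1 - of_real l))" by (rule Re_csqrt)
  qed (intro tendsto_at_infinityD vanish_add_diff gK_gF_lim)+
  have d2: "((\<lambda>y. gF y - gK y) has_vector_derivative (gF' t - gK' t)) (at t)" for t
    by (rule vderiv_intros gK_deriv gF_deriv)+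
  have d2': "((\<lambda>y. gF' y - gK' y) has_vector_derivative
        (of_real (sqrt (1 + l)))\<^sup>2 * (gF t - gK t) - Qc t * N'' t) (at t)" for t
  proof -
    have "(of_real (sqrt (1 + l)))\<^sup>2 = (1 + of_real l :: complex)"
      using l by (simp flip: of_real_power)
    then show ?thesis
      by - (rule has_vector_derivative_eq_rhs, (rule vderiv_intros gK'_deriv gF'_deriv)+,
         simp add: algebra_simps)
  qed
  have lims: "((\<lambda>y. gF y - gK y) \<longlongrightarrow> 0) at_top" "((\<lambda>y. gF' y - gK' y) \<longlongrightarrow> 0) at_top"
      "((\<lambda>y. gF y - gK y) \<longlongrightarrow> 0) at_bot" "((\<lambda>y. gF' y - gK' y) \<longlongrightarrow> 0) at_bot"
    by (intro tendsto_at_infinityD vanish_add_diff gK_gF_lim)+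
  have "0 \<le> Re (of_real (sqrt (1 + l)))" using l by simp
  note \<beta>_bounds = derivative_bound_of_exp_source[where a = "\<lambda>y. gF y - gK y" and a' = "\<lambda>y. gF' y - gK' y"
        and \<rho> = "\<lambda>y. Qc y * N'' y", OF d2 d2' \<rho> this lims]
  have \<beta>: "cmod (gF t - gK t) \<le> 2 * M" for t
  proof -
    have "1 \<le> sqrt (1 + l)" using l by simp
    then have "1 * cmod (gF t - gK t) \<le> sqrt (1 + l) * cmod (gF t - gK t)"
      by (intro mult_right_mono) auto
    also have "\<dots> = cmod (of_real (sqrt (1 + l)) * (gF t - gK t))"
      using l by (simp add: norm_mult)
    finally show ?thesis using \<beta>_bounds(2)[of t] by simp
  qed
  have "2 * gK' y = (gF' y + gK' y) - (gF' y - gK' y)" by simp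
  then have "2 * cmod (gK' y) \<le> cmod (gF' y + gK' y) + cmod (gF' y - gK' y)"
    by (metis norm_triangle_ineq4 norm_mult norm_numeral)
  then show "cmod (gK' y) \<le> 2 * M" using \<alpha>[of y] \<beta>_bounds(1)[of y] by simp
  have "cmod ((gF y + gK y) - (gF 0 + gK 0)) \<le> 2 * M * norm (y - 0)"
    using \<alpha> by (intro differentiable_bound[where f' = "\<lambda>t h. h *\<^sub>R (gF' t + gK' t)" and S = UNIV]
        d1[unfolded has_vector_derivative_def] onorm_le) (auto simp: mult.commute intro: mult_left_mono)
  moreover have "2 * (g - x / 2) = ((h + g) - x) - (h - g)" for g h x :: complex by simp
  from this[of "gK y" "gF 0 + gK 0" "gF y"]
  have "2 * cmod (gK y - (gF 0 + gK 0) / 2) \<le> cmod ((gF y + gK y) - (gF 0 + gK 0)) + cmod (gF y - gK y)"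
    by (metis norm_triangle_ineq4 norm_mult norm_numeral)
  ultimately show "cmod (gK y - (gF 0 + gK 0) / 2) \<le> M * (1 + \<bar>y\<bar>)"
    using \<beta>[of y] by (simp add: algebra_simps)
qed

definition Y :: "real \<Rightarrow> complex" where "Y y = of_real y"

lemma Y_deriv: "(Y has_vector_derivative 1) (at y)"
  using has_vector_derivative_of_real[OF DERIV_ident[of "at y"]] by (simp add: Y_def [abs_def])

text \<open>
Undoing \<open>D\<close> twice. The constant \<open>A\<close> satisfies \<open>D\<^sup>2 A = A\<close>, and \<open>D (y Q) = Q\<close>, \<open>D Q = 0\<close> account for the two
integration constants. In terms of \<open>h = D K\<close>, both \<open>l F = 2 tanh h - gK\<close> and its derivative are free
of second derivatives, and they do not involve \<open>c2\<close>.
\<close>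

lemma expansion:
  assumes \<rho>: "\<And>y. cmod (Qc y * N'' y) \<le> M * exp (- \<bar>y\<bar>)"
  obtains A c1 c2 Kr S where "S = cmod A + cmod c1 + M"
    "\<And>y. K y = A + c1 * Y y * Qc y + c2 * Qc y + Kr y"
    "\<And>y. cmod (Kr y) \<le> M * (1 + \<bar>y\<bar>)"
    "\<And>y. l * cmod (F y) \<le> 7 * S * (1 + \<bar>y\<bar>)"
    "\<And>y. l * cmod (F' y) \<le> 22 * S * (1 + \<bar>y\<bar>)"
proof -
  have M: "0 \<le> M" using order_trans[OF norm_ge_zero \<rho>[of 0]] by simp
  define A where "A = (gF 0 + gK 0) / 2"
  define h where "h y = K' y + Tc y * K y" for y
  have Q0: "Qc 0 \<noteq> 0" using Q_pos[of 0] by (simp add: Qc_def)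
  have T0: "Tc 0 = 0" by (simp add: Tc_def)
  define c1 where "c1 = h 0 / Qc 0"
  define c2 where "c2 = (K 0 - A) / Qc 0"
  define hr where "hr y = h y - A * Tc y - c1 * Qc y" for y
  define Kr where "Kr y = K y - A - c1 * Y y * Qc y - c2 * Qc y" for y
  define S where "S = cmod A + cmod c1 + M"
  have h_deriv: "(h has_vector_derivative gK y - Tc y * h y) (at y)" for y
    unfolding h_def [abs_def]
    apply (rule has_vector_derivative_eq_rhs, (rule vderiv_intros K K')+)
    unfolding gK_def using Qc_squared[of y] by algebra
  have lF: "of_real l * F y = 2 * Tc y * h y - gK y" for y
    by (simp add: gK_def h_def algebra_simps)
  have lF': "of_real l * F' y = 2 * h y - 2 * Tc y * (of_real l * F y) - gK' y" for y
    by (simp add: gK'_def h_def algebra_simps)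
  have hr: "cmod (hr y) \<le> M * (1 + \<bar>y\<bar>)" for y
  proof (rule linear_growth[where r = "\<lambda>y. gK y - A"])
    show "(hr has_vector_derivative gK y - A - Tc y * hr y) (at y)" for y
      unfolding hr_def [abs_def]
      by (rule has_vector_derivative_eq_rhs, (rule vderiv_intros h_deriv)+) (simp add: algebra_simps)
    show "hr 0 = 0" using Q0 by (simp add: hr_def c1_def T0)
    show "cmod (gK y - A) \<le> M * (1 + \<bar>y\<bar>)" for y
      unfolding A_def by (rule transform_bounds(2)[OF \<rho>])
  qed
  have Kr: "cmod (Kr y) \<le> M * (1 + \<bar>y\<bar>)" for y
  proof (rule linear_growth[where r = hr])
    show "(Kr has_vector_derivative hr y - Tc y * Kr y) (at y)" for y
      unfolding Kr_def [abs_def]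
      by (rule has_vector_derivative_eq_rhs, (rule vderiv_intros K Y_deriv)+)
         (simp add: algebra_simps hr_def h_def)
    show "Kr 0 = 0" using Q0 by (simp add: Kr_def c2_def Y_def)
  qed (rule hr)
  have S: "0 \<le> S" "cmod A \<le> S" "cmod c1 \<le> S" "M \<le> S" using M by (simp_all add: S_def)
  have one: "x \<le> x * (1 + \<bar>y\<bar>)" if "0 \<le> x" for x y :: real
    using mult_left_mono[of 1 "1 + \<bar>y\<bar>" x] that by simp
  have hb: "cmod (h y) \<le> 2 * S * (1 + \<bar>y\<bar>)" for y
  proof -
    have "h y = hr y + A * Tc y + c1 * Qc y" by (simp add: hr_def)
    then have "cmod (h y) \<le> cmod (hr y) + cmod A * cmod (Tc y) + cmod c1 * cmod (Qc y)"
      by (metis (no_types, opaque_lifting) norm_mult norm_triangle_ineq order_trans add_right_mono)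
    also have "\<dots> \<le> M * (1 + \<bar>y\<bar>) + cmod A * 1 + cmod c1 * (3/2)"
      using hr norm_Tc norm_Qc Q_le_3_2 by (intro add_mono mult_left_mono) auto
    also have "\<dots> \<le> M * (1 + \<bar>y\<bar>) + cmod A * 2 * (1 + \<bar>y\<bar>) + cmod c1 * 2 * (1 + \<bar>y\<bar>)"
      by (intro add_mono order_refl order_trans[OF _ one]) auto
    also have "\<dots> \<le> 2 * S * (1 + \<bar>y\<bar>)"
      using one[of M y] M by (simp add: S_def algebra_simps)
    finally show ?thesis .
  qed
  have Gb: "cmod (gK y) \<le> S * (1 + \<bar>y\<bar>)" for y
  proof -
    have "cmod (gK y) \<le> cmod (gK y - A) + cmod A"
      by (metis diff_add_cancel norm_triangle_ineq)
    also have "\<dots> \<le> M * (1 + \<bar>y\<bar>) + cmod A * (1 + \<bar>y\<bar>)"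
      using transform_bounds(2)[OF \<rho>, of y] one[of "cmod A" y] by (simp add: A_def)
    also have "\<dots> \<le> S * (1 + \<bar>y\<bar>)" by (simp add: S_def algebra_simps)
    finally show ?thesis .
  qed
  have Tcm: "cmod (Tc y * z) \<le> cmod z" for y z
    using mult_right_mono[OF norm_Tc[of y], of "cmod z"] by (simp add: norm_mult)
  have Fb: "cmod (of_real l * F y) \<le> 7 * S * (1 + \<bar>y\<bar>)" for y
  proof -
    have "cmod (of_real l * F y) \<le> 2 * cmod (Tc y * h y) + cmod (gK y)"
      using norm_triangle_ineq4[of "2 * (Tc y * h y)" "gK y"] by (simp add: lF norm_mult mult.assoc)
    then show ?thesis using Tcm[of y "h y"] hb[of y] Gb[of y] S(1) one[of S y] by simp
  qed
  have F'b: "cmod (of_real l * F' y) \<le> 22 * S * (1 + \<bar>y\<bar>)" for y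
  proof -
    have "cmod (of_real l * F' y) \<le> cmod (2 * h y - 2 * Tc y * (of_real l * F y)) + cmod (gK' y)"
      unfolding lF' by (rule norm_triangle_ineq4)
    also have "cmod (2 * h y - 2 * Tc y * (of_real l * F y)) \<le> 2 * cmod (h y) + 2 * cmod (Tc y * (of_real l * F y))"
      using norm_triangle_ineq4[of "2 * h y" "2 * (Tc y * (of_real l * F y))"] by (simp add: norm_mult mult.assoc)
    also have "cmod (Tc y * (of_real l * F y)) \<le> 7 * S * (1 + \<bar>y\<bar>)"
      using Tcm Fb order_trans by blast
    finally show ?thesis using hb[of y] transform_bounds(1)[OF \<rho>, of y] one[of S y] S by simp
  qed
  show ?thesis
  proof (rule that[of S A c1 c2 Kr])
    show "l * cmod (F y) \<le> 7 * S * (1 + \<bar>y\<bar>)" "l * cmod (F' y) \<le> 22 * S * (1 + \<bar>y\<bar>)" for y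
      using Fb[of y] F'b[of y] l by (simp_all add: norm_mult)
  qed (use Kr in \<open>simp_all add: S_def Kr_def\<close>)
qed

end

text \<open>
The factor \<open>s\<close> comes from \<open>\<mu> \<le> s l\<close>: the transport source \<open>\<mu> Q F\<close> is \<open>s\<close> times the quantity
\<open>l F\<close>, which stays bounded as \<open>l\<close> tends to \<open>0\<close> although \<open>F\<close> itself need not. The second bound is the one
for \<open>Z''\<close>.
\<close>

lemma wave_bounds:
  fixes Z F F' :: "real \<Rightarrow> complex" and l \<mu> a s S :: real
  assumes Z: "\<And>y. (Z has_vector_derivative \<i> * of_real \<mu> * (Z y + 2 * of_real a * Qc y * F y)) (at y)"
    and lim: "(Z \<longlongrightarrow> 0) at_infinity"
    and F: "\<And>y. l * cmod (F y) \<le> 7 * S * (1 + \<bar>y\<bar>)" "\<And>y. l * cmod (F' y) \<le> 22 * S * (1 + \<bar>y\<bar>)"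
    and \<mu>: "\<bar>\<mu>\<bar> \<le> s * l" "\<bar>\<mu>\<bar> \<le> 1" and s: "0 \<le> s" and l: "0 \<le> l" and a: "0 < a" "a < 2" and S: "0 \<le> S"
  shows "cmod (Z y) \<le> 336 * s * S"
    and "cmod (\<i> * of_real \<mu> * (\<i> * of_real \<mu> * (Z y + 2 * of_real a * Qc y * F y)
      + 2 * of_real a * Qc y * (F' y - Tc y * F y))) \<le> 1200 * s * S"
proof -
  have src: "cmod (\<i> * of_real \<mu> * (2 * of_real a * Qc y * f)) \<le> 24 * s * C * exp (- (1/2) * \<bar>y\<bar>)"
    if "l * cmod f \<le> C * (1 + \<bar>y\<bar>)" "0 \<le> C" for f C y
  proof -
    have "cmod (\<i> * of_real \<mu> * (2 * of_real a * Qc y * f)) = \<bar>\<mu>\<bar> * (2 * a) * (Q y * cmod f)"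
      using a by (simp add: norm_mult norm_Qc)
    also have "\<dots> \<le> (s * l) * 4 * (Q y * cmod f)"
      using \<mu> a Q_pos[of y] by (intro mult_right_mono mult_mono) auto
    also have "\<dots> = 4 * s * Q y * (l * cmod f)" by simp
    also have "\<dots> \<le> 4 * s * Q y * (C * (1 + \<bar>y\<bar>))"
      using that s Q_pos[of y] by (intro mult_left_mono) auto
    also have "\<dots> = 4 * s * (C * (1 + \<bar>y\<bar>)) * Q y" by simp
    also have "\<dots> \<le> 4 * s * (C * (1 + \<bar>y\<bar>)) * (3 * exp (- \<bar>y\<bar>))"
      using Q_le_exp[of y] s that by (intro mult_left_mono) auto
    also have "\<dots> = 12 * s * C * ((1 + \<bar>y\<bar>) * exp (- \<bar>y\<bar>))" by simp
    also have "\<dots> \<le> 12 * s * C * (2 * exp (- (1/2) * \<bar>y\<bar>))"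
      using poly_exp_half[of y] s that by (intro mult_left_mono) auto
    finally show ?thesis by simp
  qed
  have le1: "x * exp (- (1/2) * \<bar>y\<bar>) \<le> x" if "0 \<le> x" for x y :: real
    using mult_left_mono[of "exp (- (1/2) * \<bar>y\<bar>)" 1 x] that by simp
  have "cmod (Z y) \<le> 168 * s * S / (1/2) * exp (- (1/2) * \<bar>y\<bar>)"
  proof (rule exp_decay[where c = "\<i> * of_real \<mu>" and r = "\<lambda>y. \<i> * of_real \<mu> * (2 * of_real a * Qc y * F y)"])
    show "(Z has_vector_derivative \<i> * of_real \<mu> * Z t
         + \<i> * of_real \<mu> * (2 * of_real a * Qc t * F t)) (at t)" for t
      using Z[of t] by (simp add: distrib_left)
    show "cmod (\<i> * of_real \<mu> * (2 * of_real a * Qc t * F t)) \<le> 168 * s * S * exp (- (1/2) * \<bar>t\<bar>)" for t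
      using src[of "F t" "7 * S" t] F S by simp
  qed (use tendsto_at_infinityD[OF lim] in auto)
  also have "\<dots> \<le> 336 * s * S" using le1[of "336 * s * S" y] s S by simp
  finally show Zb: "cmod (Z y) \<le> 336 * s * S" .
  have m1: "cmod (\<i> * of_real \<mu> * z) \<le> cmod z" for z
    using mult_right_mono[OF \<mu>(2), of "cmod z"] by (simp add: norm_mult)
  have "cmod (\<i> * of_real \<mu> * (2 * of_real a * Qc y * F y)) \<le> 168 * s * S"
    using src[of "F y" "7 * S" y] F S le1[of "168 * s * S" y] s by simp
  then have Z': "cmod (\<i> * of_real \<mu> * (Z y + 2 * of_real a * Qc y * F y)) \<le> 504 * s * S"
    using m1[of "Z y"] Zb norm_triangle_ineq[of "\<i> * of_real \<mu> * Z y" "\<i> * of_real \<mu> * (2 * of_real a * Qc y * F y)"]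
    by (simp add: distrib_left)
  have "l * cmod (F' y - Tc y * F y) \<le> 29 * S * (1 + \<bar>y\<bar>)"
  proof -
    have "cmod (F' y - Tc y * F y) \<le> cmod (F' y) + 1 * cmod (F y)"
      using norm_triangle_ineq4[of "F' y" "Tc y * F y"] mult_right_mono[OF norm_Tc[of y], of "cmod (F y)"]
      by (simp add: norm_mult)
    then have "l * cmod (F' y - Tc y * F y) \<le> l * (cmod (F' y) + 1 * cmod (F y))"
      using l by (rule mult_left_mono)
    then show ?thesis using F[of y] by (simp add: algebra_simps)
  qed
  from src[OF this] have "cmod (\<i> * of_real \<mu> * (2 * of_real a * Qc y * (F' y - Tc y * F y))) \<le> 696 * s * S"
    using S s le1[of "696 * s * S" y] by simp
  then show "cmod (\<i> * of_real \<mu> * (\<i> * of_real \<mu> * (Z y + 2 * of_real a * Qc y * F y)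
      + 2 * of_real a * Qc y * (F' y - Tc y * F y))) \<le> 1200 * s * S"
    using m1[of "\<i> * of_real \<mu> * (Z y + 2 * of_real a * Qc y * F y)"] Z'
      norm_triangle_ineq[of "\<i> * of_real \<mu> * (\<i> * of_real \<mu> * (Z y + 2 * of_real a * Qc y * F y))"
        "\<i> * of_real \<mu> * (2 * of_real a * Qc y * (F' y - Tc y * F y))"]
    by (simp only: distrib_left)
qed

section \<open>Bounded frequencies\<close>

text \<open>
The function increment tends to \<open>- 4 = - \<integral> Q\<^sup>2\<close>.
\<close>

lemma gap_V: "\<forall>\<^sub>F y in at_top. 2 \<le> \<bar>(y * (Q y)\<^sup>2 - 2 * tanh y) - ((- y) * (Q (- y))\<^sup>2 - 2 * tanh (- y))\<bar>"
proof -
  have "((\<lambda>y::real. y * (2 / (cosh y)\<^sup>2)) \<longlongrightarrow> 0) at_top"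
    by real_asymp
  then have "((\<lambda>y::real. 2 * (y * (2 / (cosh y)\<^sup>2)) - 4 * tanh y) \<longlongrightarrow> 2 * 0 - 4 * 1) at_top"
    by (intro tendsto_intros tanh_real_at_top)
  then have "\<forall>\<^sub>F y in at_top. 2 * (y * (2 / (cosh y)\<^sup>2)) - 4 * tanh y < - (2::real)"
    by (rule order_tendstoD) simp
  then show ?thesis
    by eventually_elim (simp add: Q_def power_divide)
qed

text \<open>
The function increment tends to \<open>- \<integral> Q = - sqrt 2 \<pi>\<close>.
\<close>

lemma gap_p:
  "\<forall>\<^sub>F y in at_top. 2 \<le> \<bar>(2 * y * Q y - sqrt 2 * arctan (sinh y)) -
     (2 * (- y) * Q (- y) - sqrt 2 * arctan (sinh (- y)))\<bar>"
proof -
  have "((\<lambda>y. 4 * y * (sqrt 2 / cosh y) - 2 * sqrt 2 * arctan (sinh y)) \<longlongrightarrow>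
      0 - 2 * sqrt 2 * (pi / 2)) at_top"
  proof (intro tendsto_intros filterlim_compose[OF tendsto_arctan_at_top])
    have "((\<lambda>y::real. 4 * (y / cosh y)) \<longlongrightarrow> 4 * 0) at_top"
      by (intro tendsto_intros) real_asymp
    from tendsto_mult_right[OF this, of "sqrt 2"]
    show "((\<lambda>y. 4 * y * (sqrt 2 / cosh y)) \<longlongrightarrow> 0) at_top" by (simp add: field_simps)
    show "filterlim sinh at_top (at_top :: real filter)" by (rule sinh_real_at_top)
  qed
  moreover have "2 < sqrt 2 * pi"
  proof -
    have "1 \<le> sqrt 2" by simp
    then have "1 * pi \<le> sqrt 2 * pi" by (intro mult_right_mono) auto
    then show ?thesis using pi_gt3 by linarith
  qed
  ultimately have "\<forall>\<^sub>F y in at_top. 4 * y * (sqrt 2 / cosh y) - 2 * sqrt 2 * arctan (sinh y) < - 2"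
    by (intro order_tendstoD) auto
  then show ?thesis
    by eventually_elim (simp add: Q_def arctan_minus mult_ac)
qed

context zakharov_mode
begin

text \<open>
The Wronskian \<open>Q' K - Q K'\<close>, a primitive of \<open>l Q F\<close>.
\<close>

definition J where "J y = - Tc y * Qc y * K y - Qc y * K' y"

lemma J_deriv: "(J has_vector_derivative of_real l * Qc y * F y) (at y)"
  unfolding J_def [abs_def]
  apply (rule has_vector_derivative_eq_rhs, (rule vderiv_intros K K')+)
  using Qc_squared[of y] by algebra

text \<open>
Inserting \<open>l Q F = J'\<close> into the transport equation and integrating by parts twice, one finds
\<open>Z = (2 a i \<mu> / l) (J + i \<mu> (V - Q K))\<close> with \<open>V\<close> decaying and
\<open>V' = i \<mu> (V - Q K) + 2 Q' K\<close>. So \<open>V\<close> carries the exact form of the orthogonality relation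
\<open>\<integral> Q' K \<approx> 0\<close>, divided by \<open>\<mu>\<close>; \<open>V2\<close> does the same for \<open>W\<close>, with \<open>- \<nu>\<close> in place of \<open>\<mu>\<close>.
\<close>

definition V where
  "V y = Qc y * K y + (1 / (\<i> * of_real \<mu>)) *
     (of_real (l / (2 * a)) * (1 / (\<i> * of_real \<mu>)) * Z y - J y)"
definition V2 where
  "V2 y = Qc y * K y - (1 / (\<i> * of_real \<nu>)) *
     (- of_real (l / (2 * b)) * (1 / (\<i> * of_real \<nu>)) * W y - J y)"

lemma V_deriv:
  "(V has_vector_derivative \<i> * of_real \<mu> * (V y - Qc y * K y) - 2 * Tc y * Qc y * K y) (at y)"
proof -
  define c d e where "c = \<i> * complex_of_real \<mu>" and "d = 1 / c" and "e = complex_of_real (l / (2 * a))"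
  have r: "c * d = 1" "2 * of_real a * e = of_real l" using \<mu> a by (simp_all add: c_def d_def e_def)
  have V_alt: "V = (\<lambda>y. Qc y * K y + d * (e * d * Z y - J y))"
    by (simp add: V_def [abs_def] c_def d_def e_def)
  show ?thesis
    unfolding V_alt c_def [symmetric]
    apply (rule has_vector_derivative_eq_rhs, (rule vderiv_intros K Z[folded c_def] J_deriv)+)
    unfolding J_def using r by algebra
qed

lemma V2_deriv:
  "(V2 has_vector_derivative - \<i> * of_real \<nu> * (V2 y - Qc y * K y) - 2 * Tc y * Qc y * K y) (at y)"
proof -
  define c d e where "c = - \<i> * complex_of_real \<nu>" and "d = 1 / c" and "e = complex_of_real (l / (2 * b))"
  have r: "c * d = 1" "2 * of_real b * e = of_real l" using \<nu> b by (simp_all add: c_def d_def e_def)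
  have V_alt: "V2 = (\<lambda>y. Qc y * K y + d * (e * d * W y - J y))"
    by (simp add: V2_def [abs_def] c_def d_def e_def)
  show ?thesis
    unfolding V_alt c_def [symmetric]
    apply (rule has_vector_derivative_eq_rhs, (rule vderiv_intros K W[folded c_def] J_deriv)+)
    unfolding J_def using r by algebra
qed

lemma J_lim: "(J \<longlongrightarrow> 0) at_infinity"
proof -
  have "((\<lambda>y. -1 * (Tc y * (Qc y * K y)) - Qc y * K' y) \<longlongrightarrow> 0) at_infinity"
    by (intro vanish vanish_add_diff lim)
  then show ?thesis by (simp add: J_def [abs_def] mult.assoc)
qed

lemma V_lim: "(V \<longlongrightarrow> 0) at_infinity" "(V2 \<longlongrightarrow> 0) at_infinity"
proof -
  show "(V \<longlongrightarrow> 0) at_infinity" "(V2 \<longlongrightarrow> 0) at_infinity"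
    unfolding V_def [abs_def] V2_def [abs_def] by (intro vanish vanish_add_diff lim J_lim)+
qed

text \<open>
Both \<open>V\<close> and \<open>V2\<close> integrate \<open>2 Q' K\<close> to leading order, so that their difference is of order
\<open>\<mu> + \<nu>\<close>. Dividing by it gives a second, independent relation of order one.
\<close>

definition p where "p y = (V y - V2 y) / (\<i> * of_real (\<mu> + \<nu>))"

lemma p_deriv: "(p has_vector_derivative (V y - Qc y * K y) - \<i> * of_real \<nu> * p y) (at y)"
proof -
  define c where "c = \<i> * complex_of_real (\<mu> + \<nu>)"
  have c: "c \<noteq> 0" using \<mu> \<nu> unfolding c_def by (metis add_pos_pos complex_i_not_zero mult_eq_0_iff of_real_eq_0_iff less_irrefl)
  have d: "((\<lambda>y. (1 / c) * (V y - V2 y)) has_vector_derivative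
      (1 / c) * (c * (V y - Qc y * K y) - \<i> * of_real \<nu> * (V y - V2 y))) (at y)"
    apply (rule has_vector_derivative_eq_rhs, (rule vderiv_intros V_deriv V2_deriv)+)
    by (simp add: c_def algebra_simps)
  have p_alt: "p = (\<lambda>y. (1 / c) * (V y - V2 y))"
    by (simp add: p_def [abs_def] c_def)
  have "(1 / c) * (c * A - n * D) = A - n * ((1 / c) * D)" for A n D
    using c by (simp add: diff_divide_distrib)
  then show ?thesis
    unfolding p_alt by (intro has_vector_derivative_eq_rhs[OF d])
qed

lemma p_lim: "(p \<longlongrightarrow> 0) at_infinity"
proof -
  have "((\<lambda>y. (1 / (\<i> * of_real (\<mu> + \<nu>))) * (V y - V2 y)) \<longlongrightarrow> 0) at_infinity"
    by (intro vanish vanish_add_diff V_lim)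
  then show ?thesis by (simp add: p_def [abs_def])
qed

text \<open>
The modes \<open>y Q\<close> and \<open>1\<close> are excluded by the two orthogonality relations; \<open>c2 Q\<close> satisfies both of them
exactly and is subtracted first (it contributes \<open>c2 Q\<^sup>2\<close> to \<open>V\<close> and nothing to \<open>p\<close>). The corrections carry a factor
\<open>\<mu>\<close> or \<open>\<nu>\<close>; they can be integrated over the line because \<open>V\<close> and \<open>p\<close> decay exponentially, and they are
absorbed when these parameters are at most \<open>10\<^sup>-\<^sup>6\<close>.
\<close>

lemma coefficients_small:
  assumes S: "S = cmod A + cmod c1 + M"
    and K_exp: "\<And>y. K y = A + c1 * Y y * Qc y + c2 * Qc y + Kr y"
    and Kr: "\<And>y. cmod (Kr y) \<le> M * (1 + \<bar>y\<bar>)"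
    and \<tau>: "\<mu> \<le> 1 / 10^6" "\<nu> \<le> 1 / 10^6"
  shows "S \<le> 24000 * M"
proof -
  have M: "0 \<le> M" using order_trans[OF norm_ge_zero Kr[of 0]] by simp
  have S0: "0 \<le> S" using S M by simp
  have one: "x \<le> x * (1 + \<bar>y\<bar>)" if "0 \<le> x" for x y :: real
    using mult_left_mono[of 1 "1 + \<bar>y\<bar>" x] that by simp
  define Kt where "Kt y = K y - c2 * Qc y" for y
  define v where "v y = V y - c2 * Qc y * Qc y" for y
  have Kt_exp: "Kt y = A + c1 * Y y * Qc y + Kr y" for y by (simp add: Kt_def K_exp)
  have vKt: "v y - Qc y * Kt y = V y - Qc y * K y" for y
    by (simp add: v_def Kt_def algebra_simps)
  have yQ: "cmod (c1 * Y y * Qc y) \<le> 3/2 * cmod c1 * \<bar>y\<bar>" for y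
  proof -
    have "cmod (c1 * Y y * Qc y) = cmod c1 * \<bar>y\<bar> * Q y" by (simp add: norm_mult norm_Qc Y_def)
    also have "\<dots> \<le> cmod c1 * \<bar>y\<bar> * (3/2)" using Q_le_3_2 by (intro mult_left_mono) auto
    finally show ?thesis by (simp add: mult_ac)
  qed
  have Ktb: "cmod (Kt y) \<le> 3 * S * (1 + \<bar>y\<bar>)" for y
  proof -
    have "cmod (Kt y) \<le> cmod A + cmod (c1 * Y y * Qc y) + cmod (Kr y)"
      unfolding Kt_exp by (rule order_trans[OF norm_triangle_ineq add_right_mono[OF norm_triangle_ineq]])
    also have "\<dots> \<le> cmod A * (1 + \<bar>y\<bar>) + 3/2 * cmod c1 * (1 + \<bar>y\<bar>) + M * (1 + \<bar>y\<bar>)"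
      by (intro add_mono one Kr order_trans[OF yQ] mult_left_mono) auto
    also have "\<dots> = (cmod A + 3/2 * cmod c1 + M) * (1 + \<bar>y\<bar>)" by (simp add: algebra_simps)
    also have "\<dots> \<le> (3 * S) * (1 + \<bar>y\<bar>)" using M by (intro mult_right_mono) (auto simp: S)
    finally show ?thesis .
  qed
  have QKt: "cmod (Qc y * Kt y) \<le> 18 * S * exp (- (1/2) * \<bar>y\<bar>)" for y
  proof -
    have "cmod (Qc y * Kt y) \<le> (3 * exp (- \<bar>y\<bar>)) * (3 * S * (1 + \<bar>y\<bar>))"
      using Q_le_exp[of y] Ktb[of y] Q_pos[of y] unfolding norm_mult norm_Qc by (intro mult_mono) auto
    also have "\<dots> = 9 * S * ((1 + \<bar>y\<bar>) * exp (- \<bar>y\<bar>))" by simp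
    also have "\<dots> \<le> 9 * S * (2 * exp (- (1/2) * \<bar>y\<bar>))"
      using poly_exp_half[of y] S0 by (intro mult_left_mono) auto
    finally show ?thesis by simp
  qed
  have v_deriv: "(v has_vector_derivative \<i> * of_real \<mu> * v y
      + - (2 * Tc y + \<i> * of_real \<mu>) * (Qc y * Kt y)) (at y)" for y
    unfolding v_def [abs_def]
    by (rule has_vector_derivative_eq_rhs, (rule vderiv_intros V_deriv)+)
       (simp add: v_def Kt_def algebra_simps)
  have vb: "cmod (v y) \<le> 54 * S / (1/2) * exp (- (1/2) * \<bar>y\<bar>)" for y
  proof (rule exp_decay[OF v_deriv])
    have vl: "(v \<longlongrightarrow> 0) at_infinity"
    proof -
      have "((\<lambda>y. V y - c2 * (Qc y * Qc y)) \<longlongrightarrow> 0) at_infinity"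
        by (intro vanish vanish_add_diff V_lim Qc_vanishes)
      then show ?thesis by (simp add: v_def [abs_def] mult.assoc)
    qed
    then show "(v \<longlongrightarrow> 0) at_top" "(v \<longlongrightarrow> 0) at_bot" by (auto intro: tendsto_at_infinityD)
    fix t
    have "cmod (2 * Tc t + \<i> * of_real \<mu>) \<le> 2 * cmod (Tc t) + \<mu>"
      using norm_triangle_ineq[of "2 * Tc t" "\<i> * of_real \<mu>"] \<mu> by (simp add: norm_mult)
    then have "cmod (- (2 * Tc t + \<i> * of_real \<mu>)) \<le> 3"
      using norm_Tc[of t] \<tau> unfolding norm_minus_cancel by simp
    then have "cmod (- (2 * Tc t + \<i> * of_real \<mu>)) * cmod (Qc t * Kt t) \<le> 3 * (18 * S * exp (- (1/2) * \<bar>t\<bar>))"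
      using QKt[of t] by (intro mult_mono) auto
    then show "cmod (- (2 * Tc t + \<i> * of_real \<mu>) * (Qc t * Kt t)) \<le> 54 * S * exp (- (1/2) * \<bar>t\<bar>)"
      unfolding norm_mult by simp
  qed auto
  have vKb: "cmod (v y - Qc y * Kt y) \<le> 126 * S * exp (- (1/2) * \<bar>y\<bar>)" for y
    using norm_triangle_ineq4[of "v y" "Qc y * Kt y"] vb[of y] QKt[of y] by simp
  have pb: "cmod (p y) \<le> 126 * S / (1/2) * exp (- (1/2) * \<bar>y\<bar>)" for y
  proof (rule exp_decay[where w = p and r = "\<lambda>y. v y - Qc y * Kt y" and c = "- (\<i> * of_real \<nu>)", OF _ vKb])
    show "(p has_vector_derivative - (\<i> * of_real \<nu>) * p t + (v t - Qc t * Kt t)) (at t)" for t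
      using p_deriv[of t] by (simp add: vKt)
  qed (use tendsto_at_infinityD[OF p_lim] in auto)
  have Krb: "cmod (Qc y * Kr y) \<le> 6 * M * exp (- (1/2) * \<bar>y\<bar>)" for y
  proof -
    have "cmod (Qc y * Kr y) \<le> (3 * exp (- \<bar>y\<bar>)) * (M * (1 + \<bar>y\<bar>))"
      using Q_le_exp[of y] Kr[of y] Q_pos[of y] unfolding norm_mult norm_Qc by (intro mult_mono) auto
    also have "\<dots> = 3 * M * ((1 + \<bar>y\<bar>) * exp (- \<bar>y\<bar>))" by simp
    also have "\<dots> \<le> 3 * M * (2 * exp (- (1/2) * \<bar>y\<bar>))"
      using poly_exp_half[of y] M by (intro mult_left_mono) auto
    finally show ?thesis by simp
  qed
  have Tcm: "cmod (Tc y * z) \<le> cmod z" for y z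
    using mult_right_mono[OF norm_Tc[of y], of "cmod z"] by (simp add: norm_mult)
  \<comment> \<open>The relation carried by \<open>v\<close> annihilates the resonant part, up to the exact term
    \<open>(2 A Q)'\<close>, and so isolates \<open>c1\<close>.\<close>
  have c1: "cmod c1 * 2 \<le> 2 * (12 * M + 126 * \<mu> * S) / (1/2)"
  proof (rule coefficient_bound[where f = "\<lambda>y. v y - 2 * A * Qc y" and A = c1
        and q = "\<lambda>y. y * (Q y)\<^sup>2 - 2 * tanh y" and q' = "\<lambda>y. - 2 * y * tanh y * (Q y)\<^sup>2"
        and e = "\<lambda>y. - 2 * (Tc y * (Qc y * Kr y)) + \<i> * of_real \<mu> * (v y - Qc y * Kt y)", OF _ _ _ _ _ gap_V])
    fix y
    have "of_real (- 2 * y * tanh y * (Q y)\<^sup>2) = - 2 * Y y * Tc y * Qc y * Qc y"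
      by (simp add: Y_def Tc_def Qc_def power2_eq_square)
    then show "((\<lambda>y. v y - 2 * A * Qc y) has_vector_derivative
         c1 * complex_of_real (- 2 * y * tanh y * (Q y)\<^sup>2) +
         (- 2 * (Tc y * (Qc y * Kr y)) + \<i> * of_real \<mu> * (v y - Qc y * Kt y))) (at y)"
      by (simp only:) (rule has_vector_derivative_eq_rhs, (rule vderiv_intros v_deriv)+,
        simp add: Kt_exp algebra_simps)
    show "((\<lambda>y. y * (Q y)\<^sup>2 - 2 * tanh y) has_real_derivative - 2 * y * tanh y * (Q y)\<^sup>2) (at y)"
      by (rule derivative_eq_intros Q_has_derivative refl | simp)+
         (use Q_squared[of y] in \<open>simp add: algebra_simps power2_eq_square\<close>)
    have "cmod (- 2 * (Tc y * (Qc y * Kr y)) + \<i> * of_real \<mu> * (v y - Qc y * Kt y))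
        \<le> 2 * cmod (Tc y * (Qc y * Kr y)) + \<mu> * cmod (v y - Qc y * Kt y)"
      using \<mu> norm_triangle_ineq[of "- 2 * (Tc y * (Qc y * Kr y))" "\<i> * of_real \<mu> * (v y - Qc y * Kt y)"]
      by (simp add: norm_mult)
    also have "\<dots> \<le> 2 * (6 * M * exp (- (1/2) * \<bar>y\<bar>)) + \<mu> * (126 * S * exp (- (1/2) * \<bar>y\<bar>))"
      using \<mu> vKb[of y] Krb[of y] Tcm[of y "Qc y * Kr y"] by (intro add_mono mult_left_mono) auto
    finally show "cmod (- 2 * (Tc y * (Qc y * Kr y)) + \<i> * of_real \<mu> * (v y - Qc y * Kt y))
        \<le> (12 * M + 126 * \<mu> * S) * exp (- (1/2) * \<bar>y\<bar>)" by (simp add: algebra_simps)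
    have "((\<lambda>y. V y - c2 * (Qc y * Qc y) - (2 * A) * Qc y) \<longlongrightarrow> 0) at_infinity"
      by (intro vanish vanish_add_diff V_lim Qc_vanishes)
    then show "((\<lambda>y. v y - 2 * A * Qc y) \<longlongrightarrow> 0) at_infinity" by (simp add: v_def mult.assoc)
  qed simp
  \<comment> \<open>Since \<open>p\<close> integrates \<open>v - Q Kt\<close>, subtracting it from \<open>y v\<close> trades \<open>v\<close> for its derivative
    and leaves the moment of \<open>Kt\<close> against \<open>Q + 2 y Q'\<close>, which sees the resonant part.\<close>
  have A: "cmod A * 2 \<le> 2 * (96 * (2 * cmod c1 + M) + 504 * \<mu> * S + 252 * \<nu> * S) / (1/4)"
  proof (rule coefficient_bound[where f = "\<lambda>y. Y y * v y - p y" and A = A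
        and q = "\<lambda>y. 2 * y * Q y - sqrt 2 * arctan (sinh y)" and q' = "\<lambda>y. Q y - 2 * y * tanh y * Q y"
        and e = "\<lambda>y. (1 - 2 * Y y * Tc y) * Qc y * (c1 * Y y * Qc y + Kr y) + \<i> * of_real \<nu> * p y
          + \<i> * of_real \<mu> * (Y y * (v y - Qc y * Kt y))", OF _ _ _ _ _ gap_p])
    fix y
    have "of_real (Q y - 2 * y * tanh y * Q y) = Qc y - 2 * Y y * Tc y * Qc y"
      by (simp add: Y_def Tc_def Qc_def)
    then show "((\<lambda>y. Y y * v y - p y) has_vector_derivative
         A * complex_of_real (Q y - 2 * y * tanh y * Q y) +
         ((1 - 2 * Y y * Tc y) * Qc y * (c1 * Y y * Qc y + Kr y) + \<i> * of_real \<nu> * p y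
          + \<i> * of_real \<mu> * (Y y * (v y - Qc y * Kt y)))) (at y)"
      by (simp only:) (rule has_vector_derivative_eq_rhs, (rule vderiv_intros v_deriv p_deriv Y_deriv)+,
        use vKt[of y] Kt_exp[of y] in algebra)
    show "((\<lambda>y. 2 * y * Q y - sqrt 2 * arctan (sinh y)) has_real_derivative Q y - 2 * y * tanh y * Q y) (at y)"
    proof -
      have "sqrt 2 * (cosh y / (1 + (sinh y)\<^sup>2)) = Q y"
      proof -
        have "1 + (sinh y)\<^sup>2 = cosh y * cosh y"
          by (simp add: power2_eq_square [symmetric] cosh_square_eq)
        then show ?thesis by (simp add: Q_def)
      qed
      then show ?thesis
        by - (rule derivative_eq_intros Q_has_derivative refl | simp add: field_simps)+
    qed
    have k: "cmod (c1 * Y y * Qc y + Kr y) \<le> (2 * cmod c1 + M) * (1 + \<bar>y\<bar>)"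
    proof -
      have "cmod (c1 * Y y * Qc y + Kr y) \<le> 3/2 * cmod c1 * \<bar>y\<bar> + M * (1 + \<bar>y\<bar>)"
        using norm_triangle_ineq[of "c1 * Y y * Qc y" "Kr y"] yQ[of y] Kr[of y] by simp
      also have "3/2 * cmod c1 * \<bar>y\<bar> \<le> 2 * cmod c1 * (1 + \<bar>y\<bar>)"
        by (intro mult_mono) auto
      finally show ?thesis by (simp add: algebra_simps)
    qed
    have "cmod (1 - 2 * Y y * Tc y) \<le> 2 * (1 + \<bar>y\<bar>)"
    proof -
      have "cmod (1 - 2 * Y y * Tc y) \<le> 1 + 2 * (\<bar>y\<bar> * cmod (Tc y))"
        using norm_triangle_ineq4[of 1 "2 * Y y * Tc y"] by (simp add: norm_mult Y_def)
      also have "\<bar>y\<bar> * cmod (Tc y) \<le> \<bar>y\<bar> * 1" using norm_Tc by (intro mult_left_mono) auto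
      finally show ?thesis by simp
    qed
    then have "cmod ((1 - 2 * Y y * Tc y) * Qc y * (c1 * Y y * Qc y + Kr y)) \<le>
       (2 * (1 + \<bar>y\<bar>)) * (3 * exp (- \<bar>y\<bar>)) * ((2 * cmod c1 + M) * (1 + \<bar>y\<bar>))"
      using k Q_le_exp[of y] Q_pos[of y] M
      unfolding norm_mult[of "_ * _" "_ + _"] norm_mult[of "1 - _"] norm_Qc by (intro mult_mono) auto
    also have "\<dots> = 6 * (2 * cmod c1 + M) * ((1 + \<bar>y\<bar>)\<^sup>2 * exp (- \<bar>y\<bar>))"
      by algebra
    also have "\<dots> \<le> 6 * (2 * cmod c1 + M) * (16 * exp (- (1/4) * \<bar>y\<bar>))"
      using poly2_exp[of y] M by (intro mult_left_mono) auto
    also have "\<dots> = 96 * (2 * cmod c1 + M) * exp (- (1/4) * \<bar>y\<bar>)" by algebra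
    finally have e1: "cmod ((1 - 2 * Y y * Tc y) * Qc y * (c1 * Y y * Qc y + Kr y)) \<le>
      96 * (2 * cmod c1 + M) * exp (- (1/4) * \<bar>y\<bar>)" .
    have "cmod (\<i> * of_real \<nu> * p y) \<le> \<nu> * (252 * S * exp (- (1/2) * \<bar>y\<bar>))"
      using pb[of y] \<nu> by (simp add: norm_mult mult_left_mono)
    also have "\<dots> \<le> \<nu> * (252 * S * exp (- (1/4) * \<bar>y\<bar>))"
      using \<nu> S0 by (intro mult_left_mono) auto
    finally have e2: "cmod (\<i> * of_real \<nu> * p y) \<le> 252 * \<nu> * S * exp (- (1/4) * \<bar>y\<bar>)" by simp
    have "cmod (\<i> * of_real \<mu> * (Y y * (v y - Qc y * Kt y))) \<le> \<mu> * (\<bar>y\<bar> * (126 * S * exp (- (1/2) * \<bar>y\<bar>)))"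
      using vKb[of y] \<mu> by (simp add: norm_mult mult_left_mono Y_def)
    also have "\<dots> \<le> \<mu> * ((1 + \<bar>y\<bar>) * (126 * S * exp (- (1/2) * \<bar>y\<bar>)))"
      using \<mu> S0 by (intro mult_left_mono mult_right_mono) auto
    also have "\<dots> = \<mu> * 126 * S * ((1 + \<bar>y\<bar>) * exp (- (1/2) * \<bar>y\<bar>))" by simp
    also have "\<dots> \<le> \<mu> * 126 * S * (4 * exp (- (1/4) * \<bar>y\<bar>))"
      using poly_exp_quarter[of y] \<mu> S0 by (intro mult_left_mono) auto
    finally have e3: "cmod (\<i> * of_real \<mu> * (Y y * (v y - Qc y * Kt y))) \<le> 504 * \<mu> * S * exp (- (1/4) * \<bar>y\<bar>)"
      by simp
    show "cmod ((1 - 2 * Y y * Tc y) * Qc y * (c1 * Y y * Qc y + Kr y) + \<i> * of_real \<nu> * p y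
          + \<i> * of_real \<mu> * (Y y * (v y - Qc y * Kt y)))
        \<le> (96 * (2 * cmod c1 + M) + 504 * \<mu> * S + 252 * \<nu> * S) * exp (- (1/4) * \<bar>y\<bar>)"
      using order_trans[OF norm_triangle_ineq add_mono[OF order_trans[OF norm_triangle_ineq add_mono[OF e1 e2]] e3]]
      by (simp add: algebra_simps)
    show "((\<lambda>y. Y y * v y - p y) \<longlongrightarrow> 0) at_infinity"
    proof (rule vanish_add_diff(2)[OF _ p_lim], rule Lim_null_comparison)
      have "cmod (Y y * v y) \<le> 432 * S * exp (- (1/4) * \<bar>y\<bar>)" for y
      proof -
        have "cmod (Y y * v y) \<le> (1 + \<bar>y\<bar>) * (108 * S * exp (- (1/2) * \<bar>y\<bar>))"
          unfolding norm_mult using vb[of y] by (intro mult_mono) (auto simp: Y_def)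
        also have "\<dots> = 108 * S * ((1 + \<bar>y\<bar>) * exp (- (1/2) * \<bar>y\<bar>))" by simp
        also have "\<dots> \<le> 108 * S * (4 * exp (- (1/4) * \<bar>y\<bar>))"
          using poly_exp_quarter[of y] S0 by (intro mult_left_mono) auto
        finally show ?thesis by simp
      qed
      then show "\<forall>\<^sub>F y in at_infinity. cmod (Y y * v y) \<le> 432 * S * exp (- (1/4) * \<bar>y\<bar>)" by simp
      have "filterlim (\<lambda>y. - ((1/4) * norm y)) at_bot (at_infinity :: real filter)"
        unfolding filterlim_uminus_at_bot minus_minus
        by (rule filterlim_tendsto_pos_mult_at_top[OF tendsto_const _ filterlim_norm_at_top]) simp
      then have "((\<lambda>y. exp (- ((1/4) * norm y))) \<longlongrightarrow> 0) (at_infinity :: real filter)"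
        by (rule filterlim_compose[OF exp_at_bot])
      then show "((\<lambda>y. 432 * S * exp (- (1/4) * \<bar>y\<bar>)) \<longlongrightarrow> 0) (at_infinity :: real filter)"
        using tendsto_mult_right_zero by force
    qed
  qed simp
  have \<mu>S: "\<mu> * S \<le> 1 / 10^6 * S" "\<nu> * S \<le> 1 / 10^6 * S"
    using \<tau> S0 by (intro mult_right_mono; simp)+
  have "cmod c1 \<le> 24 * M + 252 * (\<mu> * S)" using c1 by simp
  moreover have "cmod A \<le> 384 * (2 * cmod c1 + M) + 2016 * (\<mu> * S) + 1008 * (\<nu> * S)" using A by simp
  ultimately show ?thesis using \<mu>S M S S0 by simp
qed

text \<open>
The constant \<open>24000\<close> from \<open>coefficients_small\<close> and the constant \<open>1200\<close> from
\<open>wave_bounds\<close>, together with \<open>Q \<le> 3 exp (- |y|)\<close>, yield a contraction as soon as \<open>s \<le> 5 / 10\<^sup>9\<close>.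
\<close>

lemma source_contraction:
  assumes \<rho>: "\<And>y. cmod (Qc y * N'' y) \<le> M * exp (- \<bar>y\<bar>)"
    and \<tau>: "\<mu> \<le> 1 / 10^6" "\<nu> \<le> 1 / 10^6" and s: "\<mu> \<le> s * l" "\<nu> \<le> s * l" "s \<le> 1 / 10^9"
  shows "cmod (Qc y * N'' y) \<le> M / 2 * exp (- \<bar>y\<bar>)"
    and "l * cmod (F y) \<le> 7 * (24000 * M) * (1 + \<bar>y\<bar>)"
    and "cmod (Z y) \<le> 336 * s * (24000 * M)" and "cmod (W y) \<le> 336 * s * (24000 * M)"
proof -
  have M: "0 \<le> M" using order_trans[OF norm_ge_zero \<rho>[of 0]] by simp
  have s0: "0 \<le> s" using \<mu> s(1) l by (smt (verit) mult_nonpos_nonneg mult_neg_pos)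
  obtain A c1 c2 Kr S where S: "S = cmod A + cmod c1 + M"
    and e: "\<And>y. K y = A + c1 * Y y * Qc y + c2 * Qc y + Kr y"
    "\<And>y. cmod (Kr y) \<le> M * (1 + \<bar>y\<bar>)"
    and F_S: "\<And>y. l * cmod (F y) \<le> 7 * S * (1 + \<bar>y\<bar>)"
    "\<And>y. l * cmod (F' y) \<le> 22 * S * (1 + \<bar>y\<bar>)"
    using expansion[OF \<rho>] by metis
  have SM: "S \<le> 24000 * M" by (rule coefficients_small[OF S e \<tau>])
  have S0: "0 \<le> S" using S M by simp
  have up: "C * S * x \<le> C * (24000 * M) * x" if "0 \<le> C" "0 \<le> x" for C x :: real
    using SM that by (intro mult_right_mono mult_left_mono) auto
  have Zb: "cmod (Z y) \<le> 336 * s * S" "cmod (Z'' y) \<le> 1200 * s * S"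
    unfolding Z''_def Z'_def
    by (rule wave_bounds[OF Z lim(5) F_S _ _ s0 less_imp_le[OF l] a S0]; use \<mu> s \<tau> in simp)+
  have W': "(W has_vector_derivative \<i> * of_real (- \<nu>) * (W y + 2 * of_real b * Qc y * F y)) (at y)" for y
    using W[of y] by simp
  have "cmod (\<i> * of_real (- \<nu>) * (\<i> * of_real (- \<nu>) * (W y + 2 * of_real b * Qc y * F y)
      + 2 * of_real b * Qc y * (F' y - Tc y * F y))) \<le> 1200 * s * S"
    by (rule wave_bounds(2)[OF W' lim(6) F_S _ _ s0 less_imp_le[OF l] b S0]; use \<nu> s \<tau> in simp)
  then have W2b: "cmod (W'' y) \<le> 1200 * s * S"
    by (simp add: W''_def W'_def)
  have Wb: "cmod (W y) \<le> 336 * s * S"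
    by (rule wave_bounds(1)[OF W' lim(6) F_S _ _ s0 less_imp_le[OF l] b S0]; use \<nu> s \<tau> in simp)
  have "cmod (N'' y) \<le> 1200 * s * S"
    using norm_triangle_ineq[of "Z'' y" "W'' y"] Zb W2b by (simp add: N''_def norm_divide)
  then have "cmod (Qc y * N'' y) \<le> (3 * exp (- \<bar>y\<bar>)) * (1200 * s * S)"
    using Q_le_exp[of y] Q_pos[of y] unfolding norm_mult norm_Qc by (intro mult_mono) auto
  also have "\<dots> = (3600 * s) * S * exp (- \<bar>y\<bar>)" by simp
  also have "\<dots> \<le> (3600 * s) * (24000 * M) * exp (- \<bar>y\<bar>)" using s0 by (intro up) auto
  also have "\<dots> = s * (86400000 * M * exp (- \<bar>y\<bar>))" by simp
  also have "\<dots> \<le> 1 / 10^9 * (86400000 * M * exp (- \<bar>y\<bar>))"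
    using s M by (intro mult_right_mono) auto
  also have "\<dots> \<le> M / 2 * exp (- \<bar>y\<bar>)" using M by simp
  finally show "cmod (Qc y * N'' y) \<le> M / 2 * exp (- \<bar>y\<bar>)" .
  show "l * cmod (F y) \<le> 7 * (24000 * M) * (1 + \<bar>y\<bar>)"
    using F_S(1)[of y] up[of 7 "1 + \<bar>y\<bar>"] by simp
  show "cmod (Z y) \<le> 336 * s * (24000 * M)" "cmod (W y) \<le> 336 * s * (24000 * M)"
    using order_trans[OF Zb(1)] order_trans[OF Wb] mult_left_mono[OF SM, of "336 * s"] s0 by auto
qed

end

lemma bounded_of_vanishing:
  fixes f :: "real \<Rightarrow> complex"
  assumes "continuous_on UNIV f" "(f \<longlongrightarrow> 0) at_infinity"
  obtains C where "\<And>y. cmod (f y) \<le> C"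
proof -
  have "\<forall>\<^sub>F y in at_infinity. cmod (f y) < 1"
    using order_tendstoD(2)[OF tendsto_norm_zero[OF assms(2)], of 1] by simp
  then obtain R where R: "\<And>y. R \<le> norm y \<Longrightarrow> cmod (f y) < 1"
    unfolding eventually_at_infinity by blast
  have "compact (f ` {- R..R})"
    by (intro compact_continuous_image continuous_on_subset[OF assms(1)]) auto
  from compact_imp_bounded[OF this] obtain C where "\<forall>z\<in>f ` {- R..R}. cmod z \<le> C"
    unfolding bounded_iff by auto
  then have "cmod (f y) \<le> max 1 C" for y
    using R[of y] by (cases "R \<le> norm y") (auto simp: le_max_iff_disj abs_le_iff less_imp_le)
  then show ?thesis by (rule that)
qed

lemma zero_of_halving:
  fixes P :: "real \<Rightarrow> bool"
  assumes "P M" and step: "\<And>M. P M \<Longrightarrow> P (M / 2)" and M: "\<And>M. P M \<Longrightarrow> x \<le> M * (c::real)"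
  shows "x \<le> 0"
proof (rule tendsto_lowerbound)
  have "P (M / 2 ^ n)" for n
  proof (induction n)
    case (Suc n)
    then show ?case using step[OF Suc] by (simp add: mult.commute)
  qed (use assms(1) in simp)
  then show "\<forall>\<^sub>F n in sequentially. x \<le> M / 2 ^ n * c"
    by (intro always_eventually allI M)
  show "(\<lambda>n. M / 2 ^ n * c) \<longlonglongrightarrow> 0"
    by real_asymp
qed simp

context zakharov_mode
begin

text \<open>
This recovers the part \<open>c2 Q\<close> of \<open>K\<close> left undetermined by the other estimates.
\<close>

lemma K_zero_of_others_zero:
  assumes "\<And>y. F y = 0" "\<And>y. Z y = 0" "\<And>y. W y = 0"
  shows "K y = 0"
proof -
  have "F' t = 0" for t
    using vector_derivative_unique_at[OF F[of t], of 0] assms(1) has_vector_derivative_const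
    by (metis ext)
  then have "(F' has_vector_derivative 0) (at y)"
    using has_vector_derivative_const by (metis ext)
  then have "F y - 3 * Qc y * Qc y * F y - of_real l * K y - Qc y * ((Z y + W y) / 2) = 0"
    using vector_derivative_unique_at[OF F'[of y]] by simp
  then show ?thesis using assms l by simp
qed

theorem low_frequency:
  assumes \<tau>: "\<mu> \<le> 1 / 10^6" "\<nu> \<le> 1 / 10^6" and s: "\<mu> \<le> s * l" "\<nu> \<le> s * l" "s \<le> 1 / 10^9"
  shows "K y = 0 \<and> F y = 0 \<and> Z y = 0 \<and> W y = 0"
proof -
  have cont: "continuous_on UNIV f" if "\<And>y. (f has_vector_derivative f' y) (at y)" for f f' :: "real \<Rightarrow> complex"
    using has_vector_derivative_continuous[OF that] by (auto intro!: continuous_at_imp_continuous_on)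
  have N''_alt: "N'' = (\<lambda>y. (1/2) * (\<i> * of_real \<mu> * (Z' y + 2 * of_real a * (Qc y * (F' y - Tc y * F y)))
     + - \<i> * of_real \<nu> * (W' y + 2 * of_real b * (Qc y * (F' y - Tc y * F y)))))"
    by (rule ext) (simp add: N''_def Z''_def W''_def mult.assoc)
  have Z'_alt: "Z' = (\<lambda>y. \<i> * of_real \<mu> * (Z y + 2 * of_real a * (Qc y * F y)))"
    and W'_alt: "W' = (\<lambda>y. - \<i> * of_real \<nu> * (W y + 2 * of_real b * (Qc y * F y)))"
    by (simp_all add: Z'_def [abs_def] W'_def [abs_def] mult.assoc)
  have "continuous_on UNIV N''"
    unfolding N''_alt Z'_alt W'_alt
    by (intro continuous_intros cont[OF Z] cont[OF W] cont[OF F] cont[OF F'] cont[OF Qc_deriv] cont[OF Tc_deriv])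
  moreover have "(N'' \<longlongrightarrow> 0) at_infinity"
    unfolding N''_alt Z'_alt W'_alt by (intro vanish vanish_add_diff lim)
  ultimately obtain C where C: "\<And>y. cmod (N'' y) \<le> C" using bounded_of_vanishing by blast
  have start: "cmod (Qc y * N'' y) \<le> (3 * C) * exp (- \<bar>y\<bar>)" for y
  proof -
    have "cmod (Qc y * N'' y) \<le> (3 * exp (- \<bar>y\<bar>)) * C"
      using Q_le_exp[of y] Q_pos[of y] C unfolding norm_mult norm_Qc by (intro mult_mono) auto
    then show ?thesis by (simp only: mult_ac)
  qed
  note contraction = source_contraction[OF _ \<tau> s]
  let ?P = "\<lambda>M. \<forall>y. cmod (Qc y * N'' y) \<le> M * exp (- \<bar>y\<bar>)"
  have start': "?P (3 * C)" using start by blast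
  have step: "?P (M / 2)" if "?P M" for M using contraction(1) that by blast
  have F0: "F y = 0" for y
  proof -
    have bound: "l * cmod (F y) \<le> M * (7 * 24000 * (1 + \<bar>y\<bar>))" if "?P M" for M
      using contraction(2)[of M y] that by (simp add: mult_ac)
    have "l * cmod (F y) \<le> 0" by (rule zero_of_halving[of ?P, OF start' step bound])
    then show ?thesis using l by (simp add: mult_le_0_iff)
  qed
  have ZW0: "Z y = 0" "W y = 0" for y
  proof -
    have bound: "cmod (Z y) \<le> M * (336 * s * 24000)" "cmod (W y) \<le> M * (336 * s * 24000)" if "?P M" for M
      using contraction(3,4)[of M y] that by (simp_all add: mult_ac)
    have "cmod (Z y) \<le> 0" by (rule zero_of_halving[of ?P, OF start' step bound(1)])
    then show "Z y = 0" by simp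
    have "cmod (W y) \<le> 0" by (rule zero_of_halving[of ?P, OF start' step bound(2)])
    then show "W y = 0" by simp
  qed
  show ?thesis using F0 ZW0 K_zero_of_others_zero by blast
qed

end

section \<open>Large frequencies\<close>

lemmas has_vector_derivative_inner = bounded_bilinear.has_vector_derivative[OF bounded_bilinear_inner]

context zakharov_mode
begin

definition u where "u y = K y + F y"
definition u' where "u' y = K' y + F' y"
definition v where "v y = K y - F y"
definition v' where "v' y = K' y - F' y"

lemma u_deriv: "(u has_vector_derivative u' y) (at y)"
  and v_deriv: "(v has_vector_derivative v' y) (at y)"
  unfolding u_def [abs_def] v_def [abs_def] u'_def v'_def by (rule vderiv_intros K F)+

lemma u'_deriv: "(u' has_vector_derivative
    of_real (1 - l) * u y - Qc y * Qc y * (2 * u y - v y) - Qc y * ((Z y + W y) / 2)) (at y)"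
  unfolding u'_def [abs_def] u_def v_def
  by (rule has_vector_derivative_eq_rhs, (rule vderiv_intros K' F')+) (simp add: algebra_simps)

lemma v'_deriv: "(v' has_vector_derivative
    of_real (1 + l) * v y + (Qc y * Qc y * (u y - 2 * v y) + Qc y * ((Z y + W y) / 2))) (at y)"
  unfolding v'_def [abs_def] u_def v_def
  by (rule has_vector_derivative_eq_rhs, (rule vderiv_intros K' F')+) (simp add: algebra_simps)

lemma u_v_lim: "(u \<longlongrightarrow> 0) at_infinity" "(u' \<longlongrightarrow> 0) at_infinity"
  "(v \<longlongrightarrow> 0) at_infinity" "(v' \<longlongrightarrow> 0) at_infinity"
  unfolding u_def [abs_def] v_def [abs_def] u'_def [abs_def] v'_def [abs_def]
  by (intro vanish_add_diff lim)+

definition amplitude where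
  "amplitude y = u' y \<bullet> u' y + (l - 1) * (u y \<bullet> u y) + Z y \<bullet> Z y + W y \<bullet> W y"

text \<open>
A quadratic form in which the oscillating mode \<open>u\<close> and the transported fields are balanced. The
mixed term corrects for the fact that the coupling enters \<open>u''\<close> through \<open>u'\<close> but the transport
equations through \<open>u\<close>.
\<close>

definition energy where
  "energy y = u' y \<bullet> u' y + (l - 1) * (u y \<bullet> u y) + (1 / (2 * a)) * (Z y \<bullet> Z y) + (1 / (2 * b)) * (W y \<bullet> W y)
    + (Qc y * u y) \<bullet> (Z y + W y)"

text \<open>
Each term contains either the elliptic component \<open>v\<close> or a product of \<open>u\<close> with a lower order
factor; terms in \<open>Z\<close> and \<open>u\<close> alone weighted by \<open>\<mu>\<close> are absent.
\<close>

definition flux where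
  "flux y = - 2 * (Q y)\<^sup>2 * (u' y \<bullet> (2 * u y - v y)) - tanh y * Q y * (u y \<bullet> (Z y + W y))
    + \<mu> * Q y * ((\<i> * Z y) \<bullet> v y) - \<nu> * Q y * ((\<i> * W y) \<bullet> v y)
    + (Q y)\<^sup>2 * (a * \<mu> - b * \<nu>) * ((\<i> * u y) \<bullet> v y)"

lemma energy_deriv: "(energy has_vector_derivative flux y) (at y)"
proof -
  have Z_eq: "(Z has_vector_derivative \<i> * of_real \<mu> * (Z y + of_real a * Qc y * (u y - v y))) (at y)" for y
    using Z[of y] by (simp add: u_def v_def algebra_simps)
  have W_eq: "(W has_vector_derivative - \<i> * of_real \<nu> * (W y + of_real b * Qc y * (u y - v y))) (at y)" for y
    using W[of y] by (simp add: u_def v_def algebra_simps)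
  define A B where "A = 1 / (2 * a)" and "B = 1 / (2 * b)"
  have AB: "2 * A * a = 1" "2 * B * b = 1" using a b by (simp_all add: A_def B_def)
  show ?thesis
    unfolding energy_def [abs_def] A_def [symmetric] B_def [symmetric]
    apply (rule has_vector_derivative_eq_rhs,
       (rule has_vector_derivative_inner vderiv_intros u_deriv u'_deriv Z_eq W_eq)+)
    unfolding flux_def inner_complex_def Qc_def Tc_def
    using AB
    apply (simp add: power2_eq_square)
    by algebra
qed

lemma energy_lim: "(energy \<longlongrightarrow> 0) at_infinity"
proof -
  have Qu: "((\<lambda>y. Qc y * u y) \<longlongrightarrow> 0) at_infinity" by (intro vanish u_v_lim)
  have "(energy \<longlongrightarrow> (0 \<bullet> (0::complex)) + (l - 1) * (0 \<bullet> (0::complex)) + (1 / (2 * a)) * (0 \<bullet> (0::complex))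
      + (1 / (2 * b)) * (0 \<bullet> (0::complex)) + 0 \<bullet> (0 + 0 :: complex)) at_infinity"
    unfolding energy_def [abs_def] by (intro tendsto_intros u_v_lim lim Qu)
  then show ?thesis by simp
qed

lemma amplitude_lim: "(amplitude \<longlongrightarrow> 0) at_infinity"
proof -
  have "(amplitude \<longlongrightarrow> (0 \<bullet> (0::complex)) + (l - 1) * (0 \<bullet> (0::complex)) + (0 \<bullet> (0::complex))
      + (0 \<bullet> (0::complex))) at_infinity"
    unfolding amplitude_def [abs_def] by (intro tendsto_intros u_v_lim lim)
  then show ?thesis by simp
qed

lemma continuous_of_deriv:
  fixes f :: "real \<Rightarrow> complex"
  assumes "\<And>y. (f has_vector_derivative f' y) (at y)"
  shows "continuous_on UNIV f"
  using has_vector_derivative_continuous[OF assms] by (auto intro!: continuous_at_imp_continuous_on)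

lemma amplitude_le_energy:
  assumes "11 \<le> l - 1"
  shows "amplitude y \<le> 8 * energy y"
proof -
  have ZZ: "Z y \<bullet> Z y \<le> 4 * (1 / (2 * a) * (Z y \<bullet> Z y))" "W y \<bullet> W y \<le> 4 * (1 / (2 * b) * (W y \<bullet> W y))"
    using a b by (simp_all add: field_simps mult_right_mono)
  have c: "- ((Qc y * u y) \<bullet> z) \<le> z \<bullet> z / 8 + 9/2 * (u y \<bullet> u y)" for z
  proof -
    have "- ((Qc y * u y) \<bullet> z) \<le> cmod (Qc y * u y) * cmod z"
      using Cauchy_Schwarz_ineq2[of "Qc y * u y" z] by simp
    also have "\<dots> \<le> (3/2 * cmod (u y)) * cmod z"
      unfolding norm_mult norm_Qc by (intro mult_right_mono Q_le_3_2) auto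
    also have "\<dots> \<le> (cmod z)\<^sup>2 / 8 + 9/2 * (cmod (u y))\<^sup>2"
      using zero_le_power2[of "cmod z - 6 * cmod (u y)"] by (simp add: power2_eq_square algebra_simps)
    finally show ?thesis by (simp add: dot_square_norm)
  qed
  define A B C where "A = 1 / (2 * a) * (Z y \<bullet> Z y)" and "B = 1 / (2 * b) * (W y \<bullet> W y)"
    and "C = (l - 1) * (u y \<bullet> u y)"
  note abbr = A_def [symmetric] B_def [symmetric] C_def [symmetric]
  have "11 * (u y \<bullet> u y) \<le> (l - 1) * (u y \<bullet> u y)" using assms by (intro mult_right_mono) auto
  moreover have "0 \<le> u' y \<bullet> u' y" "0 \<le> Z y \<bullet> Z y" "0 \<le> W y \<bullet> W y" "0 \<le> u y \<bullet> u y" by simp_all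
  ultimately show ?thesis
    using ZZ c[of "Z y"] c[of "W y"] unfolding amplitude_def energy_def inner_add_right abbr by argo
qed

text \<open>
Relative to \<open>amplitude\<close>, \<open>u\<close> gains \<open>1 / sqrt (l - 1)\<close> and \<open>v\<close> gains \<open>1 / l\<close>; the latter compensates the
factors \<open>\<mu>\<close> and \<open>\<nu>\<close> in the flux, uniformly in \<open>l\<close>, because \<open>\<mu> / l \<le> s\<close>.
\<close>

lemma amplitude_contraction:
  assumes l: "2 * 10^7 \<le> l" and s: "\<mu> \<le> s * l" "\<nu> \<le> s * l" "s \<le> 1 / 10^9"
    and M: "\<And>y. amplitude y \<le> M"
  shows "amplitude y \<le> M / 2" and "l * cmod (v y) \<le> 8 * sqrt M"
proof -
  define k where "k = sqrt (l - 1)"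
  define m where "m = sqrt M"
  have k2: "k\<^sup>2 = l - 1" using l by (simp add: k_def)
  \<comment> \<open>A wave number of at least \<open>4000\<close> brings the flux below \<open>Q M / 99\<close>. Integration over the line
    and the comparison of the amplitude with the energy then leave the factor \<open>48 / 99 < 1 / 2\<close>.\<close>
  have "sqrt (4000\<^sup>2) \<le> k" unfolding k_def using l by (intro real_sqrt_le_mono) simp
  then have k: "4000 \<le> k" by simp
  have kl: "k \<le> l" using k k2 mult_right_mono[of 1 k k] by (simp add: power2_eq_square)
  have nn: "0 \<le> u' y \<bullet> u' y" "0 \<le> Z y \<bullet> Z y" "0 \<le> W y \<bullet> W y" "0 \<le> (l - 1) * (u y \<bullet> u y)" for y
    using l by simp_all
  have M0: "0 \<le> M" using M[of 0] nn[of 0] unfolding amplitude_def by linarith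
  have mM: "m * m = M" "0 \<le> m" using M0 by (simp_all add: m_def)
  have bds: "cmod (u' y) \<le> m" "k * cmod (u y) \<le> m" "cmod (Z y) \<le> m" "cmod (W y) \<le> m" for y
  proof -
    have "u' y \<bullet> u' y \<le> M" "(l - 1) * (u y \<bullet> u y) \<le> M" "Z y \<bullet> Z y \<le> M" "W y \<bullet> W y \<le> M"
      using M[of y] nn[of y] unfolding amplitude_def by linarith+
    then have "(cmod (u' y))\<^sup>2 \<le> M" "(k * cmod (u y))\<^sup>2 \<le> M" "(cmod (Z y))\<^sup>2 \<le> M" "(cmod (W y))\<^sup>2 \<le> M"
      by (simp_all add: dot_square_norm power_mult_distrib k2)
    then show "cmod (u' y) \<le> m" "k * cmod (u y) \<le> m" "cmod (Z y) \<le> m" "cmod (W y) \<le> m"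
      unfolding m_def by (intro real_le_rsqrt; simp)+
  qed
  have ub: "cmod (u y) \<le> m / k" for y using bds(2)[of y] k by (simp add: field_simps)
  have uk: "m / k \<le> m / 4000" using k mM by (intro divide_left_mono) auto
  have u4: "cmod (u y) \<le> m / 4000" for y by (rule order_trans[OF ub uk])
  have Qb: "0 < Q y" "Q y \<le> 3/2" "Q y * Q y \<le> 9/4" for y
    using Q_pos Q_le_3_2 mult_mono[of "Q y" "3/2" "Q y" "3/2"] less_imp_le[OF Q_pos[of y]] by auto
  obtain C where C: "\<And>y. cmod (v y) \<le> C"
    using bounded_of_vanishing[OF continuous_of_deriv[OF v_deriv] u_v_lim(3)] by blast
  define c where "c = (SUP y. cmod (v y))"
  have bdd: "bdd_above (range (\<lambda>y. cmod (v y)))" using C by (auto simp: bdd_above_def)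
  have vc: "cmod (v y) \<le> c" for y unfolding c_def by (rule cSUP_upper[OF _ bdd]) simp
  have c0: "0 \<le> c" using order_trans[OF norm_ge_zero vc] .
  have "(1 + l) * cmod (v y) \<le> 9/4 * (m + 2 * c) + 3/2 * m" for y
  proof -
    have src: "cmod (Qc y * Qc y * (u y - 2 * v y) + Qc y * ((Z y + W y) / 2)) \<le> 9/4 * (m + 2 * c) + 3/2 * m" for y
    proof -
      have "cmod (u y - 2 * v y) \<le> m + 2 * c"
        using norm_triangle_ineq4[of "u y" "2 * v y"] u4[of y] vc[of y] mM
        by (simp only: norm_mult norm_numeral)
      then have "cmod (Qc y * Qc y * (u y - 2 * v y)) \<le> 9/4 * (m + 2 * c)"
        unfolding norm_mult norm_Qc using Qb[of y] by (intro mult_mono) auto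
      moreover have "cmod ((Z y + W y) / 2) \<le> m"
        using norm_triangle_ineq[of "Z y" "W y"] bds[of y] by (simp add: norm_divide)
      then have "cmod (Qc y * ((Z y + W y) / 2)) \<le> 3/2 * m"
        unfolding norm_mult norm_Qc using Qb[of y] by (intro mult_mono) auto
      ultimately show ?thesis
        by (rule order_trans[OF norm_triangle_ineq add_mono])
    qed
    have v'': "(v' has_vector_derivative of_real ((sqrt (1 + l))\<^sup>2) * v t
        + (Qc t * Qc t * (u t - 2 * v t) + Qc t * ((Z t + W t) / 2))) (at t)" for t
      using v'_deriv[of t] l by simp
    show ?thesis
      using resolvent_bound[OF v_deriv v'' src _ tendsto_at_infinityD(1)[OF u_v_lim(3)] tendsto_at_infinityD(1)[OF u_v_lim(4)]
          tendsto_at_infinityD(2)[OF u_v_lim(3)] tendsto_at_infinityD(2)[OF u_v_lim(4)], of y] l by simp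
  qed
  then have "cmod (v y) \<le> (9/4 * (m + 2 * c) + 3/2 * m) / (1 + l)" for y
    using l by (simp add: field_simps)
  then have "c \<le> (9/4 * (m + 2 * c) + 3/2 * m) / (1 + l)"
    unfolding c_def by (intro cSUP_least) auto
  then have "(1 + l) * c \<le> 9/4 * (m + 2 * c) + 3/2 * m" using l by (simp add: field_simps)
  moreover have "9 * c \<le> l * c" using l c0 by (intro mult_right_mono) auto
  ultimately have lc: "l * c \<le> 8 * m" using mM(2) unfolding distrib_right mult_1_left by argo
  then have lv: "l * cmod (v y) \<le> 8 * m" for y
    using order_trans[OF mult_left_mono[OF vc[of y]], of l] l by simp
  then show "l * cmod (v y) \<le> 8 * sqrt M" unfolding m_def .
  have "0 < s * l" using \<mu> s(1) by simp
  moreover have l0: "0 < l" using l by simp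
  ultimately have s0: "0 \<le> s" by (simp add: zero_less_mult_iff)
  have v_small: "cmod (v y) \<le> m / 500" for y
    using lv[of y] mult_right_mono[of "4000" l "cmod (v y)"] kl k by simp
  have \<mu>v: "\<gamma> * cmod (v y) \<le> m / 1000" if "\<gamma> \<le> s * l" "0 \<le> \<gamma>" for \<gamma> y
  proof -
    have "\<gamma> * cmod (v y) \<le> s * (l * cmod (v y))" using mult_right_mono[OF that(1), of "cmod (v y)"] by simp
    also have "\<dots> \<le> s * (8 * m)" using lv[of y] s0 by (intro mult_left_mono) auto
    also have "\<dots> \<le> 1 / 10^9 * (8 * m)" using s mM by (intro mult_right_mono) auto
    finally show ?thesis using mM by simp
  qed
  have cs: "\<bar>x \<bullet> z\<bar> \<le> X * Y" if "cmod x \<le> X" "cmod z \<le> Y" for x z :: complex and X Y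
    using order_trans[OF Cauchy_Schwarz_ineq2 mult_mono[OF that]] order_trans[OF norm_ge_zero that(1)] by simp
  have flux_b: "\<bar>flux y\<bar> \<le> Q y * (M / 99)" for y
  proof -
    have mm: "0 \<le> m * m" using M0 mM(1) by simp
    have 1: "\<bar>u' y \<bullet> (2 * u y - v y)\<bar> \<le> m * (m / 400)"
      using norm_triangle_ineq4[of "2 * u y" "v y"] u4[of y] v_small[of y] mM
      by (intro cs bds) (simp add: norm_mult)
    have 2: "\<bar>u y \<bullet> (Z y + W y)\<bar> \<le> (m / 4000) * (2 * m)"
      using norm_triangle_ineq[of "Z y" "W y"] bds[of y] u4[of y] by (intro cs) auto
    have 3: "\<bar>\<mu> * ((\<i> * Z y) \<bullet> v y)\<bar> \<le> m * (m / 1000)"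
      using cs[of "\<i> * Z y" m "of_real \<mu> * v y" "m / 1000"] bds[of y] \<mu>v[OF s(1), of y] \<mu>
      by (simp add: norm_mult scaleR_conv_of_real[symmetric])
    have 4: "\<bar>\<nu> * ((\<i> * W y) \<bullet> v y)\<bar> \<le> m * (m / 1000)"
      using cs[of "\<i> * W y" m "of_real \<nu> * v y" "m / 1000"] bds[of y] \<mu>v[OF s(2), of y] \<nu>
      by (simp add: norm_mult scaleR_conv_of_real[symmetric])
    have 5: "\<bar>\<gamma> * ((\<i> * u y) \<bullet> v y)\<bar> \<le> (m / 4000) * (m / 1000)" if "0 \<le> \<gamma>" "\<gamma> \<le> s * l" for \<gamma>
      using cs[of "\<i> * u y" "m / 4000" "of_real \<gamma> * v y" "m / 1000"] u4[of y] \<mu>v[OF that(2,1), of y] that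
      by (simp add: norm_mult scaleR_conv_of_real[symmetric])
    define R where "R = - 2 * Q y * (u' y \<bullet> (2 * u y - v y)) - tanh y * (u y \<bullet> (Z y + W y))
      + \<mu> * ((\<i> * Z y) \<bullet> v y) - \<nu> * ((\<i> * W y) \<bullet> v y)
      + Q y * a * (\<mu> * ((\<i> * u y) \<bullet> v y)) - Q y * b * (\<nu> * ((\<i> * u y) \<bullet> v y))"
    have flux_R: "flux y = Q y * R" by (simp add: flux_def R_def algebra_simps power2_eq_square)
    have i: "\<bar>Q y * (u' y \<bullet> (2 * u y - v y))\<bar> \<le> 3/2 * (m * (m / 400))"
      unfolding abs_mult using 1 Qb[of y] by (intro mult_mono) auto
    have ii: "\<bar>tanh y * (u y \<bullet> (Z y + W y))\<bar> \<le> 1 * ((m / 4000) * (2 * m))"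
      unfolding abs_mult using 2 tanh_real_bounds[of y] by (intro mult_mono) auto
    have iii: "\<bar>Q y * a * (\<mu> * ((\<i> * u y) \<bullet> v y))\<bar> \<le> 3/2 * 2 * ((m / 4000) * (m / 1000))"
      unfolding abs_mult[of "Q y * a"] abs_mult[of "Q y"] using 5[OF less_imp_le[OF \<mu>] s(1)] Qb[of y] a
      by (intro mult_mono) auto
    have iv: "\<bar>Q y * b * (\<nu> * ((\<i> * u y) \<bullet> v y))\<bar> \<le> 3/2 * 2 * ((m / 4000) * (m / 1000))"
      unfolding abs_mult[of "Q y * b"] abs_mult[of "Q y"] using 5[OF less_imp_le[OF \<nu>] s(2)] Qb[of y] b
      by (intro mult_mono) auto
    have "\<bar>R\<bar> \<le> M / 99"
    proof -
      define A where "A = Q y * (u' y \<bullet> (2 * u y - v y))"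
      have "R = - 2 * A - tanh y * (u y \<bullet> (Z y + W y))
      + \<mu> * ((\<i> * Z y) \<bullet> v y) - \<nu> * ((\<i> * W y) \<bullet> v y)
      + Q y * a * (\<mu> * ((\<i> * u y) \<bullet> v y)) - Q y * b * (\<nu> * ((\<i> * u y) \<bullet> v y))"
        by (simp add: R_def A_def)
      moreover have "\<bar>A\<bar> \<le> 3/2 * (m * (m / 400))" using i by (simp add: A_def)
      ultimately show ?thesis using ii 3 4 iii iv mm unfolding mM(1)[symmetric]
        by (simp only: times_divide_eq_right times_divide_eq_left mult.assoc)
    qed
    then show ?thesis unfolding flux_R abs_mult using Qb(1)[of y] by (simp add: mult_left_mono)
  qed
  have "cmod (of_real (energy y)) \<le> 2 * (3 * (M / 99)) / 1"
  proof (rule bounded_of_exp_source[where w = "\<lambda>y. of_real (energy y)" and r = "\<lambda>y. of_real (flux y)" and c = 0])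
    show "((\<lambda>y. complex_of_real (energy y)) has_vector_derivative 0 * of_real (energy t) + of_real (flux t)) (at t)" for t
      using has_vector_derivative_of_real[of energy "flux t" "at t"] energy_deriv
      by (simp add: has_real_derivative_iff_has_vector_derivative)
    show "cmod (of_real (flux t)) \<le> 3 * (M / 99) * exp (- 1 * \<bar>t\<bar>)" for t
      using order_trans[OF flux_b[of t] mult_right_mono[OF Q_le_exp[of t]], of ] M0 by (simp add: mult_ac)
    show "((\<lambda>y. complex_of_real (energy y)) \<longlongrightarrow> 0) at_top"
      using tendsto_of_real[OF tendsto_at_infinityD(1)[OF energy_lim]] by simp
  qed auto
  then have "energy y \<le> 6 * M / 99" by simp
  moreover have "11 \<le> l - 1" using l by simp
  ultimately show "amplitude y \<le> M / 2" using amplitude_le_energy[of y] M0 by simp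
qed

theorem high_frequency:
  assumes l: "2 * 10^7 \<le> l" and s: "\<mu> \<le> s * l" "\<nu> \<le> s * l" "s \<le> 1 / 10^9"
  shows "K y = 0 \<and> F y = 0 \<and> Z y = 0 \<and> W y = 0"
proof -
  let ?P = "\<lambda>M. \<forall>y. amplitude y \<le> M"
  note cont = continuous_of_deriv[OF u_deriv] continuous_of_deriv[OF u'_deriv]
    continuous_of_deriv[OF Z] continuous_of_deriv[OF W]
  have "continuous_on UNIV (\<lambda>y. complex_of_real (amplitude y))"
    unfolding amplitude_def by (intro continuous_intros cont)
  moreover have "((\<lambda>y. complex_of_real (amplitude y)) \<longlongrightarrow> 0) at_infinity"
    using tendsto_of_real[OF amplitude_lim] by simp
  ultimately obtain C where C: "\<And>y. cmod (of_real (amplitude y)) \<le> C"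
    using bounded_of_vanishing by blast
  have start: "?P C"
  proof
    show "amplitude y \<le> C" for y using C[of y] by simp
  qed
  have step: "?P (M / 2)" if "?P M" for M
    using amplitude_contraction(1)[OF l s] that by blast
  have size0: "amplitude y \<le> 0" for y
    by (rule zero_of_halving[of ?P _ _ 1, OF start step]) auto
  have zero: "u y = 0 \<and> Z y = 0 \<and> W y = 0" for y
  proof -
    have "0 \<le> u' y \<bullet> u' y" "0 \<le> Z y \<bullet> Z y" "0 \<le> W y \<bullet> W y" "0 \<le> (l - 1) * (u y \<bullet> u y)"
      using l by simp_all
    then have "(l - 1) * (u y \<bullet> u y) = 0" "Z y \<bullet> Z y = 0" "W y \<bullet> W y = 0"
      using size0[of y] unfolding amplitude_def by linarith+
    then show ?thesis using l by simp
  qed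
  have "l * cmod (v y) \<le> 8 * sqrt 0"
    by (rule amplitude_contraction(2)[OF l s size0])
  then have "v y = 0" using l by (simp add: mult_le_0_iff)
  then show ?thesis using zero[of y] by (simp add: u_def v_def)
qed

end

section \<open>Test functions and the fundamental lemma\<close>

text \<open>
The functions \<open>p (1 / x) exp (- 1 / x)\<close>, continued by \<open>0\<close>, form a family that is closed under
differentiation; this gives smoothness without formulas for higher derivatives.
\<close>

definition flat :: "real poly \<Rightarrow> real \<Rightarrow> real"
  where "flat p x = (if x \<le> 0 then 0 else poly p (1 / x) * exp (- (1 / x)))"

lemma poly_exp_vanishes: "((\<lambda>t::real. poly p t * exp (- t)) \<longlongrightarrow> 0) at_top"
proof -
  have "((\<lambda>t::real. \<Sum>i\<le>degree p. coeff p i * (t ^ i / exp t)) \<longlongrightarrow> (\<Sum>i\<le>degree p. coeff p i * 0)) at_top"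
    by (intro tendsto_intros tendsto_power_div_exp_0)
  then show ?thesis
    by (simp add: poly_altdef sum_distrib_right exp_minus divide_inverse mult.assoc)
qed

lemma flat_deriv:
  "(flat p has_real_derivative flat ([:0, 0, 1:] * (p - pderiv p)) x) (at x)"
proof -
  consider "x < 0" | "x = 0" | "0 < x" by linarith
  then show ?thesis
  proof cases
    case 1
    have "((\<lambda>_. 0) has_real_derivative 0) (at x)" by simp
    from has_field_derivative_transform_within_open[OF this, of "{..<0}" "flat p"] 1
    show ?thesis by (simp add: flat_def)
  next
    case 2
    have "((\<lambda>h. flat p h / h) \<longlongrightarrow> 0) (at_right 0)"
    proof (rule Lim_transform_eventually)
      show "((\<lambda>h::real. poly (pCons 0 p) (inverse h) * exp (- inverse h)) \<longlongrightarrow> 0) (at_right 0)"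
        by (rule filterlim_compose[OF poly_exp_vanishes filterlim_inverse_at_top_right])
      show "\<forall>\<^sub>F h in at_right 0. poly (pCons 0 p) (inverse h) * exp (- inverse h) = flat p h / h"
        using eventually_at_right_less[of 0]
        by eventually_elim (simp add: flat_def field_simps)
    qed
    moreover have "((\<lambda>h. flat p h / h) \<longlongrightarrow> 0) (at_left 0)"
    proof (rule Lim_transform_eventually[OF tendsto_const])
      show "\<forall>\<^sub>F h in at_left 0. 0 = flat p h / h"
        using eventually_at_left_real[of "-1" 0]
        by simp (auto elim!: eventually_mono simp: flat_def)
    qed
    ultimately have "((\<lambda>h. flat p h / h) \<longlongrightarrow> 0) (at 0)"
      by (simp add: filterlim_split_at)
    then show ?thesis using 2 by (simp add: DERIV_def flat_def)
  next
    case 3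
    have "((\<lambda>x. poly p (1 / x) * exp (- (1 / x))) has_real_derivative
        poly ([:0, 0, 1:] * (p - pderiv p)) (1 / x) * exp (- (1 / x))) (at x)"
      using 3 by (auto intro!: derivative_eq_intros simp: field_simps power2_eq_square)
    from has_field_derivative_transform_within_open[OF this, of "{0<..}" "flat p"] 3
    show ?thesis by (simp add: flat_def)
  qed
qed

inductive flat_combination :: "(real \<Rightarrow> real) \<Rightarrow> bool" where
  const: "flat_combination (\<lambda>_. c)"
| flat: "flat_combination (\<lambda>x. flat p (c * x + d))"
| add: "flat_combination f \<Longrightarrow> flat_combination g \<Longrightarrow> flat_combination (\<lambda>x. f x + g x)"
| mult: "flat_combination f \<Longrightarrow> flat_combination g \<Longrightarrow> flat_combination (\<lambda>x. f x * g x)"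

lemma flat_combination_deriv:
  "flat_combination f \<Longrightarrow> \<exists>g. flat_combination g \<and> (\<forall>x. (f has_real_derivative g x) (at x))"
proof (induction rule: flat_combination.induct)
  case (const c)
  show ?case by (rule exI[of _ "\<lambda>_. 0"]) (auto intro: flat_combination.const)
next
  case (flat p c d)
  have "((\<lambda>x. flat p (c * x + d)) has_real_derivative
      c * flat ([:0, 0, 1:] * (p - pderiv p)) (c * x + d)) (at x)" for x
  proof -
    have "((\<lambda>x. c * x + d) has_real_derivative c) (at x)"
      by (auto intro!: derivative_eq_intros)
    from DERIV_chain2[where f = "flat p" and g = "\<lambda>x. c * x + d", OF flat_deriv this]
    show ?thesis by (simp add: mult.commute)
  qed
  then show ?case using flat_combination.intros by blast
next
  case (add f g)
  then obtain f' g' where "flat_combination f'" "flat_combination g'"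
    "\<And>x. (f has_real_derivative f' x) (at x)" "\<And>x. (g has_real_derivative g' x) (at x)" by blast
  then show ?case
    by (intro exI[of _ "\<lambda>x. f' x + g' x"]) (auto intro: DERIV_add flat_combination.add)
next
  case (mult f g)
  then obtain f' g' where "flat_combination f'" "flat_combination g'"
    "\<And>x. (f has_real_derivative f' x) (at x)" "\<And>x. (g has_real_derivative g' x) (at x)" by blast
  with mult(1,2) show ?case
    by (intro exI[of _ "\<lambda>x. f' x * g x + f x * g' x"])
       (auto intro!: flat_combination.intros derivative_eq_intros)
qed

lemma flat_combination_smooth:
  assumes "flat_combination f"
  shows "flat_combination ((deriv ^^ n) f)" and "((deriv ^^ n) f) field_differentiable at x"
proof -
  show *: "flat_combination ((deriv ^^ n) f)" for n
  proof (induction n)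
    case (Suc n)
    from flat_combination_deriv[OF this] obtain g
      where "flat_combination g" "\<And>x. ((deriv ^^ n) f has_real_derivative g x) (at x)" by blast
    moreover from this have "(deriv ^^ Suc n) f = g" by (auto intro!: ext DERIV_imp_deriv)
    ultimately show ?case by simp
  qed (simp add: assms)
  show "((deriv ^^ n) f) field_differentiable at x"
    using flat_combination_deriv[OF *[of n]] by (auto simp: field_differentiable_def)
qed

lemma test_function_support:
  assumes "test_function \<phi>"
  obtains R where "0 < R" "\<And>x. R < \<bar>x\<bar> \<Longrightarrow> \<phi> x = 0"
proof -
  have "bounded {y. \<phi> y \<noteq> 0}"
    using assms by (simp add: test_function_def)
  then obtain R where "0 < R" "\<And>y. \<phi> y \<noteq> 0 \<Longrightarrow> norm y \<le> R"
    by (auto simp: bounded_pos)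
  then show ?thesis using that by (metis linorder_not_less real_norm_def)
qed

lemma test_functionI:
  assumes "\<And>n x. ((deriv ^^ n) \<phi>) field_differentiable at x" and "\<And>x. R < \<bar>x\<bar> \<Longrightarrow> \<phi> x = 0"
  shows "test_function \<phi>"
proof -
  have "{y. \<phi> y \<noteq> 0} \<subseteq> cball 0 R" using assms(2) by (force simp: not_less[symmetric])
  then have "bounded {y. \<phi> y \<noteq> 0}" using bounded_cball bounded_subset by blast
  then show ?thesis using assms(1) by (simp add: test_function_def)
qed

lemma test_function_deriv:
  assumes "test_function \<phi>"
  shows "(\<phi> has_real_derivative deriv \<phi> x) (at x)" and "test_function (deriv \<phi>)"
proof -
  have n: "((deriv ^^ n) \<phi>) field_differentiable at x" for n x
    using assms by (simp add: test_function_def)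
  show d: "(\<phi> has_real_derivative deriv \<phi> x) (at x)" for x
    using n[of 0 x] by (simp add: DERIV_deriv_iff_field_differentiable)
  obtain R where R: "\<And>x. R < \<bar>x\<bar> \<Longrightarrow> \<phi> x = 0" using test_function_support[OF assms] by blast
  show "test_function (deriv \<phi>)"
  proof (rule test_functionI)
    show "((deriv ^^ n) (deriv \<phi>)) field_differentiable at x" for n x
      using n[of "Suc n" x] by (simp add: funpow_swap1)
    show "deriv \<phi> x = 0" if "R < \<bar>x\<bar>" for x
    proof -
      have "open {x::real. R < \<bar>x\<bar>}" by (intro open_Collect_less continuous_intros)
      then have "((\<lambda>_. 0) has_real_derivative deriv \<phi> x) (at x)"
        by (rule has_field_derivative_transform_within_open[OF d]) (use that R in auto)
      then show ?thesis using DERIV_unique DERIV_const by blast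
    qed
  qed
qed

lemma test_function_continuous: "test_function \<phi> \<Longrightarrow> continuous_on UNIV \<phi>"
  using test_function_deriv(1) by (auto intro!: continuous_at_imp_continuous_on DERIV_isCont)

lemma integrable_compact_support:
  fixes f :: "real \<Rightarrow> real"
  assumes "continuous_on UNIV f" "\<And>x. R < \<bar>x\<bar> \<Longrightarrow> f x = 0"
  shows "integrable lborel f"
proof -
  have "set_integrable lborel {-R..R} f"
    by (intro borel_integrable_atLeastAtMost' continuous_on_subset[OF assms(1)]) auto
  moreover have "(\<lambda>x. indicator {-R..R} x *\<^sub>R f x) = f"
    using assms(2) by (force simp: indicator_def)
  ultimately show ?thesis by (simp add: set_integrable_def)
qed

text \<open>
Stretching the argument by a factor \<open>n + 1\<close> makes these functions converge to the indicator of
\<open>(a, b)\<close> with the support unchanged.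
\<close>

definition bump :: "real \<Rightarrow> real \<Rightarrow> nat \<Rightarrow> real \<Rightarrow> real"
  where "bump a b n x = flat 1 (real (Suc n) * (x - a)) * flat 1 (real (Suc n) * (b - x))"

lemma bump_flat: "flat_combination (bump a b n)"
proof -
  have "flat_combination (\<lambda>x. flat 1 (real (Suc n) * x + - real (Suc n) * a) * flat 1 (- real (Suc n) * x + real (Suc n) * b))"
    by (intro flat_combination.intros)
  then show ?thesis unfolding bump_def [abs_def] by (simp add: algebra_simps)
qed

lemma bump_outside: "x \<notin> {a<..<b} \<Longrightarrow> bump a b n x = 0"
  by (auto simp: bump_def flat_def mult_le_0_iff)

lemma bump_bounds: "0 \<le> bump a b n x" "bump a b n x \<le> indicator {a<..<b} x"
proof -
  have f: "0 \<le> flat 1 z" "flat 1 z \<le> 1" for z by (auto simp: flat_def)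
  show "0 \<le> bump a b n x" unfolding bump_def by (intro mult_nonneg_nonneg f)
  show "bump a b n x \<le> indicator {a<..<b} x"
  proof (cases "x \<in> {a<..<b}")
    case True
    then show ?thesis unfolding bump_def using f by (simp add: mult_le_one)
  qed (simp add: bump_outside)
qed

lemma bump_test: "test_function (bump a b n)"
proof (rule test_functionI)
  show "((deriv ^^ m) (bump a b n)) field_differentiable at x" for m x
    by (rule flat_combination_smooth(2)[OF bump_flat])
  show "bump a b n x = 0" if "max \<bar>a\<bar> \<bar>b\<bar> < \<bar>x\<bar>" for x
    using that by (intro bump_outside) auto
qed

lemma bump_tendsto: "(\<lambda>n. bump a b n x) \<longlonglongrightarrow> indicator {a<..<b} x"
proof (cases "x \<in> {a<..<b}")
  case True
  have e: "(\<lambda>n. flat 1 (real (Suc n) * z)) \<longlonglongrightarrow> 1" if "0 < z" for z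
  proof -
    have "(\<lambda>n. exp (- (1 / real (Suc n) * (1 / z)))) \<longlonglongrightarrow> exp (- (0 * (1 / z)))"
      by (intro tendsto_intros LIMSEQ_Suc lim_1_over_n)
    moreover have "flat 1 (real (Suc n) * z) = exp (- (1 / real (Suc n) * (1 / z)))" for n
      using that by (simp add: flat_def not_le)
    ultimately show ?thesis by simp
  qed
  have "(\<lambda>n. bump a b n x) \<longlonglongrightarrow> 1 * 1"
    unfolding bump_def using True by (intro tendsto_mult e) auto
  then show ?thesis using True by simp
qed (simp add: bump_outside)

text \<open>
The bumps give \<open>\<integral> h = 0\<close> over every bounded interval. The positive and the negative part of a
truncation of \<open>h\<close> are therefore densities of the same measure.
\<close>

lemma fundamental_lemma:
  fixes h :: "real \<Rightarrow> real"
  assumes h [measurable]: "h \<in> borel_measurable borel"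
    and int: "\<And>R. integrable lborel (\<lambda>x. indicator {-R..R} x * h x)"
    and zero: "\<And>a b n. (\<integral>x. h x * bump a b n x \<partial>lborel) = 0"
  shows "AE x in lborel. h x = 0"
proof -
  have I: "(\<integral>x. indicator {a<..<b} x * h x \<partial>lborel) = 0" for a b
  proof (rule LIMSEQ_unique)
    define R where "R = max \<bar>a\<bar> \<bar>b\<bar>"
    have [measurable]: "bump a b n \<in> borel_measurable borel" for n
      using test_function_continuous[OF bump_test] by (rule borel_measurable_continuous_onI)
    show "(\<lambda>n. \<integral>x. h x * bump a b n x \<partial>lborel) \<longlonglongrightarrow> (\<integral>x. indicator {a<..<b} x * h x \<partial>lborel)"
    proof (rule integral_dominated_convergence)
      show "integrable lborel (\<lambda>x. \<bar>indicator {-R..R} x * h x\<bar>)" using int by (rule integrable_abs)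
      show "AE x in lborel. (\<lambda>n. h x * bump a b n x) \<longlonglongrightarrow> indicator {a<..<b} x * h x"
        using tendsto_mult_left[OF bump_tendsto] by (simp add: mult.commute)
      show "AE x in lborel. norm (h x * bump a b n x) \<le> \<bar>indicator {-R..R} x * h x\<bar>" for n
      proof (rule AE_I2)
        fix x
        have "bump a b n x \<le> indicator {-R..R} x"
          by (rule order_trans[OF bump_bounds(2)]) (auto simp: R_def indicator_def)
        then show "norm (h x * bump a b n x) \<le> \<bar>indicator {-R..R} x * h x\<bar>"
          using bump_bounds(1)[of a b n x] by (simp add: abs_mult mult.commute mult_left_mono)
      qed
    qed measurable
  qed (simp add: zero)
  have "AE x in lborel. indicator {-R<..<R} x * h x = 0" for R
  proof -
    define f where "f x = indicator {-R<..<R} x * h x" for x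
    have [measurable]: "f \<in> borel_measurable borel" by (simp add: f_def [abs_def])
    have f: "integrable lborel f"
      by (rule Bochner_Integration.integrable_bound[OF int[of R]]) (auto simp: f_def indicator_def)
    have p: "integrable lborel (\<lambda>x. max 0 (f x) * indicator {c<..} x)"
      and m: "integrable lborel (\<lambda>x. max 0 (- f x) * indicator {c<..} x)" for c
      by (rule Bochner_Integration.integrable_bound[OF f]; auto simp: indicator_def)+
    let ?P = "density lborel (\<lambda>x. ennreal (max 0 (f x)))" and ?N = "density lborel (\<lambda>x. ennreal (max 0 (- f x)))"
    have eP: "emeasure ?P {c<..} = ennreal (\<integral>x. max 0 (f x) * indicator {c<..} x \<partial>lborel)" for c
    proof -
      have "emeasure ?P {c<..} = (\<integral>\<^sup>+x. ennreal (max 0 (f x) * indicator {c<..} x) \<partial>lborel)"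
        by (simp add: emeasure_density) (intro nn_integral_cong, simp add: indicator_def)
      then show ?thesis using nn_integral_eq_integral[OF p] by simp
    qed
    have eN: "emeasure ?N {c<..} = ennreal (\<integral>x. max 0 (- f x) * indicator {c<..} x \<partial>lborel)" for c
    proof -
      have "emeasure ?N {c<..} = (\<integral>\<^sup>+x. ennreal (max 0 (- f x) * indicator {c<..} x) \<partial>lborel)"
        by (simp add: emeasure_density) (intro nn_integral_cong, simp add: indicator_def)
      then show ?thesis using nn_integral_eq_integral[OF m] by simp
    qed
    have "?P = ?N"
    proof (rule measure_eqI_lessThan)
      fix c
      have "(\<integral>x. max 0 (f x) * indicator {c<..} x \<partial>lborel) - (\<integral>x. max 0 (- f x) * indicator {c<..} x \<partial>lborel)
         = (\<integral>x. max 0 (f x) * indicator {c<..} x - max 0 (- f x) * indicator {c<..} x \<partial>lborel)"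
        using p m by simp
      also have "\<dots> = (\<integral>x. indicator {max c (-R)<..<R} x * h x \<partial>lborel)"
        by (rule Bochner_Integration.integral_cong) (auto simp: f_def indicator_def)
      finally show "emeasure ?P {c<..} = emeasure ?N {c<..}" using I eP eN by simp
    qed (auto simp: eP)
    then have "AE x in lborel. ennreal (max 0 (f x)) = ennreal (max 0 (- f x))"
      by (intro sigma_finite_measure.density_unique[OF sigma_finite_lborel]) auto
    then show ?thesis unfolding f_def [symmetric]
      by eventually_elim (auto simp: max_def split: if_splits)
  qed
  then have "AE x in lborel. \<forall>R::nat. indicator {- real R<..<real R} x * h x = 0"
    unfolding AE_all_countable by blast
  then show ?thesis
  proof eventually_elim
    case (elim x)
    obtain n where "\<bar>x\<bar> < real n" using reals_Archimedean2 by blast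
    then show ?case using elim[rule_format, of n] by (auto simp: indicator_def abs_less_iff)
  qed
qed

section \<open>Weak derivatives and primitives\<close>

text \<open>
The signed kernel of integration from \<open>0\<close> to \<open>x\<close>, chosen so that a primitive of a merely
integrable function is a parameter integral to which Fubini's theorem applies.
\<close>

definition side :: "real \<Rightarrow> real \<Rightarrow> real"
  where "side x t = indicator {0<..<x} t - indicator {x<..<0} t"

definition primitive :: "(real \<Rightarrow> real) \<Rightarrow> real \<Rightarrow> real"
  where "primitive g x = (\<integral>t. side x t * g t \<partial>lborel)"

lemma side_measurable [measurable]: "(\<lambda>(x, t). side x t) \<in> borel_measurable (borel \<Otimes>\<^sub>M borel)"
proof -
  have eq: "side x t = (if 0 < t \<and> t < x then 1 else 0) - (if x < t \<and> t < 0 then 1 else 0)" for x t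
    by (auto simp: side_def indicator_def)
  show ?thesis unfolding eq by measurable
qed

lemma abs_side_le: "\<bar>side x t\<bar> \<le> indicator {- \<bar>x\<bar>..\<bar>x\<bar>} t"
  by (auto simp: side_def indicator_def)

lemma side_measurable' [measurable]: "side x \<in> borel_measurable borel" "(\<lambda>x. side x t) \<in> borel_measurable borel"
  using measurable_compose[OF measurable_Pair1' side_measurable]
  by (auto simp: side_def [abs_def] intro!: borel_measurable_diff borel_measurable_indicator')

lemma integrable_side:
  fixes g :: "real \<Rightarrow> real"
  assumes [measurable]: "g \<in> borel_measurable borel"
    and int: "\<And>R. integrable lborel (\<lambda>t. indicator {-R..R} t * g t)"
  shows "integrable lborel (\<lambda>t. side x t * g t)"
  by (rule Bochner_Integration.integrable_bound[OF int[of "\<bar>x\<bar>"]])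
     (use abs_side_le[of x] in \<open>auto simp: abs_mult intro!: mult_right_mono\<close>)

lemma primitive_continuous:
  fixes g :: "real \<Rightarrow> real"
  assumes g [measurable]: "g \<in> borel_measurable borel"
    and int: "\<And>R. integrable lborel (\<lambda>t. indicator {-R..R} t * g t)"
  shows "continuous_on UNIV (primitive g)"
proof (rule continuous_at_imp_continuous_on, rule ballI)
  fix x
  show "isCont (primitive g) x"
    unfolding isCont_def primitive_def
  proof (rule tendsto_at_iff_sequentially[THEN iffD2], intro allI impI)
    fix X :: "nat \<Rightarrow> real" assume X: "\<forall>i. X i \<in> UNIV - {x}" "X \<longlonglongrightarrow> x"
    obtain R where R: "\<And>i. \<bar>X i\<bar> \<le> R"
      using Bseq_def[of X] convergentI[OF X(2)] convergent_imp_Bseq by (metis real_norm_def)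
    have "(\<lambda>i. \<integral>t. side (X i) t * g t \<partial>lborel) \<longlonglongrightarrow> (\<integral>t. side x t * g t \<partial>lborel)"
    proof (rule integral_dominated_convergence)
      show "integrable lborel (\<lambda>t. \<bar>indicator {-R..R} t * g t\<bar>)" using int by (rule integrable_abs)
      show "AE t in lborel. (\<lambda>i. side (X i) t * g t) \<longlonglongrightarrow> side x t * g t"
        using AE_lborel_singleton[of x]
      proof eventually_elim
        case (elim t)
        have "\<forall>\<^sub>F i in sequentially. side (X i) t = side x t"
        proof (cases "t < x")
          case True
          show ?thesis using order_tendstoD(1)[OF X(2) True]
            by eventually_elim (use True in \<open>auto simp: side_def indicator_def\<close>)
        next
          case False
          then have xt: "x < t" using elim by simp
          show ?thesis using order_tendstoD(2)[OF X(2) xt]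
            by eventually_elim (use xt in \<open>auto simp: side_def indicator_def\<close>)
        qed
        then show ?case by (intro tendsto_mult_right tendsto_eventually)
      qed
      show "AE t in lborel. norm (side (X i) t * g t) \<le> \<bar>indicator {-R..R} t * g t\<bar>" for i
      proof (rule AE_I2)
        fix t
        have "\<bar>side (X i) t\<bar> \<le> indicator {-R..R} t"
          by (rule order_trans[OF abs_side_le]) (use R[of i] in \<open>auto simp: indicator_def\<close>)
        then show "norm (side (X i) t * g t) \<le> \<bar>indicator {-R..R} t * g t\<bar>"
          by (simp add: abs_mult mult_right_mono)
      qed
    qed measurable
    then show "((\<lambda>x. \<integral>t. side x t * g t \<partial>lborel) \<circ> X) \<longlonglongrightarrow> (\<integral>t. side x t * g t \<partial>lborel)"
      by (simp add: o_def)
  qed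
qed

lemma primitive_deriv:
  fixes G :: "real \<Rightarrow> real"
  assumes G: "continuous_on UNIV G"
  shows "(primitive G has_real_derivative G x) (at x)"
proof -
  have "primitive G = (\<lambda>u. LBINT y=0..u. G y)"
  proof
    fix u :: real
    show "primitive G u = (LBINT y=0..u. G y)"
  proof (cases "0 \<le> u")
    case True
    then have "side u t = indicator {0<..<u} t" for t by (auto simp: side_def indicator_def)
    then show ?thesis using True
      by (simp add: primitive_def interval_lebesgue_integral_def set_lebesgue_integral_def zero_ereal_def)
  next
    case False
    then have "side u t = - indicator {u<..<0} t" for t by (auto simp: side_def indicator_def)
    then show ?thesis using False
      by (simp add: primitive_def interval_lebesgue_integral_def set_lebesgue_integral_def zero_ereal_def)
  qed
  qed
  moreover have "((\<lambda>u. LBINT y=0..u. G y) has_vector_derivative G x) (at x within {- \<bar>x\<bar> - 1..\<bar>x\<bar> + 1})"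
    unfolding zero_ereal_def
    by (rule interval_integral_FTC2) (use continuous_on_subset[OF G] in auto)
  ultimately have "(primitive G has_vector_derivative G x) (at x within {- \<bar>x\<bar> - 1..\<bar>x\<bar> + 1})"
    by simp
  moreover have "at x within {- \<bar>x\<bar> - 1..\<bar>x\<bar> + 1} = at x"
    by (rule at_within_interior) (auto simp: interior_atLeastAtMost_real)
  ultimately show ?thesis by (simp add: has_real_derivative_iff_has_vector_derivative)
qed

lemma integral_deriv_compact_support:
  fixes \<phi> \<phi>' :: "real \<Rightarrow> real"
  assumes d: "\<And>x. (\<phi> has_real_derivative \<phi>' x) (at x)" and c: "continuous_on UNIV \<phi>'"
    and \<phi>: "\<And>x. R < \<bar>x\<bar> \<Longrightarrow> \<phi> x = 0" "\<And>x. R < \<bar>x\<bar> \<Longrightarrow> \<phi>' x = 0"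
  shows "(\<integral>x. \<phi>' x \<partial>lborel) = 0"
    and "(\<integral>x. indicator {t<..} x * \<phi>' x \<partial>lborel) = - \<phi> t"
    and "(\<integral>x. indicator {..<t} x * \<phi>' x \<partial>lborel) = \<phi> t"
proof -
  define S where "S = max R \<bar>t\<bar> + 1"
  have S: "R < S" "t < S" "- S < t" by (auto simp: S_def)
  have \<phi>S: "\<phi> S = 0" "\<phi> (- S) = 0" by (intro \<phi>; use S in simp)+
  have cont: "isCont \<phi>' x" for x using c by (simp add: continuous_on_eq_continuous_at)
  have "(\<integral>x. indicator {t<..} x * \<phi>' x \<partial>lborel) = (\<integral>x. \<phi>' x * indicator {t..S} x \<partial>lborel)"
  proof (rule integral_cong_AE)
    show "AE x in lborel. indicator {t<..} x * \<phi>' x = \<phi>' x * indicator {t..S} x"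
      using AE_lborel_singleton[of t]
      by eventually_elim (use \<phi>(2) S in \<open>force simp: indicator_def\<close>)
  qed (use borel_measurable_continuous_onI[OF c] in measurable)
  also have "\<dots> = \<phi> S - \<phi> t" by (rule integral_FTC_Icc_real) (use S d cont in auto)
  finally show "(\<integral>x. indicator {t<..} x * \<phi>' x \<partial>lborel) = - \<phi> t" by (simp add: \<phi>S)
  have "(\<integral>x. indicator {..<t} x * \<phi>' x \<partial>lborel) = (\<integral>x. \<phi>' x * indicator {-S..t} x \<partial>lborel)"
  proof (rule integral_cong_AE)
    show "AE x in lborel. indicator {..<t} x * \<phi>' x = \<phi>' x * indicator {-S..t} x"
      using AE_lborel_singleton[of t]
      by eventually_elim (use \<phi>(2) S in \<open>force simp: indicator_def\<close>)
  qed (use borel_measurable_continuous_onI[OF c] in measurable)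
  also have "\<dots> = \<phi> t - \<phi> (- S)" by (rule integral_FTC_Icc_real) (use S d cont in auto)
  finally show "(\<integral>x. indicator {..<t} x * \<phi>' x \<partial>lborel) = \<phi> t" by (simp add: \<phi>S)
  have "(\<integral>x. \<phi>' x \<partial>lborel) = (\<integral>x. \<phi>' x * indicator {-S..S} x \<partial>lborel)"
    by (rule Bochner_Integration.integral_cong) (use \<phi>(2) S in \<open>force simp: indicator_def\<close>)+
  also have "\<dots> = \<phi> S - \<phi> (- S)" by (rule integral_FTC_Icc_real) (use S d cont in auto)
  finally show "(\<integral>x. \<phi>' x \<partial>lborel) = 0" by (simp add: \<phi>S)
qed

text \<open>
A primitive of \<open>g\<close> need not be differentiable everywhere, so the product rule is not available;
exchanging the order of integration takes its place.
\<close>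

lemma primitive_by_parts:
  fixes g \<phi> \<phi>' :: "real \<Rightarrow> real"
  assumes g [measurable]: "g \<in> borel_measurable borel"
    and int: "\<And>R. integrable lborel (\<lambda>t. indicator {-R..R} t * g t)"
    and d: "\<And>x. (\<phi> has_real_derivative \<phi>' x) (at x)" and c: "continuous_on UNIV \<phi>'"
    and \<phi>: "\<And>x. R < \<bar>x\<bar> \<Longrightarrow> \<phi> x = 0" "\<And>x. R < \<bar>x\<bar> \<Longrightarrow> \<phi>' x = 0"
  shows "(\<integral>x. primitive g x * \<phi>' x \<partial>lborel) = - (\<integral>t. g t * \<phi> t \<partial>lborel)"
proof -
  have [measurable]: "\<phi>' \<in> borel_measurable borel" using c by (rule borel_measurable_continuous_onI)
  have "continuous_on UNIV \<phi>" using d by (auto intro!: continuous_at_imp_continuous_on DERIV_isCont)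
  then have [measurable]: "\<phi> \<in> borel_measurable borel" by (rule borel_measurable_continuous_onI)
  let ?I = "\<lambda>t. indicator {-R..R} t * \<bar>g t\<bar>"
  have intR: "integrable lborel ?I"
    using integrable_abs[OF int[of R]] by (simp add: abs_mult)
  have bound: "\<bar>\<phi>' x * (side x t * g t)\<bar> \<le> \<bar>\<phi>' x\<bar> * ?I t" for x t
  proof (cases "R < \<bar>x\<bar>")
    case False
    have "\<bar>side x t\<bar> \<le> indicator {-R..R} t"
      by (rule order_trans[OF abs_side_le]) (use False in \<open>auto simp: indicator_def\<close>)
    then show ?thesis by (simp add: abs_mult mult_left_mono mult_right_mono)
  qed (simp add: \<phi>)
  have i1: "integrable lborel (\<lambda>t. \<phi>' x * (side x t * g t))" for x
    by (intro integrable_mult_right integrable_side g int)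
  have "integrable (lborel \<Otimes>\<^sub>M lborel) (case_prod (\<lambda>x t. \<phi>' x * (side x t * g t)))"
  proof (rule lborel_pair.Fubini_integrable)
    show "case_prod (\<lambda>x t. \<phi>' x * (side x t * g t)) \<in> borel_measurable (lborel \<Otimes>\<^sub>M lborel)"
      by measurable
    show "AE x in lborel. integrable lborel (\<lambda>t. case (x, t) of (x, t) \<Rightarrow> \<phi>' x * (side x t * g t))"
      using i1 by simp
    have "integrable lborel (\<lambda>x. \<bar>\<phi>' x\<bar> * (\<integral>t. ?I t \<partial>lborel))"
      by (intro integrable_mult_left integrable_abs integrable_compact_support[OF c \<phi>(2)])
    then show "integrable lborel (\<lambda>x. \<integral>t. norm (case (x, t) of (x, t) \<Rightarrow> \<phi>' x * (side x t * g t)) \<partial>lborel)"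
    proof (rule Bochner_Integration.integrable_bound)
      show "AE x in lborel. norm (\<integral>t. norm (case (x, t) of (x, t) \<Rightarrow> \<phi>' x * (side x t * g t)) \<partial>lborel)
         \<le> norm (\<bar>\<phi>' x\<bar> * (\<integral>t. ?I t \<partial>lborel))"
      proof (rule AE_I2)
        fix x
        have "(\<integral>t. \<bar>\<phi>' x * (side x t * g t)\<bar> \<partial>lborel) \<le> (\<integral>t. \<bar>\<phi>' x\<bar> * ?I t \<partial>lborel)"
          by (intro integral_mono bound integrable_abs i1 integrable_mult_right intR)
        moreover have "0 \<le> (\<integral>t. \<bar>\<phi>' x * (side x t * g t)\<bar> \<partial>lborel)" by (intro integral_nonneg_AE) auto
        moreover have "(\<integral>t. \<bar>\<phi>' x\<bar> * ?I t \<partial>lborel) = \<bar>\<phi>' x\<bar> * (\<integral>t. ?I t \<partial>lborel)" by simp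
        ultimately show "norm (\<integral>t. norm (case (x, t) of (x, t) \<Rightarrow> \<phi>' x * (side x t * g t)) \<partial>lborel)
         \<le> norm (\<bar>\<phi>' x\<bar> * (\<integral>t. ?I t \<partial>lborel))" by simp
      qed
    qed measurable
  qed
  note F = lborel_pair.Fubini_integral[OF this]
  have inner: "(\<integral>x. \<phi>' x * (side x t * g t) \<partial>lborel) = - g t * \<phi> t" if "t \<noteq> 0" for t
  proof -
    have "(\<integral>x. side x t * \<phi>' x \<partial>lborel) = - \<phi> t"
    proof (cases "0 < t")
      case True
      then have "side x t = indicator {t<..} x" for x by (auto simp: side_def indicator_def)
      then show ?thesis using integral_deriv_compact_support(2)[OF d c \<phi>] by simp
    next
      case False
      then have "side x t = - indicator {..<t} x" for x using that by (auto simp: side_def indicator_def)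
      then show ?thesis using integral_deriv_compact_support(3)[OF d c \<phi>] by simp
    qed
    moreover have "(\<integral>x. \<phi>' x * (side x t * g t) \<partial>lborel) = (\<integral>x. g t * (side x t * \<phi>' x) \<partial>lborel)"
      by (rule Bochner_Integration.integral_cong) auto
    ultimately show ?thesis by simp
  qed
  have "(\<integral>x. primitive g x * \<phi>' x \<partial>lborel) = (\<integral>x. \<integral>t. \<phi>' x * (side x t * g t) \<partial>lborel \<partial>lborel)"
    by (simp add: primitive_def mult.commute)
  also have "\<dots> = (\<integral>t. \<integral>x. \<phi>' x * (side x t * g t) \<partial>lborel \<partial>lborel)" by (rule F [symmetric])
  also have "\<dots> = (\<integral>t. - g t * \<phi> t \<partial>lborel)"
  proof (rule integral_cong_AE)
    show "AE t in lborel. (\<integral>x. \<phi>' x * (side x t * g t) \<partial>lborel) = - g t * \<phi> t"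
      using AE_lborel_singleton[of 0] by eventually_elim (rule inner)
  qed measurable
  finally show ?thesis by simp
qed

text \<open>
A test function is the derivative of another one exactly if its integral is zero. Subtracting a
multiple of one fixed bump achieves this for every bump, and the multiple determines the constant.
\<close>

lemma constant_of_weak_derivative_zero:
  fixes h :: "real \<Rightarrow> real"
  assumes h [measurable]: "h \<in> borel_measurable borel"
    and int: "\<And>R. integrable lborel (\<lambda>x. indicator {-R..R} x * h x)"
    and zero: "\<And>\<phi>. test_function \<phi> \<Longrightarrow> (\<integral>x. h x * deriv \<phi> x \<partial>lborel) = 0"
  shows "\<exists>c. AE x in lborel. h x = c"
proof -
  have cont: "continuous_on UNIV (bump a b n)" for a b n
    by (rule test_function_continuous[OF bump_test])
  have [measurable]: "bump a b n \<in> borel_measurable borel" for a b n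
    by (rule borel_measurable_continuous_onI[OF cont])
  have out: "bump a b n x = 0" if "max \<bar>a\<bar> \<bar>b\<bar> < \<bar>x\<bar>" for a b n x
    using that by (intro bump_outside) auto
  have ib: "integrable lborel (bump a b n)" for a b n
    by (rule integrable_compact_support[OF cont out])
  have ih: "integrable lborel (\<lambda>x. h x * bump a b n x)" for a b n
  proof (rule Bochner_Integration.integrable_bound[OF int[of "max \<bar>a\<bar> \<bar>b\<bar>"]])
    show "AE x in lborel. norm (h x * bump a b n x) \<le> norm (indicator {- max \<bar>a\<bar> \<bar>b\<bar>..max \<bar>a\<bar> \<bar>b\<bar>} x * h x)"
    proof (rule AE_I2)
      fix x
      have "bump a b n x \<le> indicator {- max \<bar>a\<bar> \<bar>b\<bar>..max \<bar>a\<bar> \<bar>b\<bar>} x"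
        by (rule order_trans[OF bump_bounds(2)]) (auto simp: indicator_def)
      then show "norm (h x * bump a b n x) \<le> norm (indicator {- max \<bar>a\<bar> \<bar>b\<bar>..max \<bar>a\<bar> \<bar>b\<bar>} x * h x)"
        using bump_bounds(1)[of a b n x] by (simp add: abs_mult mult.commute mult_left_mono)
    qed
  qed measurable
  define \<psi> where "\<psi> = bump 0 1 0"
  define I where "I = (\<integral>x. \<psi> x \<partial>lborel)"
  have I: "0 < I"
  proof -
    have "\<not> (AE x in lborel. \<psi> x = 0)"
    proof
      assume "AE x in lborel. \<psi> x = 0"
      then have "AE x in lborel. x \<notin> {0<..<1::real}"
        by (rule eventually_mono) (auto simp: \<psi>_def bump_def flat_def split: if_splits)
      then have "emeasure lborel {0<..<1::real} = 0" by (subst emeasure_eq_AE[where B = "{}"]) auto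
      then show False by simp
    qed
    moreover have "0 \<le> I" unfolding I_def \<psi>_def by (intro integral_nonneg_AE) (simp add: bump_bounds)
    moreover have "I = 0 \<longleftrightarrow> (AE x in lborel. \<psi> x = 0)"
      unfolding I_def \<psi>_def by (intro integral_nonneg_eq_0_iff_AE ib) (simp add: bump_bounds)
    ultimately show ?thesis by linarith
  qed
  define c where "c = (\<integral>x. h x * \<psi> x \<partial>lborel) / I"
  have "AE x in lborel. h x - c = 0"
  proof (rule fundamental_lemma)
    show "integrable lborel (\<lambda>x. indicator {-R..R} x * (h x - c))" for R
    proof -
      have "integrable lborel (\<lambda>x. indicator {-R..R} x * h x - c * indicator {-R..R} x)"
        by (intro Bochner_Integration.integrable_diff int integrable_mult_right) (simp add: emeasure_lborel_Icc_eq)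
      then show ?thesis by (simp add: algebra_simps)
    qed
    fix a b n
    define J where "J = (\<integral>x. bump a b n x \<partial>lborel)"
    define \<eta> where "\<eta> x = bump a b n x + (- (J / I)) * \<psi> x" for x
    have \<eta>_flat: "flat_combination \<eta>"
      unfolding \<eta>_def [abs_def] \<psi>_def by (intro flat_combination.intros bump_flat)
    have \<eta>_cont: "continuous_on UNIV \<eta>"
      unfolding \<eta>_def [abs_def] \<psi>_def by (intro continuous_intros cont)
    define R where "R = max 1 (max \<bar>a\<bar> \<bar>b\<bar>)"
    have \<eta>_out: "\<eta> x = 0" if "R < \<bar>x\<bar>" for x
      unfolding \<eta>_def \<psi>_def using out[of a b x n] out[of 0 1 x 0] that by (simp add: R_def)
    have i\<psi>: "integrable lborel \<psi>" unfolding \<psi>_def by (rule ib)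
    have "(\<integral>x. \<eta> x \<partial>lborel) = J + (- (J / I)) * I"
      unfolding \<eta>_def using ib i\<psi> by (subst Bochner_Integration.integral_add) (auto simp: J_def I_def)
    then have \<eta>_int: "(\<integral>x. \<eta> x \<partial>lborel) = 0" using I by simp
    define \<phi> where "\<phi> x = primitive \<eta> x - primitive \<eta> (- R - 1)" for x
    have \<phi>_deriv: "(\<phi> has_real_derivative \<eta> x) (at x)" for x
      unfolding \<phi>_def [abs_def] using primitive_deriv[OF \<eta>_cont, of x] by (auto intro!: derivative_eq_intros)
    have \<phi>_d: "deriv \<phi> = \<eta>" using \<phi>_deriv by (auto intro!: ext DERIV_imp_deriv)
    have iso: "isCont \<eta> x" for x using \<eta>_cont by (simp add: continuous_on_eq_continuous_at)
    have \<phi>_out: "\<phi> x = 0" if "R < \<bar>x\<bar>" for x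
    proof (cases "0 < x")
      case True
      have "(\<integral>y. \<eta> y * indicator {- R - 1..x} y \<partial>lborel) = \<phi> x - \<phi> (- R - 1)"
        by (rule integral_FTC_Icc_real) (use True \<phi>_deriv iso in \<open>auto simp: R_def\<close>)
      moreover have "\<eta> y * indicator {- R - 1..x} y = \<eta> y" for y
      proof (cases "y \<in> {- R - 1..x}")
        case False
        then have "R < \<bar>y\<bar>" using that True by auto
        then show ?thesis by (simp add: \<eta>_out)
      qed simp
      ultimately show ?thesis using \<eta>_int by (simp add: \<phi>_def)
    next
      case False
      have "R > 0" by (simp add: R_def)
      obtain p q where pq: "p \<le> q" "q < - R" "p = x \<and> q = - R - 1 \<or> p = - R - 1 \<and> q = x"
      proof (cases "x \<le> - R - 1")
        case True
        then show ?thesis using that[of x "- R - 1"] \<open>R > 0\<close> by simp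
      next
        case False
        then show ?thesis using that[of "- R - 1" x] \<open>R < \<bar>x\<bar>\<close> \<open>\<not> 0 < x\<close> by simp
      qed
      have "(\<integral>y. \<eta> y * indicator {p..q} y \<partial>lborel) = \<phi> q - \<phi> p"
        by (rule integral_FTC_Icc_real) (use pq(1) \<phi>_deriv iso in auto)
      moreover have "\<eta> y * indicator {p..q} y = 0" for y
      proof (cases "y \<in> {p..q}")
        case True
        then have "R < \<bar>y\<bar>"
          using pq(2) abs_ge_minus_self[of y] unfolding atLeastAtMost_iff by linarith
        then show ?thesis by (simp add: \<eta>_out)
      qed simp
      ultimately have "\<phi> q = \<phi> p" by simp
      moreover have "\<phi> (- R - 1) = 0" by (simp add: \<phi>_def)
      ultimately show ?thesis using pq(3) by auto
    qed
    have "test_function \<phi>"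
    proof (rule test_functionI[OF _ \<phi>_out])
      show "((deriv ^^ m) \<phi>) field_differentiable at x" for m x
      proof (cases m)
        case 0
        then show ?thesis using \<phi>_deriv by (auto simp: field_differentiable_def)
      next
        case (Suc k)
        then show ?thesis using flat_combination_smooth(2)[OF \<eta>_flat, of k] by (simp add: funpow_swap1 \<phi>_d)
      qed
    qed
    from zero[OF this] have "(\<integral>x. h x * \<eta> x \<partial>lborel) = 0" by (simp add: \<phi>_d)
    moreover have "h x * \<eta> x = h x * bump a b n x - (J / I) * (h x * \<psi> x)" for x
      by (simp add: \<eta>_def algebra_simps)
    moreover have "(\<integral>x. h x * bump a b n x - (J / I) * (h x * \<psi> x) \<partial>lborel)
        = (\<integral>x. h x * bump a b n x \<partial>lborel) - (J / I) * (\<integral>x. h x * \<psi> x \<partial>lborel)"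
      using ih unfolding \<psi>_def by (subst Bochner_Integration.integral_diff) auto
    ultimately have "(\<integral>x. h x * bump a b n x \<partial>lborel) = c * J" by (simp add: c_def)
    moreover have "(\<integral>x. (h x - c) * bump a b n x \<partial>lborel) = (\<integral>x. h x * bump a b n x \<partial>lborel) - c * J"
      unfolding J_def left_diff_distrib using ih ib by (subst Bochner_Integration.integral_diff) auto
    ultimately show "(\<integral>x. (h x - c) * bump a b n x \<partial>lborel) = 0" by simp
  qed measurable
  then have "AE x in lborel. h x = c" by eventually_elim simp
  then show ?thesis by blast
qed

lemma L2_cong_AE:
  assumes "f \<in> L2" "eq_ae f g"
  shows "g \<in> L2"
proof -
  have g: "g \<in> borel_measurable lebesgue"
    using assms borel_measurable_AE[of f g] by (simp add: L2_def)
  have sq: "AE y in lebesgue. (f y)\<^sup>2 = (g y)\<^sup>2" using assms(2) by eventually_elim simp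
  have "integrable lebesgue (\<lambda>y. (g y)\<^sup>2)"
    using assms(1) sq integrable_cong_AE_imp[of lebesgue "\<lambda>y. (f y)\<^sup>2" "\<lambda>y. (g y)\<^sup>2"] g
    by (auto simp: L2_def intro!: borel_measurable_power)
  with g show ?thesis by (simp add: L2_def)
qed

lemma L2_of_bound:
  assumes [measurable]: "g \<in> borel_measurable lebesgue" "f1 \<in> borel_measurable lebesgue"
    and "integrable lebesgue (\<lambda>y. (f1 y)\<^sup>2)" and "\<And>y. \<bar>g y\<bar> \<le> C * \<bar>f1 y\<bar>"
  shows "g \<in> L2"
proof -
  have "integrable lebesgue (\<lambda>y. (g y)\<^sup>2)"
  proof (rule Bochner_Integration.integrable_bound)
    show "integrable lebesgue (\<lambda>y. C\<^sup>2 * (f1 y)\<^sup>2)" using assms(3) by simp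
    show "AE y in lebesgue. norm ((g y)\<^sup>2) \<le> norm (C\<^sup>2 * (f1 y)\<^sup>2)"
    proof (rule AE_I2)
      fix y
      have "\<bar>g y\<bar>\<^sup>2 \<le> (C * \<bar>f1 y\<bar>)\<^sup>2" by (intro power_mono assms(4)) auto
      then show "norm ((g y)\<^sup>2) \<le> norm (C\<^sup>2 * (f1 y)\<^sup>2)" by (simp add: power_mult_distrib)
    qed
  qed (intro borel_measurable_power assms(1))
  then show ?thesis using assms(1) by (simp add: L2_def)
qed

lemma L2_add:
  assumes "f \<in> L2" "g \<in> L2"
  shows "(\<lambda>y. f y + g y) \<in> L2"
proof -
  have m: "f \<in> borel_measurable lebesgue" "g \<in> borel_measurable lebesgue"
    and i: "integrable lebesgue (\<lambda>y. (f y)\<^sup>2)" "integrable lebesgue (\<lambda>y. (g y)\<^sup>2)"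
    using assms by (auto simp: L2_def)
  have "integrable lebesgue (\<lambda>y. (f y + g y)\<^sup>2)"
  proof (rule Bochner_Integration.integrable_bound)
    show "integrable lebesgue (\<lambda>y. 2 * (f y)\<^sup>2 + 2 * (g y)\<^sup>2)" using i by simp
    show "AE y in lebesgue. norm ((f y + g y)\<^sup>2) \<le> norm (2 * (f y)\<^sup>2 + 2 * (g y)\<^sup>2)"
    proof (rule AE_I2)
      fix y
      have "(f y + g y)\<^sup>2 \<le> 2 * (f y)\<^sup>2 + 2 * (g y)\<^sup>2"
        using zero_le_power2[of "f y - g y"] by (simp add: power2_eq_square algebra_simps)
      then show "norm ((f y + g y)\<^sup>2) \<le> norm (2 * (f y)\<^sup>2 + 2 * (g y)\<^sup>2)" by simp
    qed
  qed (intro borel_measurable_power borel_measurable_add m)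
  then show ?thesis using m by (simp add: L2_def)
qed

lemma L2_bounded_mult:
  assumes f: "f \<in> L2" and w: "continuous_on UNIV w" "\<And>y. \<bar>w y\<bar> \<le> C"
  shows "(\<lambda>y. w y * f y) \<in> L2"
proof (rule L2_of_bound)
  have "w \<in> borel_measurable lborel" using borel_measurable_continuous_onI[OF w(1)] by simp
  then have "w \<in> borel_measurable lebesgue" by (rule measurable_completion)
  then show "(\<lambda>y. w y * f y) \<in> borel_measurable lebesgue"
    using f by (intro borel_measurable_times) (auto simp: L2_def)
  show "\<bar>w y * f y\<bar> \<le> C * \<bar>f y\<bar>" for y using w(2) by (simp add: abs_mult mult_right_mono)
qed (use f in \<open>auto simp: L2_def\<close>)

lemma L2_cmult: "f \<in> L2 \<Longrightarrow> (\<lambda>y. c * f y) \<in> L2"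
  by (rule L2_bounded_mult[of _ "\<lambda>_. c" "\<bar>c\<bar>"]) auto

lemma L2_minus: "f \<in> L2 \<Longrightarrow> (\<lambda>y. - f y) \<in> L2"
  using L2_cmult[of f "-1"] by simp

lemma L2_diff: "f \<in> L2 \<Longrightarrow> g \<in> L2 \<Longrightarrow> (\<lambda>y. f y - g y) \<in> L2"
  using L2_add[OF _ L2_minus, of f g] by simp

lemma L2_borel_representative:
  assumes "f \<in> L2"
  obtains fb where "fb \<in> borel_measurable borel" "AE y in lborel. f y = fb y"
    "integrable lborel (\<lambda>y. (fb y)\<^sup>2)"
proof -
  obtain fb where fb: "fb \<in> borel_measurable lborel" "AE y in lborel. f y = fb y"
    using assms completion_ex_borel_measurable_real[of f lborel] by (auto simp: L2_def)
  then have ae: "eq_ae f fb" by (intro AE_completion)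
  then have "integrable lebesgue (\<lambda>y. (fb y)\<^sup>2)" using L2_cong_AE[OF assms] by (simp add: L2_def)
  then have "integrable lborel (\<lambda>y. (fb y)\<^sup>2)"
    using fb(1) by (subst (asm) integrable_completion) auto
  then show ?thesis using that fb by simp
qed

lemma locally_integrable_of_square:
  fixes f :: "real \<Rightarrow> real"
  assumes [measurable]: "f \<in> borel_measurable borel" and i: "integrable lborel (\<lambda>y. (f y)\<^sup>2)"
  shows "integrable lborel (\<lambda>y. indicator {-R..R} y * f y)"
proof (rule Bochner_Integration.integrable_bound)
  show "integrable lborel (\<lambda>y. (f y)\<^sup>2 + indicator {-R..R} y)"
    by (intro Bochner_Integration.integrable_add i) (simp add: emeasure_lborel_Icc_eq)
  show "AE y in lborel. norm (indicator {-R..R} y * f y) \<le> norm ((f y)\<^sup>2 + indicator {-R..R} y)"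
  proof (rule AE_I2)
    fix y
    have "\<bar>f y\<bar> \<le> (f y)\<^sup>2 + 1"
      using zero_le_power2[of "\<bar>f y\<bar> - 1"] by (simp add: power2_diff)
    then show "norm (indicator {-R..R} y * f y) \<le> norm ((f y)\<^sup>2 + indicator {-R..R} y)"
      by (auto simp: indicator_def)
  qed
qed measurable

lemma integrable_mult_compact_support:
  fixes h \<phi> :: "real \<Rightarrow> real"
  assumes [measurable]: "h \<in> borel_measurable borel"
    and int: "\<And>R. integrable lborel (\<lambda>x. indicator {-R..R} x * h x)"
    and c: "continuous_on UNIV \<phi>" and out: "\<And>x. R < \<bar>x\<bar> \<Longrightarrow> \<phi> x = 0"
  shows "integrable lborel (\<lambda>x. h x * \<phi> x)"
proof -
  have [measurable]: "\<phi> \<in> borel_measurable borel" using c by (rule borel_measurable_continuous_onI)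
  have "compact (\<phi> ` {-R..R})"
    by (intro compact_continuous_image continuous_on_subset[OF c]) auto
  from compact_imp_bounded[OF this] obtain C where C: "\<forall>z\<in>\<phi> ` {-R..R}. norm z \<le> C"
    unfolding bounded_iff by auto
  show ?thesis
  proof (rule Bochner_Integration.integrable_bound)
    show "integrable lborel (\<lambda>x. C * (indicator {-R..R} x * h x))" by (intro integrable_mult_right int)
    show "AE x in lborel. norm (h x * \<phi> x) \<le> norm (C * (indicator {-R..R} x * h x))"
    proof (rule AE_I2)
      fix x
      show "norm (h x * \<phi> x) \<le> norm (C * (indicator {-R..R} x * h x))"
      proof (cases "x \<in> {-R..R}")
        case True
        then have "norm (\<phi> x) \<le> C" using C by blast
        then have "\<bar>\<phi> x\<bar> \<le> \<bar>C\<bar>" by simp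
        then show ?thesis using True by (simp add: abs_mult mult.commute mult_right_mono)
      next
        case False
        then have "R < \<bar>x\<bar>" by auto
        then show ?thesis by (simp add: out)
      qed
    qed
  qed measurable
qed

lemma dist_of_borel:
  assumes "f \<in> borel_measurable lebesgue" "fb \<in> borel_measurable borel" "AE y in lborel. f y = fb y"
    and "continuous_on UNIV \<phi>"
  shows "dist_of f \<phi> = (\<integral>y. fb y * \<phi> y \<partial>lborel)"
proof -
  have \<phi>: "\<phi> \<in> borel_measurable lborel" using borel_measurable_continuous_onI[OF assms(4)] by simp
  then have \<phi>': "\<phi> \<in> borel_measurable lebesgue" by (rule measurable_completion)
  have fb: "fb \<in> borel_measurable lborel" using assms(2) by simp
  then have fb': "fb \<in> borel_measurable lebesgue" by (rule measurable_completion)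
  have "eq_ae f fb" using assms(3) by (rule AE_completion)
  then have "AE y in lebesgue. f y * \<phi> y = fb y * \<phi> y" by eventually_elim simp
  then have "dist_of f \<phi> = (\<integral>y. fb y * \<phi> y \<partial>lebesgue)"
    unfolding dist_of_def by (intro integral_cong_AE borel_measurable_times assms(1) fb' \<phi>') 
  also have "\<dots> = (\<integral>y. fb y * \<phi> y \<partial>lborel)"
    by (rule integral_completion) (intro borel_measurable_times fb \<phi>)
  finally show ?thesis .
qed

lemma L2_test_integrable:
  assumes "f \<in> L2" "test_function \<phi>"
  shows "integrable lebesgue (\<lambda>y. f y * \<phi> y)"
proof -
  obtain R where R: "0 < R" "\<And>x. R < \<bar>x\<bar> \<Longrightarrow> \<phi> x = 0" using test_function_support[OF assms(2)] by blast
  have c: "continuous_on UNIV \<phi>" by (rule test_function_continuous[OF assms(2)])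
  have "integrable lborel (\<lambda>y. (\<phi> y)\<^sup>2)"
    by (rule integrable_compact_support[of _ R]) (use R c in \<open>auto intro!: continuous_intros\<close>)
  then have i\<phi>: "integrable lebesgue (\<lambda>y. (\<phi> y)\<^sup>2)"
    using borel_measurable_continuous_onI[OF c] by (subst integrable_completion) auto
  have \<phi>': "\<phi> \<in> borel_measurable lebesgue"
    using borel_measurable_continuous_onI[OF c] by (intro measurable_completion) simp
  show ?thesis
  proof (rule Bochner_Integration.integrable_bound)
    show "integrable lebesgue (\<lambda>y. (f y)\<^sup>2 + (\<phi> y)\<^sup>2)" using i\<phi> assms(1) by (simp add: L2_def)
    show "(\<lambda>y. f y * \<phi> y) \<in> borel_measurable lebesgue"
      using \<phi>' assms(1) by (intro borel_measurable_times) (auto simp: L2_def)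
    show "AE y in lebesgue. norm (f y * \<phi> y) \<le> norm ((f y)\<^sup>2 + (\<phi> y)\<^sup>2)"
    proof (rule AE_I2)
      fix y
      have "2 * (\<bar>f y\<bar> * \<bar>\<phi> y\<bar>) \<le> (f y)\<^sup>2 + (\<phi> y)\<^sup>2"
        using zero_le_power2[of "\<bar>f y\<bar> - \<bar>\<phi> y\<bar>"] by (simp add: power2_diff)
      moreover have "0 \<le> \<bar>f y\<bar> * \<bar>\<phi> y\<bar>" by simp
      moreover have "norm (f y * \<phi> y) = \<bar>f y\<bar> * \<bar>\<phi> y\<bar>" by (simp add: abs_mult)
      moreover have "norm ((f y)\<^sup>2 + (\<phi> y)\<^sup>2) = (f y)\<^sup>2 + (\<phi> y)\<^sup>2" by simp
      ultimately show "norm (f y * \<phi> y) \<le> norm ((f y)\<^sup>2 + (\<phi> y)\<^sup>2)" by linarith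
    qed
  qed
qed

lemma dist_of_add: "f \<in> L2 \<Longrightarrow> g \<in> L2 \<Longrightarrow> test_function \<phi> \<Longrightarrow>
    dist_of (\<lambda>y. f y + g y) \<phi> = dist_of f \<phi> + dist_of g \<phi>"
  unfolding dist_of_def by (simp add: distrib_right L2_test_integrable)

lemma dist_of_diff: "f \<in> L2 \<Longrightarrow> g \<in> L2 \<Longrightarrow> test_function \<phi> \<Longrightarrow>
    dist_of (\<lambda>y. f y - g y) \<phi> = dist_of f \<phi> - dist_of g \<phi>"
  unfolding dist_of_def by (simp add: left_diff_distrib L2_test_integrable)

lemma dist_of_cmult: "dist_of (\<lambda>y. c * f y) \<phi> = c * dist_of f \<phi>"
  unfolding dist_of_def by (simp add: mult.assoc)

abbreviation weak_deriv :: "(real \<Rightarrow> real) \<Rightarrow> (real \<Rightarrow> real) \<Rightarrow> bool"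
  where "weak_deriv f g \<equiv> dist_eq (dist_deriv (dist_of f)) (dist_of g)"

lemma weak_derivD: "weak_deriv f g \<Longrightarrow> test_function \<phi> \<Longrightarrow> dist_of f (deriv \<phi>) = - dist_of g \<phi>"
  by (auto simp: dist_eq_def dist_deriv_def)

text \<open>
The last conclusion serves for bootstrapping: as soon as the weak derivative is known to have a
continuous representative, the function is continuously differentiable.
\<close>

lemma weak_derivative_representative:
  assumes f: "f \<in> L2" and g: "g \<in> L2" and w: "weak_deriv f g"
  obtains F where "continuous_on UNIV F" "eq_ae f F"
    "\<And>G x. continuous_on UNIV G \<Longrightarrow> eq_ae g G \<Longrightarrow> (F has_real_derivative G x) (at x)"
proof -
  obtain fb where fb [measurable]: "fb \<in> borel_measurable borel" and f_ae: "AE y in lborel. f y = fb y"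
    and fb2: "integrable lborel (\<lambda>y. (fb y)\<^sup>2)" using L2_borel_representative[OF f] by metis
  obtain gb where gb [measurable]: "gb \<in> borel_measurable borel" and g_ae: "AE y in lborel. g y = gb y"
    and gb2: "integrable lborel (\<lambda>y. (gb y)\<^sup>2)" using L2_borel_representative[OF g] by metis
  note fi = locally_integrable_of_square[OF fb fb2] and gi = locally_integrable_of_square[OF gb gb2]
  have P: "continuous_on UNIV (primitive gb)" by (rule primitive_continuous[OF gb gi])
  have [measurable]: "primitive gb \<in> borel_measurable borel" by (rule borel_measurable_continuous_onI[OF P])
  have Pi: "integrable lborel (\<lambda>x. indicator {-R..R} x * primitive gb x)" for R
    using borel_integrable_atLeastAtMost'[OF continuous_on_subset[OF P], of "-R" R]
    by (simp add: set_integrable_def)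
  have "\<exists>c. AE x in lborel. fb x - primitive gb x = c"
  proof (rule constant_of_weak_derivative_zero)
    show "integrable lborel (\<lambda>x. indicator {-R..R} x * (fb x - primitive gb x))" for R
      unfolding right_diff_distrib by (intro Bochner_Integration.integrable_diff fi Pi)
    fix \<phi> assume \<phi>: "test_function \<phi>"
    obtain R where R: "\<And>x. R < \<bar>x\<bar> \<Longrightarrow> \<phi> x = 0" using test_function_support[OF \<phi>] by blast
    obtain R' where R': "\<And>x. R' < \<bar>x\<bar> \<Longrightarrow> deriv \<phi> x = 0"
      using test_function_support[OF test_function_deriv(2)[OF \<phi>]] by blast
    have c: "continuous_on UNIV \<phi>" "continuous_on UNIV (deriv \<phi>)"
      using test_function_continuous test_function_deriv(2) \<phi> by blast+
    have "(\<integral>x. primitive gb x * deriv \<phi> x \<partial>lborel) = - (\<integral>t. gb t * \<phi> t \<partial>lborel)"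
      by (rule primitive_by_parts[OF gb gi test_function_deriv(1)[OF \<phi>] c(2), of "max R R'"])
         (use R R' in auto)
    also have "\<dots> = - dist_of g \<phi>"
      using dist_of_borel[OF _ gb g_ae c(1)] g by (simp add: L2_def)
    also have "\<dots> = dist_of f (deriv \<phi>)" using weak_derivD[OF w \<phi>] by simp
    also have "\<dots> = (\<integral>x. fb x * deriv \<phi> x \<partial>lborel)"
      using dist_of_borel[OF _ fb f_ae c(2)] f by (simp add: L2_def)
    finally have "(\<integral>x. fb x * deriv \<phi> x \<partial>lborel) - (\<integral>x. primitive gb x * deriv \<phi> x \<partial>lborel) = 0" by simp
    moreover have "integrable lborel (\<lambda>x. fb x * deriv \<phi> x)" "integrable lborel (\<lambda>x. primitive gb x * deriv \<phi> x)"
      by (rule integrable_mult_compact_support[OF fb fi c(2) R'], assumption)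
         (rule integrable_mult_compact_support[OF _ Pi c(2) R'], measurable)
    ultimately show "(\<integral>x. (fb x - primitive gb x) * deriv \<phi> x \<partial>lborel) = 0"
      by (simp add: left_diff_distrib)
  qed measurable
  then obtain c where c: "AE x in lborel. fb x - primitive gb x = c" by blast
  show ?thesis
  proof (rule that[of "\<lambda>x. primitive gb x + c"])
    show "continuous_on UNIV (\<lambda>x. primitive gb x + c)" by (intro continuous_intros P)
    have "AE x in lborel. f x = primitive gb x + c" using f_ae c by eventually_elim simp
    then show "eq_ae f (\<lambda>x. primitive gb x + c)" by (rule AE_completion)
    fix G x assume G: "continuous_on UNIV G" "eq_ae g G"
    have [measurable]: "G \<in> borel_measurable borel" by (rule borel_measurable_continuous_onI[OF G(1)])
    have "AE x in lborel. g x = G x" using G(2) by (simp add: AE_completion_iff)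
    with g_ae have ae: "AE x in lborel. gb x = G x" by eventually_elim simp
    have "primitive gb = primitive G"
    proof
      fix x
      show "primitive gb x = primitive G x" unfolding primitive_def
      proof (rule integral_cong_AE)
        show "AE t in lborel. side x t * gb t = side x t * G t" using ae by eventually_elim simp
      qed measurable
    qed
    then show "((\<lambda>x. primitive gb x + c) has_real_derivative G x) (at x)"
      using primitive_deriv[OF G(1), of x] by (auto intro!: derivative_eq_intros)
  qed
qed

lemma weak_deriv_of_deriv:
  assumes d: "\<And>x. (f has_real_derivative f' x) (at x)" and c: "continuous_on UNIV f'"
  shows "weak_deriv f f'"
  unfolding dist_eq_def dist_deriv_def
proof (intro allI impI)
  fix \<phi> assume \<phi>: "test_function \<phi>"
  have cf: "continuous_on UNIV f" using d by (auto intro!: continuous_at_imp_continuous_on DERIV_isCont)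
  obtain R where R: "\<And>x. R < \<bar>x\<bar> \<Longrightarrow> \<phi> x = 0" using test_function_support[OF \<phi>] by blast
  obtain R' where R': "\<And>x. R' < \<bar>x\<bar> \<Longrightarrow> deriv \<phi> x = 0"
    using test_function_support[OF test_function_deriv(2)[OF \<phi>]] by blast
  have c\<phi>: "continuous_on UNIV \<phi>" "continuous_on UNIV (deriv \<phi>)"
    using test_function_continuous test_function_deriv(2) \<phi> by blast+
  have mb: "h \<in> borel_measurable lebesgue" if "continuous_on UNIV h" for h :: "real \<Rightarrow> real"
    using borel_measurable_continuous_onI[OF that] by (intro measurable_completion) simp
  have "(\<integral>x. f' x * \<phi> x + deriv \<phi> x * f x \<partial>lborel) = 0"
  proof (rule integral_deriv_compact_support(1)[where \<phi> = "\<lambda>x. f x * \<phi> x" and R = "max R R'"])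
    show "((\<lambda>x. f x * \<phi> x) has_real_derivative f' x * \<phi> x + deriv \<phi> x * f x) (at x)" for x
      by (rule DERIV_mult[OF d test_function_deriv(1)[OF \<phi>]])
  qed (use R R' c cf c\<phi> in \<open>auto intro!: continuous_intros\<close>)
  moreover have "integrable lborel (\<lambda>x. f' x * \<phi> x)" "integrable lborel (\<lambda>x. deriv \<phi> x * f x)"
    by (rule integrable_compact_support[of _ "max R R'"]; use R R' c cf c\<phi> in \<open>auto intro!: continuous_intros\<close>)+
  ultimately have "(\<integral>x. f' x * \<phi> x \<partial>lborel) + (\<integral>x. f x * deriv \<phi> x \<partial>lborel) = 0"
    by (simp add: mult.commute)
  moreover have "dist_of f (deriv \<phi>) = (\<integral>x. f x * deriv \<phi> x \<partial>lborel)" "dist_of f' \<phi> = (\<integral>x. f' x * \<phi> x \<partial>lborel)"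
    by (rule dist_of_borel[OF mb[OF cf] borel_measurable_continuous_onI[OF cf] _ c\<phi>(2)], simp)
       (rule dist_of_borel[OF mb[OF c] borel_measurable_continuous_onI[OF c] _ c\<phi>(1)], simp)
  ultimately show "- dist_of f (deriv \<phi>) = dist_of f' \<phi>" by simp
qed

text \<open>
On an interval of length one, \<open>f\<^sup>2\<close> is bounded by its mean plus the integral of
\<open>|2 f f'|\<close>, hence by the tail of an integrable function.
\<close>

lemma vanishes_at_infinity:
  assumes f: "f \<in> L2" and f': "f' \<in> L2" and d: "\<And>x. (f has_real_derivative f' x) (at x)"
    and c: "continuous_on UNIV f'"
  shows "(f \<longlongrightarrow> 0) at_infinity"
proof -
  have cf: "continuous_on UNIV f" using d by (auto intro!: continuous_at_imp_continuous_on DERIV_isCont)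
  have [measurable]: "f \<in> borel_measurable borel" "f' \<in> borel_measurable borel"
    using borel_measurable_continuous_onI c cf by auto
  have "integrable lborel (\<lambda>y. (f y)\<^sup>2)" "integrable lborel (\<lambda>y. (f' y)\<^sup>2)"
    using f f' by (auto simp: L2_def integrable_completion)
  define e where "e y = 2 * (f y)\<^sup>2 + (f' y)\<^sup>2" for y
  have e: "integrable lborel e" unfolding e_def [abs_def]
    using \<open>integrable lborel (\<lambda>y. (f y)\<^sup>2)\<close> \<open>integrable lborel (\<lambda>y. (f' y)\<^sup>2)\<close> by simp
  have e0: "0 \<le> e y" for y by (simp add: e_def)
  define tail where "tail R = (\<integral>y. indicator {y. R \<le> \<bar>y\<bar>} y * e y \<partial>lborel)" for R
  have ti: "integrable lborel (\<lambda>y. indicator {y. R \<le> \<bar>y\<bar>} y * e y)" for R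
    by (rule Bochner_Integration.integrable_bound[OF e]) (auto simp: indicator_def e_def)
  have tail: "(tail \<longlongrightarrow> 0) at_top"
  proof -
    have "(tail \<longlongrightarrow> (\<integral>y. 0 \<partial>(lborel :: real measure))) at_top"
      unfolding tail_def [abs_def]
    proof (rule integral_dominated_convergence_at_top[OF _ _ e])
      show "AE y in lborel. ((\<lambda>R. indicator {y. R \<le> \<bar>y\<bar>} y * e y) \<longlongrightarrow> 0) at_top"
      proof (rule AE_I2)
        fix y
        show "((\<lambda>R. indicator {y. R \<le> \<bar>y\<bar>} y * e y) \<longlongrightarrow> 0) at_top"
          by (rule tendsto_eventually, rule eventually_mono[OF eventually_gt_at_top[of "\<bar>y\<bar>"]]) simp
      qed
      show "\<forall>\<^sub>F R in at_top. AE y in lborel. norm (indicator {y. R \<le> \<bar>y\<bar>} y * e y) \<le> e y"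
        using e0 by (auto simp: indicator_def)
    qed (auto simp: e_def)
    then show ?thesis by simp
  qed
  have key: "(f y)\<^sup>2 \<le> (\<integral>t. e t * indicator {p..p+1} t \<partial>lborel)" if "p \<le> y" "y \<le> p + 1" for p y
  proof -
    have ic: "isCont e x" for x
      using c cf unfolding e_def [abs_def] by (auto simp: continuous_on_eq_continuous_at intro!: continuous_intros)
    have i1: "integrable lborel (\<lambda>t. e t * indicator {p..q} t)" for p q
      by (rule Bochner_Integration.integrable_bound[OF e]) (auto simp: indicator_def e_def)
    have fe: "\<bar>2 * f t * f' t\<bar> \<le> (f t)\<^sup>2 + (f' t)\<^sup>2" for t
      using zero_le_power2[of "f t - f' t"] zero_le_power2[of "f t + f' t"]
      by (simp add: power2_diff power2_sum abs_le_iff)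
    define E where "E = (\<integral>t. ((f t)\<^sup>2 + (f' t)\<^sup>2) * indicator {p..p+1} t \<partial>lborel)"
    have iE: "integrable lborel (\<lambda>t. ((f t)\<^sup>2 + (f' t)\<^sup>2) * indicator {p..p+1} t)"
      by (rule Bochner_Integration.integrable_bound[OF e]) (auto simp: indicator_def e_def)
    have isc: "isCont f x" "isCont f' x" for x using c cf by (auto simp: continuous_on_eq_continuous_at)
    have diff: "(f y)\<^sup>2 \<le> (f x)\<^sup>2 + E" if xy: "x \<in> {p..p+1}" "y \<in> {p..p+1}" for x y
    proof -
      have *: "\<bar>(f v)\<^sup>2 - (f u)\<^sup>2\<bar> \<le> E" if "u \<le> v" "u \<in> {p..p+1}" "v \<in> {p..p+1}" for u v
      proof -
        have hb: "has_bochner_integral lborel (\<lambda>t. 2 * f t * f' t * indicator {u..v} t) ((f v)\<^sup>2 - (f u)\<^sup>2)"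
          by (rule has_bochner_integral_FTC_Icc_real) (use that d isc in \<open>auto intro!: derivative_eq_intros continuous_intros\<close>)
        have "\<bar>(f v)\<^sup>2 - (f u)\<^sup>2\<bar> = \<bar>\<integral>t. 2 * f t * f' t * indicator {u..v} t \<partial>lborel\<bar>"
          using hb by (simp add: has_bochner_integral_integral_eq)
        also have "\<dots> \<le> (\<integral>t. \<bar>2 * f t * f' t * indicator {u..v} t\<bar> \<partial>lborel)"
          by (rule integral_abs_bound)
        also have "\<dots> \<le> E" unfolding E_def
        proof (intro integral_mono iE integrable_abs)
          show "integrable lborel (\<lambda>t. 2 * f t * f' t * indicator {u..v} t)"
            using hb by (simp add: has_bochner_integral_iff)
          show "\<bar>2 * f t * f' t * indicator {u..v} t\<bar> \<le> ((f t)\<^sup>2 + (f' t)\<^sup>2) * indicator {p..p+1} t" for t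
            using fe[of t] that by (auto simp: indicator_def)
        qed
        finally show ?thesis .
      qed
      show ?thesis using *[of x y] *[of y x] xy by (cases "x \<le> y") (auto simp: abs_le_iff)
    qed
    have ifs: "integrable lborel (\<lambda>t. (f t)\<^sup>2 * indicator {p..p+1} t)"
      by (rule Bochner_Integration.integrable_bound[OF e]) (auto simp: indicator_def e_def)
    have "(\<integral>t. (f y)\<^sup>2 * indicator {p..p+1} t \<partial>lborel) \<le> (\<integral>t. (f t)\<^sup>2 * indicator {p..p+1} t + E * indicator {p..p+1} t \<partial>lborel)"
    proof (rule integral_mono)
      show "(f y)\<^sup>2 * indicator {p..p+1} t \<le> (f t)\<^sup>2 * indicator {p..p+1} t + E * indicator {p..p+1} t" for t
        using diff[of t y] that by (auto simp: indicator_def)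
    qed (use ifs in \<open>auto intro!: Bochner_Integration.integrable_add integrable_mult_right simp: emeasure_lborel_Icc_eq\<close>)
    then have "(f y)\<^sup>2 \<le> (\<integral>t. (f t)\<^sup>2 * indicator {p..p+1} t \<partial>lborel) + E"
      using ifs by (simp add: measure_lborel_Icc)
    also have "\<dots> = (\<integral>t. (f t)\<^sup>2 * indicator {p..p+1} t + ((f t)\<^sup>2 + (f' t)\<^sup>2) * indicator {p..p+1} t \<partial>lborel)"
      unfolding E_def using ifs iE by simp
    also have "\<dots> = (\<integral>t. e t * indicator {p..p+1} t \<partial>lborel)"
      by (rule Bochner_Integration.integral_cong) (auto simp: e_def algebra_simps)
    finally show ?thesis .
  qed
  have bound: "(f y)\<^sup>2 \<le> tail \<bar>y\<bar>" for y
  proof -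
    define p where "p = (if 0 \<le> y then y else y - 1)"
    have "(f y)\<^sup>2 \<le> (\<integral>t. e t * indicator {p..p+1} t \<partial>lborel)" by (rule key) (auto simp: p_def)
    also have "\<dots> \<le> tail \<bar>y\<bar>" unfolding tail_def
    proof (rule integral_mono[OF _ ti])
      show "integrable lborel (\<lambda>t. e t * indicator {p..p + 1} t)"
        by (rule Bochner_Integration.integrable_bound[OF e]) (auto simp: indicator_def e_def)
      show "e t * indicator {p..p + 1} t \<le> indicator {t. \<bar>y\<bar> \<le> \<bar>t\<bar>} t * e t" for t
        using e0[of t] by (auto simp: indicator_def p_def split: if_splits)
    qed
    finally show ?thesis .
  qed
  have "((\<lambda>y. tail (norm y)) \<longlongrightarrow> 0) (at_infinity :: real filter)"
    by (rule filterlim_compose[OF tail filterlim_norm_at_top])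
  then have "((\<lambda>y. (f y)\<^sup>2) \<longlongrightarrow> 0) at_infinity"
    by (rule Lim_null_comparison[rotated]) (use bound in simp)
  from tendsto_real_sqrt[OF this] have "((\<lambda>y. \<bar>f y\<bar>) \<longlongrightarrow> 0) at_infinity" by simp
  then show ?thesis by (simp add: tendsto_rabs_zero_iff)
qed

section \<open>Kernels of the linearised operators\<close>

lemma Q_continuous: "continuous_on UNIV Q"
  using Q_has_derivative by (auto intro!: continuous_at_imp_continuous_on DERIV_isCont)

lemma Q_squared_le: "\<bar>(Q y)\<^sup>2\<bar> \<le> 2"
proof -
  have "(Q y)\<^sup>2 \<le> 2" unfolding Q_squared by simp
  then show ?thesis by simp
qed

text \<open>
The Wronskian with \<open>Q\<close> is constant and vanishes at infinity, so \<open>k / Q\<close> is constant.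
\<close>

lemma kernel_L_minus:
  fixes k k' :: "real \<Rightarrow> real"
  assumes k: "\<And>y. (k has_real_derivative k' y) (at y)"
    and k': "\<And>y. (k' has_real_derivative k y - (Q y)\<^sup>2 * k y) (at y)"
    and lim: "(k \<longlongrightarrow> 0) at_infinity" "(k' \<longlongrightarrow> 0) at_infinity"
  shows "\<exists>b. \<forall>y. k y = b * Q y"
proof -
  define w where "w y = tanh y * (Q y * k y) + Q y * k' y" for y
  have "(w has_real_derivative 0) (at y)" for y
    unfolding w_def [abs_def]
    by (rule derivative_eq_intros k k' Q_has_derivative tanh_has_derivative refl | simp)+
       (use Q_squared[of y] in algebra)
  then have w_const: "w y = w 0" for y using DERIV_isconst_all by blast
  have "(w \<longlongrightarrow> 0) at_infinity"
  proof (rule Lim_null_comparison)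
    have "((\<lambda>y. 3/2 * \<bar>k y\<bar> + 3/2 * \<bar>k' y\<bar>) \<longlongrightarrow> 3/2 * \<bar>0\<bar> + 3/2 * \<bar>0\<bar>) at_infinity"
      by (intro tendsto_intros lim)
    then show "((\<lambda>y. 3/2 * \<bar>k y\<bar> + 3/2 * \<bar>k' y\<bar>) \<longlongrightarrow> 0) at_infinity" by simp
    have "norm (w y) \<le> 3/2 * \<bar>k y\<bar> + 3/2 * \<bar>k' y\<bar>" for y
    proof -
      have "\<bar>tanh y\<bar> * (\<bar>Q y\<bar> * \<bar>k y\<bar>) \<le> 1 * (3/2 * \<bar>k y\<bar>)"
        using tanh_real_bounds[of y] Q_le_3_2[of y] Q_pos[of y] by (intro mult_mono) auto
      moreover have "\<bar>Q y\<bar> * \<bar>k' y\<bar> \<le> 3/2 * \<bar>k' y\<bar>"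
        using Q_le_3_2[of y] Q_pos[of y] by (intro mult_right_mono) auto
      ultimately show ?thesis
        using abs_triangle_ineq[of "tanh y * (Q y * k y)" "Q y * k' y"] by (simp add: w_def abs_mult)
    qed
    then show "\<forall>\<^sub>F y in at_infinity. norm (w y) \<le> 3/2 * \<bar>k y\<bar> + 3/2 * \<bar>k' y\<bar>" by simp
  qed
  then have "(w \<longlongrightarrow> 0) at_top" by (rule tendsto_at_infinityD)
  moreover have "w = (\<lambda>_. w 0)" using w_const by blast
  ultimately have "w 0 = 0" by (metis tendsto_const_iff trivial_limit_at_top_linorder)
  then have "Q y * (tanh y * k y + k' y) = 0" for y using w_const[of y] by (simp add: w_def algebra_simps)
  then have k'_eq: "tanh y * k y + k' y = 0" for y using Q_pos[of y] by (metis less_irrefl mult_eq_0_iff)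
  have "((\<lambda>y. cosh y * k y) has_real_derivative 0) (at y)" for y
  proof -
    have "sinh y * k y + cosh y * k' y = cosh y * (tanh y * k y + k' y)"
      by (simp add: tanh_def algebra_simps)
    then show ?thesis
      using k'_eq[of y] by (auto intro!: derivative_eq_intros k simp: mult.commute)
  qed
  then have "cosh y * k y = cosh 0 * k 0" for y using DERIV_isconst_all by blast
  then have "k y = k 0 / sqrt 2 * Q y" for y by (simp add: Q_def field_simps)
  then show ?thesis by blast
qed

definition dQ :: "real \<Rightarrow> real" where "dQ y = - tanh y * Q y"
definition ddQ :: "real \<Rightarrow> real" where "ddQ y = (2 * (tanh y)\<^sup>2 - 1) * Q y"

lemma deriv_Q: "deriv Q = dQ"
  using Q_has_derivative by (auto intro!: ext DERIV_imp_deriv simp: dQ_def)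

lemma Q_has_derivative_dQ: "(Q has_real_derivative dQ y) (at y)"
  using Q_has_derivative by (simp add: dQ_def)

lemma dQ_has_derivative: "(dQ has_real_derivative ddQ y) (at y)"
  unfolding dQ_def [abs_def] ddQ_def
  by (rule derivative_eq_intros Q_has_derivative tanh_has_derivative refl | simp)+
     (simp add: algebra_simps power2_eq_square)

lemma ddQ_eq: "ddQ y = Q y - (Q y)\<^sup>2 * Q y"
  unfolding Q_squared ddQ_def by (simp add: algebra_simps)

lemma ddQ_has_derivative: "(ddQ has_real_derivative dQ y - 3 * (Q y)\<^sup>2 * dQ y) (at y)"
  unfolding ddQ_def [abs_def] dQ_def
  by (rule derivative_eq_intros Q_has_derivative tanh_has_derivative refl | simp)+
     (use Q_squared[of y] in algebra)

text \<open>
Gronwall's argument for \<open>f\<^sup>2 + f'\<^sup>2\<close>, with \<open>4\<close> as a bound for \<open>|2 - 3 Q\<^sup>2|\<close>.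
\<close>

lemma linear_ode_unique:
  fixes f f' :: "real \<Rightarrow> real"
  assumes f: "\<And>y. (f has_real_derivative f' y) (at y)"
    and f': "\<And>y. (f' has_real_derivative f y - 3 * (Q y)\<^sup>2 * f y) (at y)"
    and init: "f 0 = 0" "f' 0 = 0"
  shows "f y = 0"
proof -
  have pos: "f y = 0"
    if f: "\<And>y. (f has_real_derivative f' y) (at y)"
      and f': "\<And>y. (f' has_real_derivative f y - 3 * (Q y)\<^sup>2 * f y) (at y)"
      and init: "f 0 = 0" "f' 0 = 0" and "0 \<le> y" for f f' y
  proof -
    define e where "e y = (f y)\<^sup>2 + (f' y)\<^sup>2" for y
    define e' where "e' y = 2 * (f y * f' y) * (2 - 3 * (Q y)\<^sup>2)" for y
    have e: "(e has_real_derivative e' y) (at y)" for y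
      unfolding e_def [abs_def] e'_def
      by (rule derivative_eq_intros f f' refl | simp)+ (simp add: algebra_simps power2_eq_square)
    have e'_le: "e' y \<le> 4 * e y" for y
    proof -
      have "\<bar>2 * (f y * f' y)\<bar> \<le> e y"
        using zero_le_power2[of "f y - f' y"] zero_le_power2[of "f y + f' y"]
        by (simp add: e_def power2_diff power2_sum abs_le_iff)
      moreover have "\<bar>2 - 3 * (Q y)\<^sup>2\<bar> \<le> 4" using Q_squared_le[of y] zero_le_power2[of "Q y"] by argo
      ultimately have "\<bar>2 * (f y * f' y)\<bar> * \<bar>2 - 3 * (Q y)\<^sup>2\<bar> \<le> e y * 4" by (intro mult_mono) (auto simp: e_def)
      then show ?thesis unfolding e'_def abs_mult [symmetric] by linarith
    qed
    have "e y * exp (- 4 * y) \<le> e 0 * exp (- 4 * 0)"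
    proof (rule DERIV_nonpos_imp_nonincreasing[OF \<open>0 \<le> y\<close>])
      fix x
      have "((\<lambda>y. e y * exp (- 4 * y)) has_real_derivative (e' x - 4 * e x) * exp (- 4 * x)) (at x)"
        by (rule derivative_eq_intros e refl | simp)+ (simp add: algebra_simps)
      moreover have "(e' x - 4 * e x) * exp (- 4 * x) \<le> 0"
        using e'_le[of x] by (simp add: mult_nonpos_nonneg)
      ultimately show "\<exists>D. ((\<lambda>y. e y * exp (- 4 * y)) has_real_derivative D) (at x) \<and> D \<le> 0" by blast
    qed
    then have "e y * exp (- 4 * y) \<le> 0" using init by (simp add: e_def)
    then have "e y \<le> 0" by (simp add: mult_le_0_iff)
    then show ?thesis unfolding e_def by (smt (verit) power2_eq_square zero_le_power2 zero_eq_power2)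
  qed
  show ?thesis
  proof (cases "0 \<le> y")
    case False
    have r: "((\<lambda>y. g (- y)) has_real_derivative - g' (- y)) (at y)"
      if "\<And>y. (g has_real_derivative g' y) (at y)" for g g' :: "real \<Rightarrow> real" and y
      using has_vector_derivative_reflect[of g g'] that
      by (simp add: has_real_derivative_iff_has_vector_derivative)
    have "f (- (- y)) = 0"
    proof (rule pos[where f = "\<lambda>y. f (- y)" and f' = "\<lambda>y. - f' (- y)" and y = "- y"])
      show "((\<lambda>y. f (- y)) has_real_derivative - f' (- y)) (at y)" for y by (rule r[OF f])
      have "Q (- y) = Q y" for y by (simp add: Q_def)
      then show "((\<lambda>y. - f' (- y)) has_real_derivative f (- y) - 3 * (Q y)\<^sup>2 * f (- y)) (at y)" for y
        using DERIV_minus[OF r[OF f', of y]] by simp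
    qed (use init False in auto)
    then show ?thesis by simp
  qed (use pos[OF f f' init] in simp)
qed

text \<open>
The Wronskian with \<open>Q'\<close> vanishes. Since \<open>Q'\<close> has a zero at the origin, one cannot divide by it; but
the same zero shows \<open>f 0 = 0\<close>, so a multiple of \<open>Q'\<close> has the initial values of \<open>f\<close>.
\<close>

lemma kernel_L_plus:
  fixes f f' :: "real \<Rightarrow> real"
  assumes f: "\<And>y. (f has_real_derivative f' y) (at y)"
    and f': "\<And>y. (f' has_real_derivative f y - 3 * (Q y)\<^sup>2 * f y) (at y)"
    and lim: "(f \<longlongrightarrow> 0) at_infinity" "(f' \<longlongrightarrow> 0) at_infinity"
  shows "\<exists>a. \<forall>y. f y = a * dQ y"
proof -
  define w where "w y = dQ y * f' y - ddQ y * f y" for y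
  have "(w has_real_derivative 0) (at y)" for y
    unfolding w_def [abs_def]
    by (rule derivative_eq_intros f f' dQ_has_derivative ddQ_has_derivative refl | simp)+ (simp add: algebra_simps)
  then have w_const: "w y = w 0" for y using DERIV_isconst_all by blast
  have b: "\<bar>dQ y\<bar> \<le> 3/2" "\<bar>ddQ y\<bar> \<le> 3/2" for y
  proof -
    have t: "(tanh y)\<^sup>2 \<le> 1" using Q_squared_le[of y] Q_squared[of y] zero_le_power2[of "Q y"] by argo
    have "\<bar>tanh y\<bar> * \<bar>Q y\<bar> \<le> 1 * (3/2)"
      using tanh_real_bounds[of y] Q_le_3_2[of y] Q_pos[of y] by (intro mult_mono) auto
    then show "\<bar>dQ y\<bar> \<le> 3/2" by (simp add: dQ_def abs_mult)
    have "\<bar>2 * (tanh y)\<^sup>2 - 1\<bar> * \<bar>Q y\<bar> \<le> 1 * (3/2)"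
      using t Q_le_3_2[of y] Q_pos[of y] by (intro mult_mono) (auto simp: abs_le_iff)
    then show "\<bar>ddQ y\<bar> \<le> 3/2" by (simp add: ddQ_def abs_mult)
  qed
  have "(w \<longlongrightarrow> 0) at_infinity"
  proof (rule Lim_null_comparison)
    have "((\<lambda>y. 3/2 * \<bar>f' y\<bar> + 3/2 * \<bar>f y\<bar>) \<longlongrightarrow> 3/2 * \<bar>0\<bar> + 3/2 * \<bar>0\<bar>) at_infinity"
      by (intro tendsto_intros lim)
    then show "((\<lambda>y. 3/2 * \<bar>f' y\<bar> + 3/2 * \<bar>f y\<bar>) \<longlongrightarrow> 0) at_infinity" by simp
    have "norm (w y) \<le> 3/2 * \<bar>f' y\<bar> + 3/2 * \<bar>f y\<bar>" for y
      using mult_right_mono[OF b(1)[of y], of "\<bar>f' y\<bar>"] mult_right_mono[OF b(2)[of y], of "\<bar>f y\<bar>"]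
        abs_triangle_ineq4[of "dQ y * f' y" "ddQ y * f y"] by (simp add: w_def abs_mult)
    then show "\<forall>\<^sub>F y in at_infinity. norm (w y) \<le> 3/2 * \<bar>f' y\<bar> + 3/2 * \<bar>f y\<bar>" by simp
  qed
  then have "(w \<longlongrightarrow> 0) at_top" by (rule tendsto_at_infinityD)
  moreover have "w = (\<lambda>_. w 0)" using w_const by blast
  ultimately have "w 0 = 0" by (metis tendsto_const_iff trivial_limit_at_top_linorder)
  then have f0: "f 0 = 0" using Q_pos[of 0] by (simp add: w_def dQ_def ddQ_def)
  define a where "a = f' 0 / ddQ 0"
  have "ddQ 0 \<noteq> 0" using Q_pos[of 0] by (simp add: ddQ_def)
  have "f y - a * dQ y = 0" for y
  proof (rule linear_ode_unique[where f = "\<lambda>y. f y - a * dQ y" and f' = "\<lambda>y. f' y - a * ddQ y"])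
    show "((\<lambda>y. f y - a * dQ y) has_real_derivative f' y - a * ddQ y) (at y)" for y
      by (auto intro!: derivative_eq_intros f dQ_has_derivative)
    show "((\<lambda>y. f' y - a * ddQ y) has_real_derivative
        f y - a * dQ y - 3 * (Q y)\<^sup>2 * (f y - a * dQ y)) (at y)" for y
      by (rule derivative_eq_intros f' ddQ_has_derivative refl | simp)+ (simp add: algebra_simps)
    show "f 0 - a * dQ 0 = 0" by (simp add: f0 dQ_def)
    show "f' 0 - a * ddQ 0 = 0" using \<open>ddQ 0 \<noteq> 0\<close> by (simp add: a_def)
  qed
  then have "\<forall>y. f y = a * dQ y" by simp
  then show ?thesis by blast
qed

section \<open>The classical real system\<close>

text \<open>
The transport equations appear solved for the single derivatives: for \<open>\<beta>\<^sup>2 \<noteq> 1\<close> the left-hand sides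
\<open>f' - \<beta> g'\<close> and \<open>g' - \<beta> f'\<close> determine \<open>f'\<close> and \<open>g'\<close>.
\<close>

locale classical_mode =
  fixes \<beta> \<omega> l :: real and c1 s1 c2 s2 cn sn cv sv c1' s1' c2' s2' :: "real \<Rightarrow> real"
  assumes c1: "\<And>y. (c1 has_real_derivative c1' y) (at y)"
    and c1': "\<And>y. (c1' has_real_derivative c1 y - 3 * (Q y)\<^sup>2 * c1 y - (- l * s2 y + Q y * cn y)) (at y)"
    and s1: "\<And>y. (s1 has_real_derivative s1' y) (at y)"
    and s1': "\<And>y. (s1' has_real_derivative s1 y - 3 * (Q y)\<^sup>2 * s1 y - (l * c2 y + Q y * sn y)) (at y)"
    and c2: "\<And>y. (c2 has_real_derivative c2' y) (at y)"
    and c2': "\<And>y. (c2' has_real_derivative c2 y - (Q y)\<^sup>2 * c2 y - l * s1 y) (at y)"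
    and s2: "\<And>y. (s2 has_real_derivative s2' y) (at y)"
    and s2': "\<And>y. (s2' has_real_derivative s2 y - (Q y)\<^sup>2 * s2 y - - l * c1 y) (at y)"
    and cn: "\<And>y. (cn has_real_derivative (1 / (1 - \<beta>\<^sup>2)) * (- l * sqrt \<omega> * (sv y + 2 * \<beta> * Q y * s1 y)
        + \<beta> * (- l * sqrt \<omega> * (sn y + 2 * Q y * s1 y)))) (at y)"
    and cv: "\<And>y. (cv has_real_derivative (1 / (1 - \<beta>\<^sup>2)) * (- l * sqrt \<omega> * (sn y + 2 * Q y * s1 y)
        + \<beta> * (- l * sqrt \<omega> * (sv y + 2 * \<beta> * Q y * s1 y)))) (at y)"
    and sn: "\<And>y. (sn has_real_derivative (1 / (1 - \<beta>\<^sup>2)) * (l * sqrt \<omega> * (cv y + 2 * \<beta> * Q y * c1 y)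
        + \<beta> * (l * sqrt \<omega> * (cn y + 2 * Q y * c1 y)))) (at y)"
    and sv: "\<And>y. (sv has_real_derivative (1 / (1 - \<beta>\<^sup>2)) * (l * sqrt \<omega> * (cn y + 2 * Q y * c1 y)
        + \<beta> * (l * sqrt \<omega> * (cv y + 2 * \<beta> * Q y * c1 y)))) (at y)"
    and lim: "(c1 \<longlongrightarrow> 0) at_infinity" "(s1 \<longlongrightarrow> 0) at_infinity" "(c2 \<longlongrightarrow> 0) at_infinity" "(s2 \<longlongrightarrow> 0) at_infinity"
      "(c1' \<longlongrightarrow> 0) at_infinity" "(s1' \<longlongrightarrow> 0) at_infinity" "(c2' \<longlongrightarrow> 0) at_infinity" "(s2' \<longlongrightarrow> 0) at_infinity"
      "(cn \<longlongrightarrow> 0) at_infinity" "(sn \<longlongrightarrow> 0) at_infinity" "(cv \<longlongrightarrow> 0) at_infinity" "(sv \<longlongrightarrow> 0) at_infinity"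
begin

lemma vanishes_of_positive:
  assumes \<beta>: "- 1 < \<beta>" "\<beta> < 1" and \<omega>: "0 < \<omega>" "\<omega> < ((1 - \<bar>\<beta>\<bar>) / (4 * 10^13))\<^sup>2" and l: "0 < l"
  shows "c1 y = 0 \<and> s1 y = 0 \<and> c2 y = 0 \<and> s2 y = 0 \<and> cn y = 0 \<and> sn y = 0 \<and> cv y = 0 \<and> sv y = 0"
proof -
  define \<mu> \<nu> s where "\<mu> = l * sqrt \<omega> / (1 - \<beta>)" and "\<nu> = l * sqrt \<omega> / (1 + \<beta>)"
    and "s = sqrt \<omega> / (1 - \<bar>\<beta>\<bar>)"
  have d: "0 < 1 - \<bar>\<beta>\<bar>" using \<beta> by simp
  define K K' F F' Z W where "K y = - of_real (s2 y) + \<i> * of_real (c2 y)"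
    and "K' y = - of_real (s2' y) + \<i> * of_real (c2' y)"
    and "F y = of_real (c1 y) + \<i> * of_real (s1 y)"
    and "F' y = of_real (c1' y) + \<i> * of_real (s1' y)"
    and "Z y = of_real (cn y + cv y) + \<i> * of_real (sn y + sv y)"
    and "W y = of_real (cn y - cv y) + \<i> * of_real (sn y - sv y)" for y
  have b1: "1 - \<beta>\<^sup>2 = (1 - \<beta>) * (1 + \<beta>)" by (simp add: power2_eq_square algebra_simps)
  have b2: "1 / (1 - \<beta>\<^sup>2) * (1 + \<beta>) = 1 / (1 - \<beta>)" "1 / (1 - \<beta>\<^sup>2) * (1 - \<beta>) = 1 / (1 + \<beta>)"
    unfolding b1 using \<beta> by simp_all
  define A where "A = 1 / (1 - \<beta>\<^sup>2)"
  have \<mu>A: "\<mu> = l * sqrt \<omega> * (A * (1 + \<beta>))" "\<nu> = l * sqrt \<omega> * (A * (1 - \<beta>))"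
    unfolding A_def b2 by (simp_all add: \<mu>_def \<nu>_def)
  have pair: "((\<lambda>y. of_real (f y) + \<i> * of_real (g y)) has_vector_derivative of_real f1 + \<i> * of_real g1) (at y)"
    if "(f has_real_derivative f1) (at y)" "(g has_real_derivative g1) (at y)" for f g f1 g1 y
    by (rule has_vector_derivative_eq_rhs,
        (rule vderiv_intros has_vector_derivative_of_real that)+) simp
  have pair_lim: "((\<lambda>y. of_real (f y) + \<i> * of_real (g y)) \<longlongrightarrow> (0::complex)) at_infinity"
    if "(f \<longlongrightarrow> 0) at_infinity" "(g \<longlongrightarrow> 0) at_infinity" for f g :: "real \<Rightarrow> real"
    using tendsto_add[OF tendsto_of_real[OF that(1)] tendsto_mult_left[OF tendsto_of_real[OF that(2)], of \<i>]] by simp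
  interpret zakharov_mode l \<mu> \<nu> "1 + \<beta>" "1 - \<beta>" K K' F F' Z W
  proof
    show "0 < \<mu>" "0 < \<nu>" using l \<omega> \<beta> by (simp_all add: \<mu>_def \<nu>_def)
    show "0 < l" by (rule l)
    show "0 < 1 + \<beta>" "1 + \<beta> < 2" "0 < 1 - \<beta>" "1 - \<beta> < 2" using \<beta> by auto
    fix y
    show "(K has_vector_derivative K' y) (at y)"
      using pair[OF DERIV_minus[OF s2] c2] by (simp add: K_def [abs_def] K'_def)
    show "(F has_vector_derivative F' y) (at y)"
      using pair[OF c1 s1] by (simp add: F_def [abs_def] F'_def)
    have "((\<lambda>y. of_real (- s2' y) + \<i> * of_real (c2' y)) has_vector_derivative
        K y - Qc y * Qc y * K y - of_real l * F y) (at y)"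
      by (rule has_vector_derivative_eq_rhs, rule pair[OF DERIV_minus[OF s2'] c2'])
         (simp add: K_def F_def Qc_def power2_eq_square algebra_simps)
    then show "(K' has_vector_derivative K y - Qc y * Qc y * K y - of_real l * F y) (at y)"
      by (simp add: K'_def [abs_def])
    have "((\<lambda>y. of_real (c1' y) + \<i> * of_real (s1' y)) has_vector_derivative
        F y - 3 * Qc y * Qc y * F y - of_real l * K y - Qc y * ((Z y + W y) / 2)) (at y)"
      by (rule has_vector_derivative_eq_rhs, rule pair[OF c1' s1'])
         (simp add: K_def F_def Z_def W_def Qc_def power2_eq_square algebra_simps)
    then show "(F' has_vector_derivative F y - 3 * Qc y * Qc y * F y - of_real l * K y - Qc y * ((Z y + W y) / 2)) (at y)"
      by (simp add: F'_def [abs_def])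
    show "(Z has_vector_derivative \<i> * of_real \<mu> * (Z y + 2 * of_real (1 + \<beta>) * Qc y * F y)) (at y)"
      unfolding Z_def [abs_def]
      by (rule has_vector_derivative_eq_rhs, rule pair[OF DERIV_add[OF cn cv] DERIV_add[OF sn sv]],
          unfold A_def [symmetric] \<mu>A)
         (simp add: complex_eq_iff F_def Qc_def; simp add: algebra_simps power2_eq_square)
    show "(W has_vector_derivative - \<i> * of_real \<nu> * (W y + 2 * of_real (1 - \<beta>) * Qc y * F y)) (at y)"
      unfolding W_def [abs_def]
      by (rule has_vector_derivative_eq_rhs, rule pair[OF DERIV_diff[OF cn cv] DERIV_diff[OF sn sv]],
          unfold A_def [symmetric] \<mu>A)
         (simp add: complex_eq_iff F_def Qc_def; simp add: algebra_simps power2_eq_square)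
    have m: "((\<lambda>y. - f y) \<longlongrightarrow> 0) at_infinity" if "(f \<longlongrightarrow> 0) at_infinity" for f :: "real \<Rightarrow> real"
      using tendsto_minus[OF that] by simp
    show "(K \<longlongrightarrow> 0) at_infinity" "(K' \<longlongrightarrow> 0) at_infinity"
      using pair_lim[OF m[OF lim(4)] lim(3)] pair_lim[OF m[OF lim(8)] lim(7)] by (simp_all add: K_def [abs_def] K'_def [abs_def])
    show "(F \<longlongrightarrow> 0) at_infinity" "(F' \<longlongrightarrow> 0) at_infinity"
      using pair_lim[OF lim(1,2)] pair_lim[OF lim(5,6)] by (simp_all add: F_def [abs_def] F'_def [abs_def])
    show "(Z \<longlongrightarrow> 0) at_infinity" "(W \<longlongrightarrow> 0) at_infinity"
      unfolding Z_def [abs_def] W_def [abs_def]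
      by (rule pair_lim; rule tendsto_add[OF lim(9,11), simplified] tendsto_add[OF lim(10,12), simplified]
        tendsto_diff[OF lim(9,11), simplified] tendsto_diff[OF lim(10,12), simplified])+
  qed
  have "sqrt \<omega> < (1 - \<bar>\<beta>\<bar>) / (4 * 10^13)"
    using real_sqrt_less_mono[OF \<omega>(2)] d by simp
  then have s_small: "s < 1 / (4 * 10^13)" using d by (simp add: s_def field_simps)
  have s0: "0 \<le> s" using d \<omega> by (simp add: s_def)
  have "l * sqrt \<omega> / (1 - \<beta>) \<le> l * sqrt \<omega> / (1 - \<bar>\<beta>\<bar>)" "l * sqrt \<omega> / (1 + \<beta>) \<le> l * sqrt \<omega> / (1 - \<bar>\<beta>\<bar>)"
    using l \<omega> d \<beta> by (intro divide_left_mono; simp)+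
  then have \<mu>s: "\<mu> \<le> s * l" "\<nu> \<le> s * l" by (simp_all add: \<mu>_def \<nu>_def s_def mult.commute)
  have all0: "K y = 0 \<and> F y = 0 \<and> Z y = 0 \<and> W y = 0"
  proof (cases "2 * 10^7 \<le> l")
    case True
    then show ?thesis using high_frequency \<mu>s s_small by simp
  next
    case False
    \<comment> \<open>The bound on \<open>\<omega>\<close> is chosen so that \<open>s l\<close> stays below \<open>10\<^sup>-\<^sup>6\<close> up to the frequency from
      which the other regime applies.\<close>
    have "s * l \<le> 1 / (4 * 10^13) * (2 * 10^7)"
      using s_small s0 False l by (intro mult_mono) auto
    then have "s * l \<le> 1 / 10^6" by simp
    then show ?thesis using low_frequency[OF _ _ \<mu>s] \<mu>s s_small by simp
  qed
  then show ?thesis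
    by (simp add: K_def F_def Z_def W_def complex_eq_iff)
qed

text \<open>
Conjugating the complexified system changes the signs of all sine components and of the frequency.
\<close>

lemma conjugate_mode:
  "classical_mode \<beta> \<omega> (- l) c1 (\<lambda>y. - s1 y) c2 (\<lambda>y. - s2 y) cn (\<lambda>y. - sn y) cv (\<lambda>y. - sv y)
    c1' (\<lambda>y. - s1' y) c2' (\<lambda>y. - s2' y)"
proof -
  have m: "((\<lambda>y. - f y) \<longlongrightarrow> 0) at_infinity" if "(f \<longlongrightarrow> 0) at_infinity" for f :: "real \<Rightarrow> real"
    using tendsto_minus[OF that] by simp
  have e1: "(c1' has_real_derivative c1 y - 3 * (Q y)\<^sup>2 * c1 y - (- (- l) * - s2 y + Q y * cn y)) (at y)" for y
    using c1'[of y] by simp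
  have e2: "((\<lambda>y. - s1' y) has_real_derivative - s1 y - 3 * (Q y)\<^sup>2 * - s1 y - (- l * c2 y + Q y * - sn y)) (at y)" for y
    using DERIV_minus[OF s1'[of y]] by (simp add: algebra_simps)
  have e3: "(c2' has_real_derivative c2 y - (Q y)\<^sup>2 * c2 y - - l * - s1 y) (at y)" for y
    using c2'[of y] by simp
  have e4: "((\<lambda>y. - s2' y) has_real_derivative - s2 y - (Q y)\<^sup>2 * - s2 y - - (- l) * c1 y) (at y)" for y
    using DERIV_minus[OF s2'[of y]] by (simp add: algebra_simps)
  have e5: "(cn has_real_derivative (1 / (1 - \<beta>\<^sup>2)) * (- (- l) * sqrt \<omega> * (- sv y + 2 * \<beta> * Q y * - s1 y)
        + \<beta> * (- (- l) * sqrt \<omega> * (- sn y + 2 * Q y * - s1 y)))) (at y)" for y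
    by (rule DERIV_cong[OF cn]) algebra
  have e6: "(cv has_real_derivative (1 / (1 - \<beta>\<^sup>2)) * (- (- l) * sqrt \<omega> * (- sn y + 2 * Q y * - s1 y)
        + \<beta> * (- (- l) * sqrt \<omega> * (- sv y + 2 * \<beta> * Q y * - s1 y)))) (at y)" for y
    by (rule DERIV_cong[OF cv]) algebra
  have e7: "((\<lambda>y. - sn y) has_real_derivative (1 / (1 - \<beta>\<^sup>2)) * (- l * sqrt \<omega> * (cv y + 2 * \<beta> * Q y * c1 y)
        + \<beta> * (- l * sqrt \<omega> * (cn y + 2 * Q y * c1 y)))) (at y)" for y
    by (rule DERIV_cong[OF DERIV_minus[OF sn]]) algebra
  have e8: "((\<lambda>y. - sv y) has_real_derivative (1 / (1 - \<beta>\<^sup>2)) * (- l * sqrt \<omega> * (cn y + 2 * Q y * c1 y)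
        + \<beta> * (- l * sqrt \<omega> * (cv y + 2 * \<beta> * Q y * c1 y)))) (at y)" for y
    by (rule DERIV_cong[OF DERIV_minus[OF sv]]) algebra
  show ?thesis
    by (rule classical_mode.intro[OF c1 e1 DERIV_minus[OF s1] e2 c2 e3 DERIV_minus[OF s2] e4 e5 e6 e7 e8
          lim(1) m[OF lim(2)] lim(3) m[OF lim(4)] lim(5) m[OF lim(6)] lim(7) m[OF lim(8)]
          lim(9) m[OF lim(10)] lim(11) m[OF lim(12)]])
qed

end

lemma (in classical_mode) vanishes:
  assumes \<beta>: "- 1 < \<beta>" "\<beta> < 1" and \<omega>: "0 < \<omega>" "\<omega> < ((1 - \<bar>\<beta>\<bar>) / (4 * 10^13))\<^sup>2" and l: "l \<noteq> 0"
  shows "c1 y = 0 \<and> s1 y = 0 \<and> c2 y = 0 \<and> s2 y = 0 \<and> cn y = 0 \<and> sn y = 0 \<and> cv y = 0 \<and> sv y = 0"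
proof (cases "0 < l")
  case True
  then show ?thesis by (rule vanishes_of_positive[OF \<beta> \<omega>])
next
  case False
  then have "0 < - l" using l by simp
  from classical_mode.vanishes_of_positive[OF conjugate_mode \<beta> \<omega> this, of y] show ?thesis by simp
qed

section \<open>From distributions to the classical system\<close>

text \<open>
A function in \<open>H\<^sup>1\<close> with this equation has a weak second derivative in \<open>L\<^sup>2\<close>; applying
\<open>weak_derivative_representative\<close> twice gives a continuously differentiable representative. The
source need not be continuous for this; whenever it has a continuous representative \<open>R\<close>, the equation holds
classically.
\<close>

lemma schroedinger_representative:
  assumes f: "f \<in> H1" and r: "r \<in> L2"
    and eq: "\<forall>\<phi>. test_function \<phi> \<longrightarrow> - dist_deriv (dist_deriv (dist_of f)) \<phi> + dist_of f \<phi>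
      - dist_of (\<lambda>y. c * (Q y)\<^sup>2 * f y) \<phi> = dist_of r \<phi>"
  obtains F F' where "continuous_on UNIV F" "eq_ae f F" "\<And>x. (F has_real_derivative F' x) (at x)"
    "\<And>R x. continuous_on UNIV R \<Longrightarrow> eq_ae r R \<Longrightarrow> (F' has_real_derivative F x - c * (Q x)\<^sup>2 * F x - R x) (at x)"
    "(F \<longlongrightarrow> 0) at_infinity"
    "\<And>R. continuous_on UNIV R \<Longrightarrow> eq_ae r R \<Longrightarrow> (F' \<longlongrightarrow> 0) at_infinity"
proof -
  obtain g where fL: "f \<in> L2" and g: "g \<in> L2" and fg: "weak_deriv f g" using f by (auto simp: H1_def)
  have Qf: "(\<lambda>y. c * (Q y)\<^sup>2 * f y) \<in> L2"
    by (rule L2_bounded_mult[OF fL, of _ "\<bar>c\<bar> * 2"])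
       (use Q_squared_le in \<open>auto intro!: continuous_intros Q_continuous mult_left_mono simp: abs_mult\<close>)
  define k where "k y = f y - c * (Q y)\<^sup>2 * f y - r y" for y
  have k: "k \<in> L2" unfolding k_def [abs_def] by (intro L2_diff fL Qf r)
  have gk: "weak_deriv g k"
    unfolding dist_eq_def dist_deriv_def
  proof (intro allI impI)
    fix \<phi> assume \<phi>: "test_function \<phi>"
    have "dist_deriv (dist_deriv (dist_of f)) \<phi> = - dist_of g (deriv \<phi>)"
      using weak_derivD[OF fg test_function_deriv(2)[OF \<phi>]] by (simp add: dist_deriv_def)
    then show "- dist_of g (deriv \<phi>) = dist_of k \<phi>"
      using eq[rule_format, OF \<phi>] by (simp add: k_def [abs_def] dist_of_diff L2_diff fL Qf r \<phi>)
  qed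
  obtain F where F: "continuous_on UNIV F" "eq_ae f F"
    "\<And>G x. continuous_on UNIV G \<Longrightarrow> eq_ae g G \<Longrightarrow> (F has_real_derivative G x) (at x)"
    using weak_derivative_representative[OF fL g fg] by metis
  obtain F' where F': "continuous_on UNIV F'" "eq_ae g F'"
    "\<And>G x. continuous_on UNIV G \<Longrightarrow> eq_ae k G \<Longrightarrow> (F' has_real_derivative G x) (at x)"
    using weak_derivative_representative[OF g k gk] by metis
  have d: "(F has_real_derivative F' x) (at x)" for x by (rule F(3)[OF F'(1,2)])
  have FL: "F \<in> L2" "F' \<in> L2" using L2_cong_AE fL F(2) g F'(2) by blast+
  have ce: "continuous_on UNIV (\<lambda>y. F y - c * (Q y)\<^sup>2 * F y - R y)"
    if "continuous_on UNIV R" for R by (intro continuous_intros F Q_continuous that)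
  have ae: "eq_ae k (\<lambda>y. F y - c * (Q y)\<^sup>2 * F y - R y)" if "eq_ae r R" for R
    using F(2) that by eventually_elim (simp add: k_def)
  show ?thesis
  proof (rule that[OF F(1,2) d])
    show d': "(F' has_real_derivative F x - c * (Q x)\<^sup>2 * F x - R x) (at x)"
      if "continuous_on UNIV R" "eq_ae r R" for R x by (rule F'(3)[OF ce[OF that(1)] ae[OF that(2)]])
    show "(F \<longlongrightarrow> 0) at_infinity" by (rule vanishes_at_infinity[OF FL d F'(1)])
    show "(F' \<longlongrightarrow> 0) at_infinity" if "continuous_on UNIV R" "eq_ae r R" for R
      by (rule vanishes_at_infinity[OF FL(2) L2_cong_AE[OF k ae[OF that(2)]] d'[OF that] ce[OF that(1)]])
  qed
qed

lemma transport_solve: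
  assumes \<beta>: "\<beta>\<^sup>2 \<noteq> 1" and f: "f \<in> L2" and g: "g \<in> L2" and p: "p \<in> L2" and q: "q \<in> L2"
    and fg: "dist_eq (transport \<beta> f g) (dist_of p)" and gf: "dist_eq (transport \<beta> g f) (dist_of q)"
  shows "weak_deriv f (\<lambda>y. (1 / (1 - \<beta>\<^sup>2)) * (p y + \<beta> * q y))"
  unfolding dist_eq_def
proof (intro allI impI)
  fix \<phi> assume \<phi>: "test_function \<phi>"
  have "dist_of (\<lambda>y. (1 / (1 - \<beta>\<^sup>2)) * (p y + \<beta> * q y)) \<phi> = (1 / (1 - \<beta>\<^sup>2)) * (dist_of p \<phi> + \<beta> * dist_of q \<phi>)"
    by (simp only: dist_of_cmult dist_of_add[OF p L2_cmult[OF q] \<phi>])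
  moreover have "dist_of p \<phi> + \<beta> * dist_of q \<phi> = (1 - \<beta>\<^sup>2) * dist_deriv (dist_of f) \<phi>"
  proof -
    have "dist_of p \<phi> = dist_deriv (dist_of f) \<phi> - \<beta> * dist_deriv (dist_of g) \<phi>"
      "dist_of q \<phi> = dist_deriv (dist_of g) \<phi> - \<beta> * dist_deriv (dist_of f) \<phi>"
      using fg gf \<phi> by (simp_all add: dist_eq_def transport_def)
    then show ?thesis by (simp only:) (simp add: algebra_simps power2_eq_square)
  qed
  ultimately show "dist_deriv (dist_of f) \<phi> = dist_of (\<lambda>y. (1 / (1 - \<beta>\<^sup>2)) * (p y + \<beta> * q y)) \<phi>"
    using \<beta> by simp
qed

lemma wave_representative:
  assumes f: "f \<in> L2" and g: "g \<in> L2" and w: "weak_deriv f g"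
  obtains F where "continuous_on UNIV F" "eq_ae f F"
    "\<And>G x. continuous_on UNIV G \<Longrightarrow> eq_ae g G \<Longrightarrow> (F has_real_derivative G x) (at x)"
    "\<And>G. continuous_on UNIV G \<Longrightarrow> eq_ae g G \<Longrightarrow> (F \<longlongrightarrow> 0) at_infinity"
proof -
  obtain F where F: "continuous_on UNIV F" "eq_ae f F"
    "\<And>G x. continuous_on UNIV G \<Longrightarrow> eq_ae g G \<Longrightarrow> (F has_real_derivative G x) (at x)"
    using weak_derivative_representative[OF assms] by metis
  show ?thesis
  proof (rule that[of F, OF F(1,2)])
    show "(F has_real_derivative G x) (at x)" if "continuous_on UNIV G" "eq_ae g G" for G x by (rule F(3)[OF that])
    show "(F \<longlongrightarrow> 0) at_infinity" if "continuous_on UNIV G" "eq_ae g G" for G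
      by (rule vanishes_at_infinity[OF L2_cong_AE[OF f F(2)] L2_cong_AE[OF g that(2)] F(3)[OF that] that(1)])
  qed
qed

lemma H1_L2: "f \<in> H1 \<Longrightarrow> f \<in> L2"
  by (simp add: H1_def)

lemma L2_Q_mult: "f \<in> L2 \<Longrightarrow> (\<lambda>y. Q y * f y) \<in> L2"
  by (rule L2_bounded_mult[OF _ Q_continuous, of _ "3/2"]) (use Q_pos Q_le_3_2 in \<open>auto simp: abs_of_pos\<close>)

lemma L_plus_equation:
  "dist_eq (L_plus f) (dist_of r) \<Longrightarrow> \<forall>\<phi>. test_function \<phi> \<longrightarrow> - dist_deriv (dist_deriv (dist_of f)) \<phi> + dist_of f \<phi>
      - dist_of (\<lambda>y. 3 * (Q y)\<^sup>2 * f y) \<phi> = dist_of r \<phi>"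
  by (simp add: dist_eq_def L_plus_def)

lemma L_minus_equation:
  "dist_eq (L_minus f) (dist_of r) \<Longrightarrow> \<forall>\<phi>. test_function \<phi> \<longrightarrow> - dist_deriv (dist_deriv (dist_of f)) \<phi> + dist_of f \<phi>
      - dist_of (\<lambda>y. 1 * (Q y)\<^sup>2 * f y) \<phi> = dist_of r \<phi>"
  by (simp add: dist_eq_def L_minus_def)

lemma nonzero_frequency_trivial:
  assumes \<beta>: "- 1 < \<beta>" "\<beta> < 1" and \<omega>: "0 < \<omega>" "\<omega> < ((1 - \<bar>\<beta>\<bar>) / (4 * 10^13))\<^sup>2" and l: "l \<noteq> 0"
    and H: "C1 \<in> H1" "S1 \<in> H1" "C2 \<in> H1" "S2 \<in> H1"
    and L: "CN \<in> L2" "SN \<in> L2" "CV \<in> L2" "SV \<in> L2"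
    and S: "schroedinger_part l C1 S1 C2 S2 CN SN" and W: "wave_part \<beta> \<omega> l C1 S1 CN SN CV SV"
  shows "eq_ae C1 (\<lambda>_. 0) \<and> eq_ae S1 (\<lambda>_. 0) \<and> eq_ae C2 (\<lambda>_. 0) \<and> eq_ae S2 (\<lambda>_. 0) \<and>
     eq_ae CN (\<lambda>_. 0) \<and> eq_ae SN (\<lambda>_. 0) \<and> eq_ae CV (\<lambda>_. 0) \<and> eq_ae SV (\<lambda>_. 0)"
proof -
  note HL = H[THEN H1_L2]
  have S': "dist_eq (L_minus C2) (dist_of (\<lambda>y. l * S1 y))"
    "dist_eq (L_plus S1) (dist_of (\<lambda>y. l * C2 y + Q y * SN y))"
    "dist_eq (L_minus S2) (dist_of (\<lambda>y. - l * C1 y))"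
    "dist_eq (L_plus C1) (dist_of (\<lambda>y. - l * S2 y + Q y * CN y))"
    using S by (simp_all add: schroedinger_part_def)
  have W': "dist_eq (transport \<beta> CV CN) (dist_of (\<lambda>y. - l * sqrt \<omega> * (SN y + 2 * Q y * S1 y)))"
    "dist_eq (transport \<beta> SV SN) (dist_of (\<lambda>y. l * sqrt \<omega> * (CN y + 2 * Q y * C1 y)))"
    "dist_eq (transport \<beta> CN CV) (dist_of (\<lambda>y. - l * sqrt \<omega> * (SV y + 2 * \<beta> * Q y * S1 y)))"
    "dist_eq (transport \<beta> SN SV) (dist_of (\<lambda>y. l * sqrt \<omega> * (CV y + 2 * \<beta> * Q y * C1 y)))"
    using W by (simp_all add: wave_part_def)
  have source: "(\<lambda>y. a * (f y + b * Q y * g y)) \<in> L2" if "f \<in> L2" "g \<in> L2" for a b f g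
    using L2_cmult[OF L2_add[OF that(1) L2_cmult[OF L2_Q_mult[OF that(2)], of b]], of a] by (simp add: mult.assoc)
  note src = source[OF L(2) HL(2), of "- l * sqrt \<omega>" 2] source[OF L(1) HL(1), of "l * sqrt \<omega>" 2]
    source[OF L(4) HL(2), of "- l * sqrt \<omega>" "2 * \<beta>"] source[OF L(3) HL(1), of "l * sqrt \<omega>" "2 * \<beta>"]
  have \<beta>2: "\<beta>\<^sup>2 \<noteq> 1" using \<beta> by (simp add: power2_eq_1_iff)
  have comb: "(\<lambda>y. (1 / (1 - \<beta>\<^sup>2)) * (p y + \<beta> * q y)) \<in> L2" if "p \<in> L2" "q \<in> L2" for p q
    by (intro L2_cmult L2_add that)
  obtain c2 c2' where c2: "continuous_on UNIV c2" "eq_ae C2 c2" "\<And>x. (c2 has_real_derivative c2' x) (at x)"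
    "\<And>R x. continuous_on UNIV R \<Longrightarrow> eq_ae (\<lambda>y. l * S1 y) R \<Longrightarrow> (c2' has_real_derivative c2 x - 1 * (Q x)\<^sup>2 * c2 x - R x) (at x)"
    "(c2 \<longlongrightarrow> 0) at_infinity" "\<And>R. continuous_on UNIV R \<Longrightarrow> eq_ae (\<lambda>y. l * S1 y) R \<Longrightarrow> (c2' \<longlongrightarrow> 0) at_infinity"
    by (rule schroedinger_representative[OF H(3) L2_cmult[OF HL(2)] L_minus_equation[OF S'(1)]], rule that)
  obtain s2 s2' where s2: "continuous_on UNIV s2" "eq_ae S2 s2" "\<And>x. (s2 has_real_derivative s2' x) (at x)"
    "\<And>R x. continuous_on UNIV R \<Longrightarrow> eq_ae (\<lambda>y. - l * C1 y) R \<Longrightarrow> (s2' has_real_derivative s2 x - 1 * (Q x)\<^sup>2 * s2 x - R x) (at x)"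
    "(s2 \<longlongrightarrow> 0) at_infinity" "\<And>R. continuous_on UNIV R \<Longrightarrow> eq_ae (\<lambda>y. - l * C1 y) R \<Longrightarrow> (s2' \<longlongrightarrow> 0) at_infinity"
    by (rule schroedinger_representative[OF H(4) L2_cmult[OF HL(1)] L_minus_equation[OF S'(3)]], rule that)
  obtain s1 s1' where s1: "continuous_on UNIV s1" "eq_ae S1 s1" "\<And>x. (s1 has_real_derivative s1' x) (at x)"
    "\<And>R x. continuous_on UNIV R \<Longrightarrow> eq_ae (\<lambda>y. l * C2 y + Q y * SN y) R \<Longrightarrow> (s1' has_real_derivative s1 x - 3 * (Q x)\<^sup>2 * s1 x - R x) (at x)"
    "(s1 \<longlongrightarrow> 0) at_infinity" "\<And>R. continuous_on UNIV R \<Longrightarrow> eq_ae (\<lambda>y. l * C2 y + Q y * SN y) R \<Longrightarrow> (s1' \<longlongrightarrow> 0) at_infinity"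
    by (rule schroedinger_representative[OF H(2) L2_add[OF L2_cmult[OF HL(3)] L2_Q_mult[OF L(2)]] L_plus_equation[OF S'(2)]], rule that)
  obtain c1 c1' where c1: "continuous_on UNIV c1" "eq_ae C1 c1" "\<And>x. (c1 has_real_derivative c1' x) (at x)"
    "\<And>R x. continuous_on UNIV R \<Longrightarrow> eq_ae (\<lambda>y. - l * S2 y + Q y * CN y) R \<Longrightarrow> (c1' has_real_derivative c1 x - 3 * (Q x)\<^sup>2 * c1 x - R x) (at x)"
    "(c1 \<longlongrightarrow> 0) at_infinity" "\<And>R. continuous_on UNIV R \<Longrightarrow> eq_ae (\<lambda>y. - l * S2 y + Q y * CN y) R \<Longrightarrow> (c1' \<longlongrightarrow> 0) at_infinity"
    by (rule schroedinger_representative[OF H(1) L2_add[OF L2_cmult[OF HL(4)] L2_Q_mult[OF L(1)]] L_plus_equation[OF S'(4)]], rule that)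
  let ?rcv = "\<lambda>SN S1 SV y. (1 / (1 - \<beta>\<^sup>2)) * (- l * sqrt \<omega> * (SN y + 2 * Q y * S1 y)
        + \<beta> * (- l * sqrt \<omega> * (SV y + 2 * \<beta> * Q y * S1 y)))"
  let ?rcn = "\<lambda>SN S1 SV y. (1 / (1 - \<beta>\<^sup>2)) * (- l * sqrt \<omega> * (SV y + 2 * \<beta> * Q y * S1 y)
        + \<beta> * (- l * sqrt \<omega> * (SN y + 2 * Q y * S1 y)))"
  let ?rsv = "\<lambda>CN C1 CV y. (1 / (1 - \<beta>\<^sup>2)) * (l * sqrt \<omega> * (CN y + 2 * Q y * C1 y)
        + \<beta> * (l * sqrt \<omega> * (CV y + 2 * \<beta> * Q y * C1 y)))"
  let ?rsn = "\<lambda>CN C1 CV y. (1 / (1 - \<beta>\<^sup>2)) * (l * sqrt \<omega> * (CV y + 2 * \<beta> * Q y * C1 y)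
        + \<beta> * (l * sqrt \<omega> * (CN y + 2 * Q y * C1 y)))"
  obtain cv where cv: "continuous_on UNIV cv" "eq_ae CV cv"
    "\<And>G x. continuous_on UNIV G \<Longrightarrow> eq_ae (?rcv SN S1 SV) G \<Longrightarrow> (cv has_real_derivative G x) (at x)"
    "\<And>G. continuous_on UNIV G \<Longrightarrow> eq_ae (?rcv SN S1 SV) G \<Longrightarrow> (cv \<longlongrightarrow> 0) at_infinity"
    by (rule wave_representative[OF L(3) comb[OF src(1,3)] transport_solve[OF \<beta>2 L(3,1) src(1,3) W'(1,3)]], rule that)
  obtain cn where cn: "continuous_on UNIV cn" "eq_ae CN cn"
    "\<And>G x. continuous_on UNIV G \<Longrightarrow> eq_ae (?rcn SN S1 SV) G \<Longrightarrow> (cn has_real_derivative G x) (at x)"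
    "\<And>G. continuous_on UNIV G \<Longrightarrow> eq_ae (?rcn SN S1 SV) G \<Longrightarrow> (cn \<longlongrightarrow> 0) at_infinity"
    by (rule wave_representative[OF L(1) comb[OF src(3,1)] transport_solve[OF \<beta>2 L(1,3) src(3,1) W'(3,1)]], rule that)
  obtain sv where sv: "continuous_on UNIV sv" "eq_ae SV sv"
    "\<And>G x. continuous_on UNIV G \<Longrightarrow> eq_ae (?rsv CN C1 CV) G \<Longrightarrow> (sv has_real_derivative G x) (at x)"
    "\<And>G. continuous_on UNIV G \<Longrightarrow> eq_ae (?rsv CN C1 CV) G \<Longrightarrow> (sv \<longlongrightarrow> 0) at_infinity"
    by (rule wave_representative[OF L(4) comb[OF src(2,4)] transport_solve[OF \<beta>2 L(4,2) src(2,4) W'(2,4)]], rule that)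
  obtain sn where sn: "continuous_on UNIV sn" "eq_ae SN sn"
    "\<And>G x. continuous_on UNIV G \<Longrightarrow> eq_ae (?rsn CN C1 CV) G \<Longrightarrow> (sn has_real_derivative G x) (at x)"
    "\<And>G. continuous_on UNIV G \<Longrightarrow> eq_ae (?rsn CN C1 CV) G \<Longrightarrow> (sn \<longlongrightarrow> 0) at_infinity"
    by (rule wave_representative[OF L(2) comb[OF src(4,2)] transport_solve[OF \<beta>2 L(2,4) src(4,2) W'(4,2)]], rule that)
  note cont = c1(1) s1(1) c2(1) s2(1) cn(1) sn(1) cv(1) sv(1)
  note ae = c1(2) s1(2) c2(2) s2(2) cn(2) sn(2) cv(2) sv(2)
  have r: "eq_ae (\<lambda>y. l * S1 y) (\<lambda>y. l * s1 y)" "eq_ae (\<lambda>y. - l * C1 y) (\<lambda>y. - l * c1 y)"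
    "eq_ae (\<lambda>y. l * C2 y + Q y * SN y) (\<lambda>y. l * c2 y + Q y * sn y)"
    "eq_ae (\<lambda>y. - l * S2 y + Q y * CN y) (\<lambda>y. - l * s2 y + Q y * cn y)"
    "eq_ae (?rcv SN S1 SV) (?rcv sn s1 sv)" "eq_ae (?rcn SN S1 SV) (?rcn sn s1 sv)"
    "eq_ae (?rsv CN C1 CV) (?rsv cn c1 cv)" "eq_ae (?rsn CN C1 CV) (?rsn cn c1 cv)"
    using ae by (eventually_elim, simp)+
  have rc: "continuous_on UNIV (\<lambda>y. l * s1 y)" "continuous_on UNIV (\<lambda>y. - l * c1 y)"
    "continuous_on UNIV (\<lambda>y. l * c2 y + Q y * sn y)" "continuous_on UNIV (\<lambda>y. - l * s2 y + Q y * cn y)"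
    "continuous_on UNIV (?rcv sn s1 sv)" "continuous_on UNIV (?rcn sn s1 sv)"
    "continuous_on UNIV (?rsv cn c1 cv)" "continuous_on UNIV (?rsn cn c1 cv)"
    by (intro continuous_intros cont Q_continuous)+
  have "classical_mode \<beta> \<omega> l c1 s1 c2 s2 cn sn cv sv c1' s1' c2' s2'"
    by (rule classical_mode.intro[OF c1(3) c1(4)[OF rc(4) r(4)] s1(3) s1(4)[OF rc(3) r(3)]
          c2(3) c2(4)[OF rc(1) r(1), unfolded mult_1_left] s2(3) s2(4)[OF rc(2) r(2), unfolded mult_1_left]
          cn(3)[OF rc(6) r(6)] cv(3)[OF rc(5) r(5)] sn(3)[OF rc(8) r(8)] sv(3)[OF rc(7) r(7)]
          c1(5) s1(5) c2(5) s2(5) c1(6)[OF rc(4) r(4)] s1(6)[OF rc(3) r(3)] c2(6)[OF rc(1) r(1)] s2(6)[OF rc(2) r(2)]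
          cn(4)[OF rc(6) r(6)] sn(4)[OF rc(8) r(8)] cv(4)[OF rc(5) r(5)] sv(4)[OF rc(7) r(7)]])
  from classical_mode.vanishes[OF this \<beta> \<omega> l]
  have "c1 y = 0 \<and> s1 y = 0 \<and> c2 y = 0 \<and> s2 y = 0 \<and> cn y = 0 \<and> sn y = 0 \<and> cv y = 0 \<and> sv y = 0" for y .
  then show ?thesis using ae by simp
qed

section \<open>Frequency zero and the converse\<close>

lemma zero_of_deriv_zero:
  fixes F :: "real \<Rightarrow> real"
  assumes "\<And>x. (F has_real_derivative 0) (at x)" "(F \<longlongrightarrow> 0) at_infinity"
  shows "F x = 0"
proof -
  have "F = (\<lambda>_. F 0)" using DERIV_isconst_all[of F] assms(1) by blast
  moreover have "(F \<longlongrightarrow> 0) at_top" using assms(2) by (rule tendsto_at_infinityD)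
  ultimately have "F 0 = 0" by (metis tendsto_const_iff trivial_limit_at_top_linorder)
  then show ?thesis using \<open>F = (\<lambda>_. F 0)\<close> by metis
qed

lemma L2_zero: "(\<lambda>_. 0) \<in> L2"
  by (simp add: L2_def)

lemma zero_frequency_kernel:
  assumes \<beta>: "- 1 < \<beta>" "\<beta> < 1" and H: "C1 \<in> H1" "C2 \<in> H1" and L: "CN \<in> L2" "CV \<in> L2"
    and S: "schroedinger_part 0 C1 S1 C2 S2 CN SN" and W: "wave_part \<beta> \<omega> 0 C1 S1 CN SN CV SV"
  shows "(\<exists>a. eq_ae C1 (\<lambda>y. a * deriv Q y)) \<and> (\<exists>b. eq_ae C2 (\<lambda>y. b * Q y)) \<and>
     eq_ae CN (\<lambda>_. 0) \<and> eq_ae CV (\<lambda>_. 0)"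
proof -
  have \<beta>2: "\<beta>\<^sup>2 \<noteq> 1" using \<beta> by (simp add: power2_eq_1_iff)
  have W': "dist_eq (transport \<beta> CV CN) (dist_of (\<lambda>_. 0))" "dist_eq (transport \<beta> CN CV) (dist_of (\<lambda>_. 0))"
    using W by (simp_all add: wave_part_def)
  have zero: "eq_ae f (\<lambda>_. 0)" if f: "f \<in> L2" and w: "weak_deriv f (\<lambda>y. (1 / (1 - \<beta>\<^sup>2)) * (0 + \<beta> * 0))" for f
  proof -
    have w': "weak_deriv f (\<lambda>_. 0)" using w by simp
    obtain F where F: "eq_ae f F"
      "\<And>G x. continuous_on UNIV G \<Longrightarrow> eq_ae (\<lambda>_. 0) G \<Longrightarrow> (F has_real_derivative G x) (at x)"
      "\<And>G. continuous_on UNIV G \<Longrightarrow> eq_ae (\<lambda>_. 0) G \<Longrightarrow> (F \<longlongrightarrow> 0) at_infinity"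
      by (rule wave_representative[OF f L2_zero w'], rule that)
    have "F x = 0" for x
      by (rule zero_of_deriv_zero) (use F(2,3)[of "\<lambda>_. 0"] in auto)
    then show ?thesis using F(1) by simp
  qed
  have CN: "eq_ae CN (\<lambda>_. 0)" by (rule zero[OF L(1) transport_solve[OF \<beta>2 L(1,2) L2_zero L2_zero W'(2,1)]])
  have CV: "eq_ae CV (\<lambda>_. 0)" by (rule zero[OF L(2) transport_solve[OF \<beta>2 L(2,1) L2_zero L2_zero W'(1,2)]])
  have S': "dist_eq (L_minus C2) (dist_of (\<lambda>_. 0))" "dist_eq (L_plus C1) (dist_of (\<lambda>y. Q y * CN y))"
    using S by (simp_all add: schroedinger_part_def)
  obtain k k' where k: "eq_ae C2 k" "\<And>x. (k has_real_derivative k' x) (at x)"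
    "\<And>R x. continuous_on UNIV R \<Longrightarrow> eq_ae (\<lambda>_. 0) R \<Longrightarrow> (k' has_real_derivative k x - 1 * (Q x)\<^sup>2 * k x - R x) (at x)"
    "(k \<longlongrightarrow> 0) at_infinity" "\<And>R. continuous_on UNIV R \<Longrightarrow> eq_ae (\<lambda>_. 0) R \<Longrightarrow> (k' \<longlongrightarrow> 0) at_infinity"
    by (rule schroedinger_representative[OF H(2) L2_zero L_minus_equation[OF S'(1)]], rule that)
  obtain f f' where f: "eq_ae C1 f" "\<And>x. (f has_real_derivative f' x) (at x)"
    "\<And>R x. continuous_on UNIV R \<Longrightarrow> eq_ae (\<lambda>y. Q y * CN y) R \<Longrightarrow> (f' has_real_derivative f x - 3 * (Q x)\<^sup>2 * f x - R x) (at x)"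
    "(f \<longlongrightarrow> 0) at_infinity" "\<And>R. continuous_on UNIV R \<Longrightarrow> eq_ae (\<lambda>y. Q y * CN y) R \<Longrightarrow> (f' \<longlongrightarrow> 0) at_infinity"
    by (rule schroedinger_representative[OF H(1) L2_Q_mult[OF L(1)] L_plus_equation[OF S'(2)]], rule that)
  have "\<exists>b. \<forall>y. k y = b * Q y"
    by (rule kernel_L_minus[OF k(2) _ k(4)]) (use k(3,5)[of "\<lambda>_. 0"] in auto)
  moreover have QCN: "eq_ae (\<lambda>y. Q y * CN y) (\<lambda>_. 0)" using CN by eventually_elim simp
  have "\<exists>a. \<forall>y. f y = a * dQ y"
    by (rule kernel_L_plus[OF f(2) _ f(4)]) (use f(3,5)[of "\<lambda>_. 0", OF _ QCN] in auto)
  ultimately obtain a b where "\<And>y. k y = b * Q y" "\<And>y. f y = a * dQ y" by blast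
  then have "eq_ae C1 (\<lambda>y. a * deriv Q y)" "eq_ae C2 (\<lambda>y. b * Q y)"
    using k(1) f(1) by (simp_all add: deriv_Q)
  then show ?thesis using CN CV by blast
qed

lemma Q_L2: "Q \<in> L2" and dQ_L2: "dQ \<in> L2" and ddQ_L2: "ddQ \<in> L2"
proof -
  have t: "tanh y * tanh y \<le> 1" "\<bar>tanh y\<bar> \<le> 1" for y :: real
    using tanh_real_bounds[of y] mult_mono[of "\<bar>tanh y\<bar>" 1 "\<bar>tanh y\<bar>" 1] by (auto simp: abs_le_iff)
  have tc: "continuous_on UNIV (tanh :: real \<Rightarrow> real)"
    using tanh_has_derivative by (auto intro!: continuous_at_imp_continuous_on DERIV_isCont)
  have m: "f \<in> borel_measurable lebesgue" if "continuous_on UNIV f" for f :: "real \<Rightarrow> real"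
    using borel_measurable_continuous_onI[OF that] by (intro measurable_completion) simp
  have "set_integrable lborel (einterval (- \<infinity>) \<infinity>) (\<lambda>y. (Q y)\<^sup>2)"
  proof (rule interval_integral_FTC_nonneg(1)[where F = "\<lambda>y. 2 * tanh y" and A = "- 2" and B = 2])
    show "((\<lambda>y. 2 * tanh y) has_real_derivative (Q y)\<^sup>2) (at y)" for y
      unfolding Q_squared by (intro DERIV_cmult tanh_has_derivative)
    show "isCont (\<lambda>y. (Q y)\<^sup>2) y" for y
      using Q_continuous by (auto intro!: continuous_intros simp: continuous_on_eq_continuous_at)
    have "((\<lambda>y::real. 2 * tanh y) \<longlongrightarrow> 2 * (- 1)) at_bot" "((\<lambda>y::real. 2 * tanh y) \<longlongrightarrow> 2 * 1) at_top"
      by (intro tendsto_intros tanh_real_at_bot tanh_real_at_top)+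
    then show "(((\<lambda>y. 2 * tanh y) \<circ> real_of_ereal) \<longlongrightarrow> - 2) (at_right (- \<infinity>))"
      "(((\<lambda>y. 2 * tanh y) \<circ> real_of_ereal) \<longlongrightarrow> 2) (at_left \<infinity>)"
      by (simp_all add: ereal_tendsto_simps)
  qed auto
  then have "integrable lborel (\<lambda>y. (Q y)\<^sup>2)" by (simp add: set_integrable_def)
  then have i: "integrable lebesgue (\<lambda>y. (Q y)\<^sup>2)"
    using borel_measurable_continuous_onI[OF Q_continuous] by (subst integrable_completion) auto
  then show "Q \<in> L2" using m[OF Q_continuous] by (simp add: L2_def)
  show "dQ \<in> L2"
  proof (rule L2_of_bound[OF _ m[OF Q_continuous] i])
    show "dQ \<in> borel_measurable lebesgue"
      unfolding dQ_def [abs_def] by (intro m continuous_intros tc Q_continuous)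
    show "\<bar>dQ y\<bar> \<le> 1 * \<bar>Q y\<bar>" for y
      using mult_right_mono[OF t(2)[of y], of "\<bar>Q y\<bar>"] by (simp add: dQ_def abs_mult)
  qed
  show "ddQ \<in> L2"
  proof (rule L2_of_bound[OF _ m[OF Q_continuous] i])
    show "ddQ \<in> borel_measurable lebesgue"
      unfolding ddQ_def [abs_def] by (intro m continuous_intros tc Q_continuous)
    have "\<bar>2 * (tanh y)\<^sup>2 - 1\<bar> \<le> 1" for y :: real
      using t(1)[of y] by (auto simp: abs_le_iff power2_eq_square)
    then show "\<bar>ddQ y\<bar> \<le> 1 * \<bar>Q y\<bar>" for y
      using mult_right_mono[of "\<bar>2 * (tanh y)\<^sup>2 - 1\<bar>" 1 "\<bar>Q y\<bar>"] by (simp add: ddQ_def abs_mult)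
  qed
qed

lemma dist_of_cong_AE:
  assumes "f \<in> L2" "eq_ae f g" "test_function \<phi>"
  shows "dist_of f \<phi> = dist_of g \<phi>"
  unfolding dist_of_def
proof (rule integral_cong_AE)
  have g: "g \<in> L2" by (rule L2_cong_AE[OF assms(1,2)])
  show "(\<lambda>y. f y * \<phi> y) \<in> borel_measurable lebesgue" "(\<lambda>y. g y * \<phi> y) \<in> borel_measurable lebesgue"
    using L2_test_integrable[OF assms(1,3)] L2_test_integrable[OF g assms(3)] by simp_all
  show "AE y in lebesgue. f y * \<phi> y = g y * \<phi> y" using assms(2) by eventually_elim simp
qed

lemma dist_of_zero: "eq_ae f (\<lambda>_. 0) \<Longrightarrow> dist_of f \<phi> = 0"
  unfolding dist_of_def by (rule integral_eq_zero_AE) (auto elim: eventually_mono)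

lemma L2_of_zero: "eq_ae f (\<lambda>_. 0) \<Longrightarrow> f \<in> L2"
  by (rule L2_cong_AE[OF L2_zero]) (auto elim: eventually_mono)

lemma H1_of_weak_deriv: "f \<in> L2 \<Longrightarrow> g \<in> L2 \<Longrightarrow> weak_deriv f g \<Longrightarrow> f \<in> H1"
  by (auto simp: H1_def)

lemma H1_of_zero: "eq_ae f (\<lambda>_. 0) \<Longrightarrow> f \<in> H1"
  by (rule H1_of_weak_deriv[OF L2_of_zero L2_zero])
     (auto simp: dist_eq_def dist_deriv_def dist_of_zero)

lemma weak_deriv_cong_AE:
  assumes "f \<in> L2" "eq_ae f F" "weak_deriv F g"
  shows "weak_deriv f g"
  using assms(3) dist_of_cong_AE[OF assms(1,2)] test_function_deriv(2)
  by (simp add: dist_eq_def dist_deriv_def)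

lemma schroedinger_of_classical:
  assumes F: "F \<in> L2" "F'' \<in> L2"
    and d: "\<And>x. (F has_real_derivative F' x) (at x)" "\<And>x. (F' has_real_derivative F'' x) (at x)"
    and c: "continuous_on UNIV F''" and f: "f \<in> L2" "eq_ae f F" and \<phi>: "test_function \<phi>"
    and eq: "\<And>y. F'' y = F y - c * (Q y)\<^sup>2 * F y"
  shows "- dist_deriv (dist_deriv (dist_of f)) \<phi> + dist_of f \<phi> - dist_of (\<lambda>y. c * (Q y)\<^sup>2 * f y) \<phi> = 0"
proof -
  note \<phi>' = test_function_deriv(2)[OF \<phi>]
  have cF': "continuous_on UNIV F'" using d(2) by (auto intro!: continuous_at_imp_continuous_on DERIV_isCont)
  have Qf: "(\<lambda>y. c * (Q y)\<^sup>2 * f y) \<in> L2"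
    by (rule L2_bounded_mult[OF f(1), of _ "\<bar>c\<bar> * 2"])
       (use Q_squared_le in \<open>auto intro!: continuous_intros Q_continuous mult_left_mono simp: abs_mult\<close>)
  have QF: "eq_ae (\<lambda>y. c * (Q y)\<^sup>2 * f y) (\<lambda>y. c * (Q y)\<^sup>2 * F y)" using f(2) by eventually_elim simp
  have QFL: "(\<lambda>y. c * (Q y)\<^sup>2 * F y) \<in> L2" by (rule L2_cong_AE[OF Qf QF])
  have "dist_deriv (dist_deriv (dist_of f)) \<phi> = dist_of f (deriv (deriv \<phi>))"
    by (simp add: dist_deriv_def)
  also have "\<dots> = dist_of F (deriv (deriv \<phi>))"
    by (rule dist_of_cong_AE[OF f test_function_deriv(2)[OF \<phi>']])
  also have "\<dots> = dist_of F'' \<phi>"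
    using weak_derivD[OF weak_deriv_of_deriv[OF d(1) cF'] \<phi>'] weak_derivD[OF weak_deriv_of_deriv[OF d(2) c] \<phi>] by simp
  finally have "- dist_deriv (dist_deriv (dist_of f)) \<phi> + dist_of f \<phi> - dist_of (\<lambda>y. c * (Q y)\<^sup>2 * f y) \<phi>
      = dist_of F \<phi> - dist_of (\<lambda>y. c * (Q y)\<^sup>2 * F y) \<phi> - dist_of F'' \<phi>"
    using dist_of_cong_AE[OF f \<phi>] dist_of_cong_AE[OF Qf QF \<phi>] by simp
  also have "\<dots> = dist_of (\<lambda>y. F y - c * (Q y)\<^sup>2 * F y - F'' y) \<phi>"
    by (simp add: dist_of_diff L2_diff F QFL \<phi>)
  also have "\<dots> = 0" by (rule dist_of_zero) (simp add: eq)
  finally show ?thesis .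
qed

text \<open>
Both families in the theorem at once: a zero solution at any frequency is the case \<open>a = b = 0\<close>.
\<close>

lemma kernel_solves:
  assumes C1: "eq_ae C1 (\<lambda>y. a * dQ y)" and C2: "eq_ae C2 (\<lambda>y. b * Q y)"
    and z: "eq_ae CN (\<lambda>_. 0)" "eq_ae CV (\<lambda>_. 0)" "eq_ae S1 (\<lambda>_. 0)" "eq_ae S2 (\<lambda>_. 0)"
      "eq_ae SN (\<lambda>_. 0)" "eq_ae SV (\<lambda>_. 0)"
    and l: "l = 0 \<or> (a = 0 \<and> b = 0)"
  shows "C1 \<in> H1 \<and> S1 \<in> H1 \<and> C2 \<in> H1 \<and> S2 \<in> H1 \<and> CN \<in> L2 \<and> SN \<in> L2 \<and> CV \<in> L2 \<and> SV \<in> L2 \<and>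
     schroedinger_part l C1 S1 C2 S2 CN SN \<and> wave_part \<beta> \<omega> l C1 S1 CN SN CV SV"
proof -
  have dd: "((\<lambda>y. a * dQ y) has_real_derivative a * ddQ x) (at x)"
    "((\<lambda>y. a * ddQ y) has_real_derivative a * (dQ x - 3 * (Q x)\<^sup>2 * dQ x)) (at x)"
    "((\<lambda>y. b * Q y) has_real_derivative b * dQ x) (at x)"
    "((\<lambda>y. b * dQ y) has_real_derivative b * ddQ x) (at x)" for x
    by (intro DERIV_cmult Q_has_derivative_dQ dQ_has_derivative ddQ_has_derivative)+
  have cQ: "continuous_on UNIV dQ" "continuous_on UNIV ddQ"
    using dQ_has_derivative ddQ_has_derivative by (auto intro!: continuous_at_imp_continuous_on DERIV_isCont)
  have L: "C1 \<in> L2" "C2 \<in> L2"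
    using L2_cong_AE[OF L2_cmult[OF dQ_L2, of a], of C1] L2_cong_AE[OF L2_cmult[OF Q_L2, of b], of C2] C1 C2
    by (auto simp: eq_commute)
  have dddQ_L2: "(\<lambda>y. a * (dQ y - 3 * (Q y)\<^sup>2 * dQ y)) \<in> L2"
  proof -
    have "(\<lambda>y. (3 * (Q y)\<^sup>2) * dQ y) \<in> L2"
      by (rule L2_bounded_mult[OF dQ_L2, of _ 6])
         (use Q_squared_le in \<open>auto intro!: continuous_intros Q_continuous simp: abs_mult\<close>)
    then show ?thesis by (intro L2_cmult L2_diff dQ_L2)
  qed
  have H: "C1 \<in> H1" "C2 \<in> H1"
    by (rule H1_of_weak_deriv[OF L(1) L2_cmult[OF ddQ_L2] weak_deriv_cong_AE[OF L(1) C1 weak_deriv_of_deriv[OF dd(1)]]],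
        intro continuous_intros cQ)
       (rule H1_of_weak_deriv[OF L(2) L2_cmult[OF dQ_L2] weak_deriv_cong_AE[OF L(2) C2 weak_deriv_of_deriv[OF dd(3)]]],
        intro continuous_intros cQ)
  have lC: "eq_ae (\<lambda>y. l * C1 y) (\<lambda>_. 0)" "eq_ae (\<lambda>y. l * C2 y) (\<lambda>_. 0)"
    using C1 C2 l by (auto elim: eventually_mono)
  have P: "dist_eq (L_plus C1) (dist_of (\<lambda>y. - l * S2 y + Q y * CN y))"
  proof -
    have "dist_of (\<lambda>y. - l * S2 y + Q y * CN y) \<phi> = 0" for \<phi>
      by (rule dist_of_zero) (use z in \<open>eventually_elim, simp\<close>)
    moreover have "L_plus C1 \<phi> = 0" if "test_function \<phi>" for \<phi>
    proof -
      have "continuous_on UNIV (\<lambda>y. a * (dQ y - 3 * (Q y)\<^sup>2 * dQ y))"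
        by (intro continuous_intros cQ Q_continuous)
      moreover have "a * (dQ y - 3 * (Q y)\<^sup>2 * dQ y) = a * dQ y - 3 * (Q y)\<^sup>2 * (a * dQ y)" for y
        by (simp add: algebra_simps)
      ultimately show ?thesis
        using schroedinger_of_classical[OF L2_cmult[OF dQ_L2] dddQ_L2 dd(1,2) _ L(1) C1 that, where c = 3]
        unfolding L_plus_def by blast
    qed
    ultimately show ?thesis by (simp add: dist_eq_def)
  qed
  have M: "dist_eq (L_minus C2) (dist_of (\<lambda>y. l * S1 y))"
  proof -
    have "dist_of (\<lambda>y. l * S1 y) \<phi> = 0" for \<phi>
      by (rule dist_of_zero) (use z in \<open>eventually_elim, simp\<close>)
    moreover have "L_minus C2 \<phi> = 0" if "test_function \<phi>" for \<phi>
    proof -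
      have "continuous_on UNIV (\<lambda>y. b * ddQ y)" by (intro continuous_intros cQ)
      moreover have "b * ddQ y = b * Q y - 1 * (Q y)\<^sup>2 * (b * Q y)" for y
        unfolding ddQ_eq by (simp add: algebra_simps)
      ultimately show ?thesis
        using schroedinger_of_classical[OF L2_cmult[OF Q_L2] L2_cmult[OF ddQ_L2] dd(3,4) _ L(2) C2 that, where c = 1]
        unfolding L_minus_def mult_1_left by blast
    qed
    ultimately show ?thesis by (simp add: dist_eq_def)
  qed
  have QS: "eq_ae (\<lambda>y. c * (Q y)\<^sup>2 * S1 y) (\<lambda>_. 0)" "eq_ae (\<lambda>y. c * (Q y)\<^sup>2 * S2 y) (\<lambda>_. 0)" for c
    using z by (eventually_elim, simp)+
  have r: "eq_ae (\<lambda>y. l * C2 y + Q y * SN y) (\<lambda>_. 0)" "eq_ae (\<lambda>y. - l * C1 y) (\<lambda>_. 0)"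
    "eq_ae (\<lambda>y. - l * sqrt \<omega> * (SN y + 2 * Q y * S1 y)) (\<lambda>_. 0)"
    "eq_ae (\<lambda>y. l * sqrt \<omega> * (CN y + 2 * Q y * C1 y)) (\<lambda>_. 0)"
    "eq_ae (\<lambda>y. - l * sqrt \<omega> * (SV y + 2 * \<beta> * Q y * S1 y)) (\<lambda>_. 0)"
    "eq_ae (\<lambda>y. l * sqrt \<omega> * (CV y + 2 * \<beta> * Q y * C1 y)) (\<lambda>_. 0)"
    using z lC by (eventually_elim, force)+
  have "dist_eq (L_plus S1) (dist_of (\<lambda>y. l * C2 y + Q y * SN y))"
    "dist_eq (L_minus S2) (dist_of (\<lambda>y. - l * C1 y))"
    using QS[of 1] QS[of 3] z r by (simp_all add: dist_eq_def L_plus_def L_minus_def dist_deriv_def dist_of_zero)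
  then have "schroedinger_part l C1 S1 C2 S2 CN SN" using P M by (simp add: schroedinger_part_def)
  moreover have "wave_part \<beta> \<omega> l C1 S1 CN SN CV SV"
    unfolding wave_part_def dist_eq_def transport_def dist_deriv_def
    by (intro conjI allI impI; simp only: dist_of_zero[OF r(3)] dist_of_zero[OF r(4)] dist_of_zero[OF r(5)]
        dist_of_zero[OF r(6)] dist_of_zero[OF z(1)] dist_of_zero[OF z(2)] dist_of_zero[OF z(5)] dist_of_zero[OF z(6)]; simp)
  ultimately show ?thesis using H z by (simp add: H1_of_zero L2_of_zero)
qed

section \<open>The point spectrum\<close>

theorem theorem2:
  fixes \<beta> :: real
  assumes "\<beta> \<in> {-1<..<1}"
  shows "\<exists>\<omega>\<^sub>0>0. \<forall>\<omega>\<in>{0<..<\<omega>\<^sub>0}. \<forall>l C1 S1 C2 S2 CN SN CV SV.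
    (C1 \<in> H1 \<and> S1 \<in> H1 \<and> C2 \<in> H1 \<and> S2 \<in> H1 \<and>
     CN \<in> L2 \<and> SN \<in> L2 \<and> CV \<in> L2 \<and> SV \<in> L2 \<and>
     (l = 0 \<longrightarrow> eq_ae S1 (\<lambda>_. 0) \<and> eq_ae S2 (\<lambda>_. 0) \<and> eq_ae SN (\<lambda>_. 0) \<and> eq_ae SV (\<lambda>_. 0)) \<and>
     schroedinger_part l C1 S1 C2 S2 CN SN \<and>
     wave_part \<beta> \<omega> l C1 S1 CN SN CV SV)
    \<longleftrightarrow>
    (l = 0 \<and> (\<exists>a. eq_ae C1 (\<lambda>y. a * deriv Q y)) \<and> (\<exists>b. eq_ae C2 (\<lambda>y. b * Q y)) \<and>
     eq_ae CN (\<lambda>_. 0) \<and> eq_ae CV (\<lambda>_. 0) \<and>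
     eq_ae S1 (\<lambda>_. 0) \<and> eq_ae S2 (\<lambda>_. 0) \<and> eq_ae SN (\<lambda>_. 0) \<and> eq_ae SV (\<lambda>_. 0))
    \<or>
    (eq_ae C1 (\<lambda>_. 0) \<and> eq_ae S1 (\<lambda>_. 0) \<and> eq_ae C2 (\<lambda>_. 0) \<and> eq_ae S2 (\<lambda>_. 0) \<and>
     eq_ae CN (\<lambda>_. 0) \<and> eq_ae SN (\<lambda>_. 0) \<and> eq_ae CV (\<lambda>_. 0) \<and> eq_ae SV (\<lambda>_. 0))"
    (is "\<exists>\<omega>\<^sub>0>0. \<forall>\<omega>\<in>{0<..<\<omega>\<^sub>0}. \<forall>l C1 S1 C2 S2 CN SN CV SV.
      ?solves \<omega> l C1 S1 C2 S2 CN SN CV SV \<longleftrightarrow> ?kernel l C1 S1 C2 S2 CN SN CV SV \<or> ?zero C1 S1 C2 S2 CN SN CV SV")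
proof (intro exI conjI ballI allI)
  have \<beta>: "- 1 < \<beta>" "\<beta> < 1" using assms by auto
  show "0 < ((1 - \<bar>\<beta>\<bar>) / (4 * 10^13))\<^sup>2" using \<beta> by simp
  fix \<omega> l C1 S1 C2 S2 CN SN CV SV
  assume "\<omega> \<in> {0<..<((1 - \<bar>\<beta>\<bar>) / (4 * 10^13))\<^sup>2}"
  then have \<omega>: "0 < \<omega>" "\<omega> < ((1 - \<bar>\<beta>\<bar>) / (4 * 10^13))\<^sup>2" by auto
  show "?solves \<omega> l C1 S1 C2 S2 CN SN CV SV \<longleftrightarrow> ?kernel l C1 S1 C2 S2 CN SN CV SV \<or> ?zero C1 S1 C2 S2 CN SN CV SV"
  proof
    assume s: "?solves \<omega> l C1 S1 C2 S2 CN SN CV SV"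
    show "?kernel l C1 S1 C2 S2 CN SN CV SV \<or> ?zero C1 S1 C2 S2 CN SN CV SV"
    proof (cases "l = 0")
      case True
      have "schroedinger_part 0 C1 S1 C2 S2 CN SN" "wave_part \<beta> \<omega> 0 C1 S1 CN SN CV SV"
        "C1 \<in> H1" "C2 \<in> H1" "CN \<in> L2" "CV \<in> L2" using s True by simp_all
      from zero_frequency_kernel[OF \<beta> this(3-6) this(1,2)] show ?thesis using s True by simp
    next
      case False
      from s show ?thesis
        by (elim conjE, intro disjI2 nonzero_frequency_trivial[OF \<beta> \<omega> False])
    qed
  next
    assume "?kernel l C1 S1 C2 S2 CN SN CV SV \<or> ?zero C1 S1 C2 S2 CN SN CV SV"
    then show "?solves \<omega> l C1 S1 C2 S2 CN SN CV SV"
    proof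
      assume k: "?kernel l C1 S1 C2 S2 CN SN CV SV"
      then obtain a b where "eq_ae C1 (\<lambda>y. a * dQ y)" "eq_ae C2 (\<lambda>y. b * Q y)" by (auto simp: deriv_Q)
      from kernel_solves[OF this, of CN CV S1 S2 SN SV l \<beta> \<omega>] show ?thesis using k by simp
    next
      assume z: "?zero C1 S1 C2 S2 CN SN CV SV"
      then show ?thesis using kernel_solves[of C1 0 C2 0 CN CV S1 S2 SN SV l \<beta> \<omega>] by simp
    qed
  qed
qed

end
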